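(* Let $n\geq5$ be an integer and $b>0$. For $0<a<\pi/2$ let $\varphi_a:B^n\to E^n(b)$ be the map $\varphi_a(x)=\left(\sin a\,\frac{x}{|x|},\,b\cos a\right)$. Then there exists $a\in(0,\pi/2)$ such that $\varphi_a$ is a proper weakly biharmonic map if and only if $$0<b^2<\frac{n-1}{2(n-4)}.$$
   Context: $B^n\subset\mathbb{R}^n$ is the Euclidean unit ball with centre $O$, and $E^n(b)=\left\{(x,y)\in\mathbb{R}^n\times\mathbb{R}: |x|^2+\frac{y^2}{b^2}=1\right\}$ is the rotationally symmetric ellipsoid with the Riemannian metric induced from $\mathbb{R}^{n+1}$. For a smooth map $\varphi:(M,g_M)\to(N,g_N)$ the tension field is $\tau(\varphi)=\mathrm{trace}_{g_M}\nabla d\varphi$; $\varphi$ is harmonic if $\tau(\varphi)=0$, and biharmonic if it is a critical point of the bienergy $E_2(\varphi)=\frac12\int_M|\tau(\varphi)|^2\,dV$. $W^{2,2}(B^n,E^n(b))$ is the set of $\varphi\in W^{2,2}(B^n,\mathbb{R}^{n+1})$ with $\varphi(x)\in E^n(b)$ a.e. A map in $W^{2,2}(B^n,E^n(b))$ is weakly biharmonic if it solves the Euler-Lagrange equation of $E_2$ in the sense of distributions. For the maps $\varphi_a$, which are smooth away from $O$, this is used in the equivalent form: $\varphi_a\in W^{2,2}(B^n,E^n(b))$ and $\varphi_a$ is biharmonic on $B^n\setminus\{O\}$. Such a map is proper if it is not (weakly) harmonic. *)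

theory Defs
  imports "HOL-Analysis.Analysis"
begin

section \<open>Smooth functions\<close>

definition dir_deriv ::
    "('a::real_normed_vector \<Rightarrow> 'b::real_normed_vector) \<Rightarrow> 'a \<Rightarrow> 'a \<Rightarrow> 'b" where
  "dir_deriv f v = (\<lambda>x. frechet_derivative f (at x) v)"

text \<open>Class \<open>C\<^sup>k\<close> and \<open>C\<^sup>\<infinity>\<close>. The definitions are meant for open \<open>S\<close>: derivatives are taken
  in the ambient space.\<close>

fun Ck_on :: "nat \<Rightarrow> 'a::euclidean_space set \<Rightarrow> ('a \<Rightarrow> 'b::real_normed_vector) \<Rightarrow> bool" where
  "Ck_on 0 S f \<longleftrightarrow> continuous_on S f"
| "Ck_on (Suc k) S f \<longleftrightarrow>
     (\<forall>x\<in>S. f differentiable (at x)) \<and> (\<forall>v. Ck_on k S (dir_deriv f v))"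

definition smooth_on :: "'a::euclidean_space set \<Rightarrow> ('a \<Rightarrow> 'b::real_normed_vector) \<Rightarrow> bool" where
  "smooth_on S f \<longleftrightarrow> (\<forall>k. Ck_on k S f)"


section \<open>Sobolev spaces\<close>

definition test_function :: "'a::euclidean_space set \<Rightarrow> ('a \<Rightarrow> real) \<Rightarrow> bool" where
  "test_function \<Omega> \<psi> \<longleftrightarrow>
     smooth_on UNIV \<psi> \<and> compact (closure {x. \<psi> x \<noteq> 0}) \<and> closure {x. \<psi> x \<noteq> 0} \<subseteq> \<Omega>"

definition L2_on :: "'a::euclidean_space set \<Rightarrow> ('a \<Rightarrow> 'b::euclidean_space) \<Rightarrow> bool" where
  "L2_on \<Omega> u \<longleftrightarrow>
     set_borel_measurable lebesgue \<Omega> u \<and> set_integrable lebesgue \<Omega> (\<lambda>x. (norm (u x))\<^sup>2)"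

text \<open>\<open>v\<close> is the distributional derivative of \<open>u\<close> in direction \<open>i\<close>. This is only used for
  \<open>u\<close> and \<open>v\<close> in \<open>L\<^sup>2(\<Omega>)\<close>, so that both integrals converge.\<close>

definition weak_deriv ::
    "'a::euclidean_space set \<Rightarrow> 'a \<Rightarrow> ('a \<Rightarrow> 'b::euclidean_space) \<Rightarrow> ('a \<Rightarrow> 'b) \<Rightarrow> bool" where
  "weak_deriv \<Omega> i u v \<longleftrightarrow>
     (\<forall>\<psi>. test_function \<Omega> \<psi> \<longrightarrow>
        (LINT x:\<Omega>|lebesgue. dir_deriv \<psi> i x *\<^sub>R u x) = - (LINT x:\<Omega>|lebesgue. \<psi> x *\<^sub>R v x))"

text \<open>\<open>sobolev k \<Omega> u\<close> says that \<open>u\<close> lies in \<open>W\<^sup>k\<^sup>,\<^sup>2(\<Omega>)\<close>: all weak partial derivatives of order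
  at most \<open>k\<close> exist and are square integrable.\<close>

fun sobolev ::
    "nat \<Rightarrow> 'a::euclidean_space set \<Rightarrow> ('a \<Rightarrow> 'b::euclidean_space) \<Rightarrow> bool" where
  "sobolev 0 \<Omega> u \<longleftrightarrow> L2_on \<Omega> u"
| "sobolev (Suc k) \<Omega> u \<longleftrightarrow>
     L2_on \<Omega> u \<and> (\<forall>i\<in>Basis. \<exists>v. weak_deriv \<Omega> i u v \<and> sobolev k \<Omega> v)"

definition sobolev_into ::
    "nat \<Rightarrow> 'a::euclidean_space set \<Rightarrow> 'b::euclidean_space set \<Rightarrow> ('a \<Rightarrow> 'b) \<Rightarrow> bool" where
  "sobolev_into k \<Omega> N u \<longleftrightarrow> sobolev k \<Omega> u \<and> (AE x in lebesgue. x \<in> \<Omega> \<longrightarrow> u x \<in> N)"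


section \<open>The ellipsoid\<close>

definition ellipsoid :: "real \<Rightarrow> ((real ^ 'n) \<times> real) set" where
  "ellipsoid b = {(x, y). (norm x)\<^sup>2 + y\<^sup>2 / b\<^sup>2 = 1}"

text \<open>Half the gradient of the defining function of the ellipsoid.\<close>

definition normal_vec :: "real \<Rightarrow> (real ^ 'n) \<times> real \<Rightarrow> (real ^ 'n) \<times> real" where
  "normal_vec b p = (fst p, snd p / b\<^sup>2)"

text \<open>Orthogonal projection of the ambient space onto the tangent space at \<open>p\<close>.\<close>

definition tangent_proj ::
    "real \<Rightarrow> (real ^ 'n) \<times> real \<Rightarrow> (real ^ 'n) \<times> real \<Rightarrow> (real ^ 'n) \<times> real" where
  "tangent_proj b p v =
     v - ((v \<bullet> normal_vec b p) / (normal_vec b p \<bullet> normal_vec b p)) *\<^sub>R normal_vec b p"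


section \<open>Harmonic and biharmonic maps into the ellipsoid\<close>

text \<open>The Levi-Civita connection of the metric induced on the ellipsoid is the tangential part of
  the flat connection of the ambient space. Hence the pull-back connection applied to a vector
  field \<open>Y\<close> along \<open>\<phi>\<close> is the tangential part of the ordinary derivative of \<open>Y\<close>; and, the domain
  being flat, \<open>(\<nabla>d\<phi>)(v, w)\<close> for constant \<open>v\<close> and \<open>w\<close> is the covariant derivative of \<open>d\<phi>(w)\<close>
  in direction \<open>v\<close>.\<close>

definition cov_deriv ::
    "real \<Rightarrow> ('a::euclidean_space \<Rightarrow> (real ^ 'n) \<times> real) \<Rightarrow> 'a
      \<Rightarrow> ('a \<Rightarrow> (real ^ 'n) \<times> real) \<Rightarrow> 'a \<Rightarrow> (real ^ 'n) \<times> real" where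
  "cov_deriv b \<phi> v Y = (\<lambda>x. tangent_proj b (\<phi> x) (dir_deriv Y v x))"

definition tension ::
    "real \<Rightarrow> ('a::euclidean_space \<Rightarrow> (real ^ 'n) \<times> real) \<Rightarrow> 'a \<Rightarrow> (real ^ 'n) \<times> real" where
  "tension b \<phi> x = (\<Sum>i\<in>Basis. cov_deriv b \<phi> i (dir_deriv \<phi> i) x)"

definition bienergy ::
    "real \<Rightarrow> 'a::euclidean_space set \<Rightarrow> ('a \<Rightarrow> (real ^ 'n) \<times> real) \<Rightarrow> real" where
  "bienergy b M \<phi> = 1 / 2 * (LINT x:M|lebesgue. (norm (tension b \<phi> x))\<^sup>2)"

text \<open>Below \<open>U\<close> is an open set. A map into the ellipsoid is smooth iff it is smooth as a map into
  the ambient space.\<close>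

definition smooth_map ::
    "real \<Rightarrow> 'a::euclidean_space set \<Rightarrow> ('a \<Rightarrow> (real ^ 'n) \<times> real) \<Rightarrow> bool" where
  "smooth_map b U \<phi> \<longleftrightarrow> smooth_on U \<phi> \<and> \<phi> ` U \<subseteq> ellipsoid b"

definition harmonic_on ::
    "real \<Rightarrow> 'a::euclidean_space set \<Rightarrow> ('a \<Rightarrow> (real ^ 'n) \<times> real) \<Rightarrow> bool" where
  "harmonic_on b U \<phi> \<longleftrightarrow> smooth_map b U \<phi> \<and> (\<forall>x\<in>U. tension b \<phi> x = 0)"

text \<open>A smooth variation of \<open>\<phi>\<close> through maps into the ellipsoid, supported in \<open>K\<close>.\<close>

definition variation ::
    "real \<Rightarrow> 'a::euclidean_space set \<Rightarrow> 'a set \<Rightarrow> ('a \<Rightarrow> (real ^ 'n) \<times> real) \<Rightarrow> real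
      \<Rightarrow> (real \<Rightarrow> 'a \<Rightarrow> (real ^ 'n) \<times> real) \<Rightarrow> bool" where
  "variation b U K \<phi> \<epsilon> \<Phi> \<longleftrightarrow>
     smooth_map b ({- \<epsilon><..<\<epsilon>} \<times> U) (\<lambda>(t, x). \<Phi> t x) \<and>
     (\<forall>x\<in>U. \<Phi> 0 x = \<phi> x) \<and>
     (\<forall>t\<in>{- \<epsilon><..<\<epsilon>}. \<forall>x\<in>U - K. \<Phi> t x = \<phi> x)"

text \<open>Critical points of the bienergy. As \<open>U\<close> is not compact, only compactly supported variations
  are admitted, and the bienergy is taken over a compact set containing the support, outside of
  which nothing varies.\<close>

definition biharmonic_on ::
    "real \<Rightarrow> 'a::euclidean_space set \<Rightarrow> ('a \<Rightarrow> (real ^ 'n) \<times> real) \<Rightarrow> bool" where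
  "biharmonic_on b U \<phi> \<longleftrightarrow>
     smooth_map b U \<phi> \<and>
     (\<forall>K \<epsilon> \<Phi>. compact K \<and> K \<subseteq> U \<and> \<epsilon> > 0 \<and> variation b U K \<phi> \<epsilon> \<Phi> \<longrightarrow>
        ((\<lambda>t. bienergy b K (\<Phi> t)) has_real_derivative 0) (at 0))"

text \<open>For maps that are smooth away from the centre of the ball, weak (bi)harmonicity is taken in the
  following form.\<close>

definition weakly_harmonic ::
    "real \<Rightarrow> (real ^ 'n \<Rightarrow> (real ^ 'n) \<times> real) \<Rightarrow> bool" where
  "weakly_harmonic b \<phi> \<longleftrightarrow>
     sobolev_into 1 (ball 0 1) (ellipsoid b) \<phi> \<and> harmonic_on b (ball 0 1 - {0}) \<phi>"

definition weakly_biharmonic ::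
    "real \<Rightarrow> (real ^ 'n \<Rightarrow> (real ^ 'n) \<times> real) \<Rightarrow> bool" where
  "weakly_biharmonic b \<phi> \<longleftrightarrow>
     sobolev_into 2 (ball 0 1) (ellipsoid b) \<phi> \<and> biharmonic_on b (ball 0 1 - {0}) \<phi>"

definition proper_weakly_biharmonic ::
    "real \<Rightarrow> (real ^ 'n \<Rightarrow> (real ^ 'n) \<times> real) \<Rightarrow> bool" where
  "proper_weakly_biharmonic b \<phi> \<longleftrightarrow> weakly_biharmonic b \<phi> \<and> \<not> weakly_harmonic b \<phi>"

text \<open>At the origin the value is \<open>(0, b cos a)\<close>, off the ellipsoid, which is irrelevant as
  a single point is a null set.\<close>

definition phi :: "real \<Rightarrow> real \<Rightarrow> real ^ 'n \<Rightarrow> (real ^ 'n) \<times> real" where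
  "phi b a x = (sin a *\<^sub>R (x /\<^sub>R norm x), b * cos a)"

end

theory Submission
  imports Defs "HOL-Real_Asymp.Real_Asymp"
begin

text \<open>
  Write \<open>u = x / |x|\<close> and let \<open>A\<close> be the diagonal map \<open>normal_vec b\<close>, so that \<open>A \<phi>\<close> is normal to
  the ellipsoid at \<open>\<phi>\<close>. The tension field of a map \<open>\<phi>\<close> into the ellipsoid is
  \<open>\<tau> = \<Delta>\<phi> - \<lambda> A\<phi>\<close> with \<open>\<lambda> = (\<Delta>\<phi> \<bullet> A\<phi>) / (A\<phi> \<bullet> A\<phi>)\<close>, and the first variation of the bienergy in
  direction of a compactly supported tangential field \<open>V\<close> is the integral of
  \<open>(\<Delta>\<tau> - \<lambda> A\<tau>) \<bullet> V\<close> (\<open>first_variation_of_bienergy\<close>). Hence a smooth map is biharmonic as soon as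
  \<open>\<Delta>\<tau> - \<lambda> A\<tau>\<close> is normal to the ellipsoid.

  All fields that arise from the map of the theorem have the form
  \<open>(\<alpha> |x|\<^sup>p x, \<beta> |x|\<^sup>q)\<close>, and the Laplacian maps such fields to such fields. For every
  \<open>0 < a < pi / 2\<close> the tension field comes out as a nonzero multiple of
  \<open>|x|\<^sup>-\<^sup>2 (cos a / b u, - sin a)\<close>, so that the map is never harmonic and
  \<^emph>\<open>proper\<close> is automatic. The field \<open>\<Delta>\<tau> - \<lambda> A\<tau>\<close> lies in the plane spanned by \<open>(u, 0)\<close> and
  \<open>(0, 1)\<close>; it is normal iff its product with the polar direction \<open>(cos a u, - b sin a)\<close> vanishes.
  With \<open>s = sin\<^sup>2 a\<close> and \<open>\<beta> = b\<^sup>2\<close> this is the vanishing of the quadratic polynomial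
  \<open>3(n-3)(1-s)(1-s+\<beta>s) + 2(n-4)\<beta>s(1-s+\<beta>s) - (n-1)\<beta>s\<close>. It is positive at \<open>s = 0\<close> and has
  the sign of \<open>2(n-4)\<beta> - (n-1)\<close> at \<open>s = 1\<close>; if the latter is not negative, the polynomial is
  visibly positive on \<open>(0,1)\<close>. This gives the bound of the theorem.

  Two analytic points remain. If the map is biharmonic, the vanishing of the polynomial
  is read off from a single variation, which changes \<open>a\<close> to \<open>a + t \<eta>(x)\<close> for a smooth bump
  function \<open>\<eta>\<close> supported in an annulus. Conversely the map has to lie in \<open>W\<^sup>2\<^sup>,\<^sup>2\<close>:
  its second derivatives are of order \<open>|x|\<^sup>-\<^sup>2\<close>, whose square is integrable near the origin because
  \<open>n > 4\<close>, and the pointwise derivatives are the weak ones because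
  \<open>x / |x|\<close> is the dominated limit of the smooth maps \<open>x / sqrt (\<delta> + |x|\<^sup>2)\<close>.
\<close>

section \<open>Calculus of functions of class \<open>C\<^sup>k\<close>\<close>

lemma dir_deriv_eqI: "(f has_derivative f') (at x) \<Longrightarrow> dir_deriv f v x = f' v"
  unfolding dir_deriv_def using frechet_derivative_at by metis

lemma has_derivative_dir_deriv:
  "f differentiable (at x) \<Longrightarrow> (f has_derivative (\<lambda>v. dir_deriv f v x)) (at x)"
  unfolding dir_deriv_def using frechet_derivative_works by blast

lemma has_derivative_cong_open:
  assumes "open S" "x \<in> S" "\<And>y. y \<in> S \<Longrightarrow> f y = g y"
  shows "(f has_derivative D) (at x) \<longleftrightarrow> (g has_derivative D) (at x)"
  using assms has_derivative_transform_within_open[of f D x UNIV S g]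
    has_derivative_transform_within_open[of g D x UNIV S f] by auto

lemma differentiable_cong_open:
  assumes "open S" "x \<in> S" "\<And>y. y \<in> S \<Longrightarrow> f y = g y"
  shows "f differentiable (at x) \<longleftrightarrow> g differentiable (at x)"
  unfolding differentiable_def using has_derivative_cong_open[OF assms] by simp

lemma dir_deriv_cong_open:
  assumes "open S" "x \<in> S" "\<And>y. y \<in> S \<Longrightarrow> f y = g y"
  shows "dir_deriv f v x = dir_deriv g v x"
  unfolding dir_deriv_def frechet_derivative_def using has_derivative_cong_open[OF assms] by simp

lemma Ck_on_cong:
  assumes "open S" "\<And>y. y \<in> S \<Longrightarrow> f y = g y"
  shows "Ck_on k S f \<longleftrightarrow> Ck_on k S g"
  using assms(2)
proof (induction k arbitrary: f g)
  case 0
  then show ?case using continuous_on_cong by (metis Ck_on.simps(1))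
next
  case (Suc k)
  have "Ck_on k S (dir_deriv f v) \<longleftrightarrow> Ck_on k S (dir_deriv g v)" for v
    by (rule Suc.IH) (use dir_deriv_cong_open[OF assms(1)] Suc.prems in blast)
  moreover have "f differentiable (at x) \<longleftrightarrow> g differentiable (at x)" if "x \<in> S" for x
    using differentiable_cong_open[OF assms(1) that] Suc.prems by blast
  ultimately show ?case by simp
qed

lemma Ck_on_subset: "Ck_on k S f \<Longrightarrow> T \<subseteq> S \<Longrightarrow> Ck_on k T f"
  by (induction k arbitrary: f) (auto intro: continuous_on_subset)

lemma Ck_on_continuous_on: "Ck_on k S f \<Longrightarrow> continuous_on S f"
  by (cases k) (auto intro!: continuous_at_imp_continuous_on differentiable_imp_continuous_within)

lemma Ck_on_Suc_imp: "Ck_on (Suc k) S f \<Longrightarrow> Ck_on k S f"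
proof (induction k arbitrary: f)
  case 0
  then show ?case using Ck_on_continuous_on Ck_on.simps(1) by blast
next
  case (Suc k)
  then show ?case by (metis Ck_on.simps(2))
qed

lemma Ck_on_mono: "Ck_on m S f \<Longrightarrow> k \<le> m \<Longrightarrow> Ck_on k S f"
  by (induction m) (auto simp: le_Suc_eq simp del: Ck_on.simps dest: Ck_on_Suc_imp)

lemma Ck_on_differentiable: "Ck_on k S f \<Longrightarrow> 1 \<le> k \<Longrightarrow> x \<in> S \<Longrightarrow> f differentiable (at x)"
  by (cases k) auto

lemma Ck_on_dir_deriv: "Ck_on (Suc k) S f \<Longrightarrow> Ck_on k S (dir_deriv f v)"
  by simp

lemma Ck_on_has_derivative:
  "Ck_on k S f \<Longrightarrow> 1 \<le> k \<Longrightarrow> x \<in> S \<Longrightarrow> (f has_derivative (\<lambda>v. dir_deriv f v x)) (at x)"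
  using has_derivative_dir_deriv Ck_on_differentiable by blast

text \<open>The form in which membership in \<open>C\<^sup>k\<close> is proved by induction on \<open>k\<close>: it suffices to know the
  derivative on \<open>S\<close> by a formula, since \<open>S\<close> is open.\<close>

lemma Ck_on_SucI:
  assumes "open S"
    and deriv: "\<And>x. x \<in> S \<Longrightarrow> (f has_derivative (\<lambda>v. D v x)) (at x)"
    and Ck: "\<And>v. Ck_on k S (D v)"
  shows "Ck_on (Suc k) S f"
  using assms Ck_on_cong[OF \<open>open S\<close>, of "dir_deriv f _" "D _"] dir_deriv_eqI[OF deriv]
  by (auto simp: differentiable_def)

lemma Ck_on_const: "Ck_on k S (\<lambda>x. c)"
proof (induction k arbitrary: c)
  case (Suc k)
  have "dir_deriv (\<lambda>x::'a. c) v = (\<lambda>x. 0)" for v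
    by (rule ext, rule dir_deriv_eqI) simp
  then show ?case using Suc by simp
qed simp

lemma Ck_on_bounded_linear:
  assumes "bounded_linear L"
  shows "Ck_on k S L"
proof (cases k)
  case 0
  then show ?thesis using assms linear_continuous_on by simp
next
  case (Suc m)
  have L: "(L has_derivative L) (at x)" for x
    using assms bounded_linear_imp_has_derivative by blast
  have "dir_deriv L v = (\<lambda>x. L v)" for v
    by (rule ext, rule dir_deriv_eqI) (rule L)
  then show ?thesis using Suc L by (auto simp: Ck_on_const differentiable_def)
qed

lemma Ck_on_add:
  assumes "open S" "Ck_on k S f" "Ck_on k S g"
  shows "Ck_on k S (\<lambda>x. f x + g x)"
  using assms(2,3)
proof (induction k arbitrary: f g)
  case 0
  then show ?case by (simp add: continuous_on_add)
next
  case (Suc k)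
  show ?case
    by (rule Ck_on_SucI[where D="\<lambda>v x. dir_deriv f v x + dir_deriv g v x", OF assms(1)])
      (use Suc in \<open>auto intro!: has_derivative_add has_derivative_dir_deriv\<close>)
qed

lemma Ck_on_compose_linear:
  assumes "open S" "bounded_linear L" "Ck_on k S f"
  shows "Ck_on k S (\<lambda>x. L (f x))"
  using assms(3)
proof (induction k arbitrary: f)
  case 0
  then show ?case using assms(2) by (simp add: bounded_linear.continuous_on)
next
  case (Suc k)
  show ?case
    by (rule Ck_on_SucI[where D="\<lambda>v x. L (dir_deriv f v x)", OF assms(1)])
      (use Suc in \<open>auto intro!: bounded_linear.has_derivative[OF assms(2)] has_derivative_dir_deriv\<close>)
qed

lemma Ck_on_sum:
  assumes "open S" "\<And>i. i \<in> I \<Longrightarrow> Ck_on k S (f i)"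
  shows "Ck_on k S (\<lambda>x. \<Sum>i\<in>I. f i x)"
  using assms(2)
  by (induction I rule: infinite_finite_induct) (auto intro: Ck_on_const Ck_on_add assms(1))

lemma Ck_on_bilinear:
  assumes "open S" "bounded_bilinear B" "Ck_on k S f" "Ck_on k S g"
  shows "Ck_on k S (\<lambda>x. B (f x) (g x))"
  using assms(3,4)
proof (induction k arbitrary: f g)
  case 0
  then show ?case using assms(2) by (simp add: bounded_bilinear.continuous_on)
next
  case (Suc k)
  show ?case
  proof (rule Ck_on_SucI[where D="\<lambda>v x. B (f x) (dir_deriv g v x) + B (dir_deriv f v x) (g x)", OF assms(1)])
    fix x assume "x \<in> S"
    then show "((\<lambda>x. B (f x) (g x)) has_derivative
        (\<lambda>v. B (f x) (dir_deriv g v x) + B (dir_deriv f v x) (g x))) (at x)"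
      using Suc.prems by (intro bounded_bilinear.FDERIV[OF assms(2)] has_derivative_dir_deriv) auto
  next
    fix v
    have "Ck_on k S f" "Ck_on k S g" using Suc.prems Ck_on_Suc_imp by auto
    then show "Ck_on k S (\<lambda>x. B (f x) (dir_deriv g v x) + B (dir_deriv f v x) (g x))"
      using Suc.prems by (intro Ck_on_add[OF assms(1)] Suc.IH) auto
  qed
qed

lemmas Ck_on_scaleR = Ck_on_bilinear[OF _ bounded_bilinear_scaleR]
lemmas Ck_on_mult = Ck_on_bilinear[OF _ bounded_bilinear_mult]
lemmas Ck_on_inner = Ck_on_bilinear[OF _ bounded_bilinear_inner]

lemma Ck_on_minus: "open S \<Longrightarrow> Ck_on k S f \<Longrightarrow> Ck_on k S (\<lambda>x. - f x)"
  using Ck_on_compose_linear[where L="\<lambda>x. - x"] bounded_linear_minus[OF bounded_linear_ident] by auto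

lemma Ck_on_diff:
  "open S \<Longrightarrow> Ck_on k S f \<Longrightarrow> Ck_on k S g \<Longrightarrow> Ck_on k S (\<lambda>x. f x - g x)"
  using Ck_on_add[of S k f "\<lambda>x. - g x"] Ck_on_minus by auto

lemma Ck_on_Pair:
  assumes "open S" "Ck_on k S f" "Ck_on k S g"
  shows "Ck_on k S (\<lambda>x. (f x, g x))"
proof -
  have "Ck_on k S (\<lambda>x. (f x, 0))"
    using assms by (intro Ck_on_compose_linear[where L="\<lambda>y. (y, 0)"]
      bounded_linear_Pair bounded_linear_ident bounded_linear_zero)
  moreover have "Ck_on k S (\<lambda>x. (0, g x))"
    using assms by (intro Ck_on_compose_linear[where L="\<lambda>y. (0, y)"]
      bounded_linear_Pair bounded_linear_ident bounded_linear_zero)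
  ultimately show ?thesis
    using Ck_on_add[OF assms(1), of k "\<lambda>x. (f x, 0)" "\<lambda>x. (0, g x)"] by simp
qed

text \<open>Only affine inner functions are treated in several variables, because their derivative does not
  depend on the point. This covers freezing a variable and ignoring one.\<close>

lemma Ck_on_compose_affine:
  assumes "open S" "bounded_linear L" "\<And>x. x \<in> S \<Longrightarrow> c + L x \<in> T" "Ck_on k T f"
  shows "Ck_on k S (\<lambda>x. f (c + L x))"
  using assms(4)
proof (induction k arbitrary: f)
  case 0
  have "continuous_on S (\<lambda>x. c + L x)"
    by (intro continuous_intros linear_continuous_on assms(2))
  then show ?case using 0 assms(3)
    by (auto intro!: continuous_on_compose2[where f="\<lambda>x. c + L x" and s=S])
next
  case (Suc k)
  show ?case
  proof (rule Ck_on_SucI[where D="\<lambda>v x. dir_deriv f (L v) (c + L x)", OF assms(1)])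
    fix x assume "x \<in> S"
    then have "(f has_derivative (\<lambda>v. dir_deriv f v (c + L x))) (at (c + L x))"
      using Suc.prems assms(3) has_derivative_dir_deriv by auto
    moreover have "((\<lambda>x. c + L x) has_derivative L) (at x)"
      using bounded_linear_imp_has_derivative[OF assms(2)]
      by (auto intro!: derivative_eq_intros)
    ultimately show "((\<lambda>x. f (c + L x)) has_derivative (\<lambda>v. dir_deriv f (L v) (c + L x))) (at x)"
      using has_derivative_compose by blast
  qed (use Suc in auto)
qed

text \<open>With a real inner function the derivative of \<open>h\<close> is multiplication by one function \<open>h'\<close>, so that
  the chain rule yields a product and the induction needs no higher-order chain rule.\<close>

lemma Ck_on_compose_real:
  fixes h :: "real \<Rightarrow> 'b::real_normed_vector"
  assumes "open S" "\<And>x. x \<in> S \<Longrightarrow> f x \<in> T" "Ck_on k S f" "Ck_on k T h"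
  shows "Ck_on k S (\<lambda>x. h (f x))"
  using assms(3,4)
proof (induction k arbitrary: h)
  case 0
  then show ?case using assms(2)
    by (auto intro!: continuous_on_compose2[where f=f and s=S])
next
  case (Suc k)
  show ?case
  proof (rule Ck_on_SucI[where D="\<lambda>v x. dir_deriv f v x *\<^sub>R dir_deriv h 1 (f x)", OF assms(1)])
    fix x assume x: "x \<in> S"
    have h: "(h has_derivative (\<lambda>v. dir_deriv h v (f x))) (at (f x))"
      using Ck_on_has_derivative[OF Suc.prems(2)] assms(2) x by auto
    have eq: "dir_deriv h c (f x) = c *\<^sub>R dir_deriv h 1 (f x)" for c
      using linear_simps(5)[OF has_derivative_bounded_linear[OF h], of c 1] by simp
    have "(f has_derivative (\<lambda>v. dir_deriv f v x)) (at x)"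
      using Suc.prems x has_derivative_dir_deriv by auto
    from has_derivative_compose[OF this h]
    show "((\<lambda>x. h (f x)) has_derivative (\<lambda>v. dir_deriv f v x *\<^sub>R dir_deriv h 1 (f x))) (at x)"
      unfolding eq[of "dir_deriv f _ x"] .
  next
    fix v
    have "Ck_on k S f" using Suc.prems Ck_on_Suc_imp by auto
    then show "Ck_on k S (\<lambda>x. dir_deriv f v x *\<^sub>R dir_deriv h 1 (f x))"
      using Suc.prems by (intro Ck_on_scaleR[OF assms(1)] Suc.IH) auto
  qed
qed

lemma Ck_on_real_SucI:
  fixes h :: "real \<Rightarrow> real"
  assumes "open T" "\<And>t. t \<in> T \<Longrightarrow> (h has_real_derivative h' t) (at t)" "Ck_on k T h'"
  shows "Ck_on (Suc k) T h"
proof (rule Ck_on_SucI[where D="\<lambda>v t. v * h' t", OF assms(1)])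
  show "(h has_derivative (\<lambda>v. v * h' x)) (at x)" if "x \<in> T" for x
    using assms(2)[OF that] by (simp add: has_field_derivative_def mult.commute[of _ "h' x"])
qed (intro Ck_on_mult Ck_on_const assms)

lemma Ck_on_powr: "Ck_on k {0<..} (\<lambda>t::real. t powr p)"
proof (induction k arbitrary: p)
  case 0
  then show ?case by (auto intro!: continuous_intros)
next
  case (Suc k)
  show ?case
    by (rule Ck_on_real_SucI[where h'="\<lambda>t. p * t powr (p - 1)"])
      (auto intro!: Ck_on_mult Ck_on_const Suc.IH has_real_derivative_powr)
qed

lemma Ck_on_sin_cos: "Ck_on k UNIV (sin :: real \<Rightarrow> real) \<and> Ck_on k UNIV (cos :: real \<Rightarrow> real)"
proof (induction k)
  case 0
  then show ?case by (auto intro!: continuous_intros)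
next
  case (Suc k)
  have "Ck_on (Suc k) UNIV (sin :: real \<Rightarrow> real)"
    by (rule Ck_on_real_SucI[where h'=cos, OF open_UNIV DERIV_sin]) (use Suc in blast)
  moreover have "Ck_on (Suc k) UNIV (cos :: real \<Rightarrow> real)"
    by (rule Ck_on_real_SucI[where h'="\<lambda>t. - sin t", OF open_UNIV DERIV_cos])
      (use Suc Ck_on_minus[OF open_UNIV] in blast)
  ultimately show ?case ..
qed

text \<open>For \<open>m = 0\<close> this is the standard function that is smooth and flat at \<open>0\<close>. The additional powers
  make the family closed under differentiation up to linear combinations.\<close>

definition flat :: "nat \<Rightarrow> real \<Rightarrow> real" where
  "flat m t = (if t > 0 then exp (- 1 / t) / t ^ m else 0)"

text \<open>At the origin the exponential beats every power of \<open>t\<close>.\<close>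

lemma flat_has_derivative:
  "(flat m has_real_derivative (flat (m + 2) t - m * flat (m + 1) t)) (at t)"
proof (cases t "0::real" rule: linorder_cases)
  case less
  have "((\<lambda>t. 0) has_real_derivative 0) (at t)" by simp
  then have "(flat m has_real_derivative 0) (at t)"
    by (rule has_field_derivative_transform_within_open[of _ _ _ "{..<0}"])
      (use less in \<open>auto simp: flat_def\<close>)
  then show ?thesis using less by (simp add: flat_def)
next
  case greater
  have "((\<lambda>t. exp (- 1 / t) / t ^ m) has_real_derivative flat (m + 2) t - m * flat (m + 1) t) (at t)"
    using greater
    by (cases m) (auto intro!: derivative_eq_intros simp: flat_def divide_simps power2_eq_square,
      auto simp: algebra_simps power_add, metis One_nat_def power_eq_if)
  then show ?thesis
    by (rule has_field_derivative_transform_within_open[of _ _ _ "{0<..}"])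
      (use greater in \<open>auto simp: flat_def\<close>)
next
  case equal
  have r: "((\<lambda>t. flat m t / t) \<longlongrightarrow> 0) (at_right 0)"
  proof (rule Lim_transform_eventually)
    show "((\<lambda>t::real. exp (- 1 / t) / t ^ Suc m) \<longlongrightarrow> 0) (at_right 0)" by real_asymp
    show "\<forall>\<^sub>F t in at_right 0. exp (- 1 / t) / t ^ Suc m = flat m t / t"
      unfolding eventually_at_filter by (auto simp: flat_def mult.commute)
  qed
  have l: "((\<lambda>t. flat m t / t) \<longlongrightarrow> 0) (at_left 0)"
    by (rule Lim_transform_eventually[of "\<lambda>t. 0"])
      (auto simp: eventually_at_filter flat_def)
  have "((\<lambda>t. flat m t / t) \<longlongrightarrow> 0) (at 0)"
    using l r filterlim_split_at by blast
  then show ?thesis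
    using equal by (simp add: has_field_derivative_iff flat_def)
qed

lemma Ck_on_flat: "Ck_on k UNIV (flat m)"
proof (induction k arbitrary: m)
  case 0
  show ?case unfolding Ck_on.simps
    by (rule continuous_at_imp_continuous_on) (auto intro: DERIV_isCont[OF flat_has_derivative])
next
  case (Suc k)
  show ?case
    by (rule Ck_on_real_SucI[OF open_UNIV flat_has_derivative])
      (intro Suc.IH Ck_on_diff Ck_on_mult Ck_on_const open_UNIV)
qed

section \<open>Differentiation under the integral sign and integration by parts\<close>

lemma set_integrable_lebesgue_compact:
  fixes f :: "'a::euclidean_space \<Rightarrow> 'b::euclidean_space"
  assumes "compact K" "continuous_on K f"
  shows "set_integrable lebesgue K f"
  using borel_integrable_compact[OF assms] unfolding set_integrable_def
  by (subst integrable_completion) auto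

lemma norm_le_on_compact:
  assumes "compact K" "continuous_on K f"
  obtains M where "M > 0" "\<And>x. x \<in> K \<Longrightarrow> norm (f x) \<le> M"
proof -
  have "bounded (f ` K)"
    using assms compact_continuous_image compact_imp_bounded by blast
  then obtain M where "M > 0" "\<forall>y\<in>f ` K. norm y \<le> M" unfolding bounded_pos by blast
  then show ?thesis using that by blast
qed

lemma has_vector_derivative_0_iff:
  "(F has_vector_derivative D) (at (0::real)) \<longleftrightarrow> ((\<lambda>t. (F t - F 0) /\<^sub>R t) \<longlongrightarrow> D) (at 0)"
proof -
  have eq: "norm (F t - F 0 - (t - 0) *\<^sub>R D) / norm (t - 0) = norm ((F t - F 0) /\<^sub>R t - D)"
    if "t \<noteq> 0" for t
  proof -
    have "F t - F 0 - (t - 0) *\<^sub>R D = t *\<^sub>R ((F t - F 0) /\<^sub>R t - D)"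
      using that by (simp add: algebra_simps)
    then show ?thesis using that by (simp only: norm_scaleR) simp
  qed
  have "((\<lambda>t. norm (F t - F 0 - (t - 0) *\<^sub>R D) / norm (t - 0)) \<longlongrightarrow> 0) (at 0) \<longleftrightarrow>
        ((\<lambda>t. norm ((F t - F 0) /\<^sub>R t - D)) \<longlongrightarrow> 0) (at 0)"
    by (rule filterlim_cong) (simp_all only: eventually_at_filter, auto intro!: always_eventually eq[simplified])
  then show ?thesis
    unfolding has_vector_derivative_def has_derivative_iff_norm
    by (simp add: bounded_linear_scaleR_left tendsto_norm_zero_iff LIM_zero_iff)
qed

text \<open>The derivative in \<open>t\<close> is bounded on \<open>[-\<epsilon>/2, \<epsilon>/2] \<times> K\<close> by compactness, hence so are the difference
  quotients, and dominated convergence applies. The set \<open>K\<close> is an arbitrary compact set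
  because supports of variations are.\<close>

lemma has_vector_derivative_set_integral_compact:
  fixes f :: "real \<Rightarrow> 'a::euclidean_space \<Rightarrow> 'b::euclidean_space"
  assumes K: "compact K" and "\<epsilon> > 0"
    and cont: "\<And>t. t \<in> {-\<epsilon><..<\<epsilon>} \<Longrightarrow> continuous_on K (f t)"
    and deriv: "\<And>t x. t \<in> {-\<epsilon><..<\<epsilon>} \<Longrightarrow> x \<in> K \<Longrightarrow> ((\<lambda>s. f s x) has_vector_derivative f' t x) (at t)"
    and cont': "continuous_on ({-\<epsilon><..<\<epsilon>} \<times> K) (\<lambda>(t, x). f' t x)"
  shows "((\<lambda>t. LINT x:K|lebesgue. f t x) has_vector_derivative (LINT x:K|lebesgue. f' 0 x)) (at 0)"
proof -
  let ?T = "{-\<epsilon>/2..\<epsilon>/2}"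
  have T: "?T \<subseteq> {-\<epsilon><..<\<epsilon>}" "0 \<in> interior ?T" "0 \<in> ?T" using \<open>\<epsilon> > 0\<close> by auto
  have "compact (?T \<times> K)" using K by (simp add: compact_Times)
  moreover have "continuous_on (?T \<times> K) (\<lambda>(t, x). f' t x)"
    by (rule continuous_on_subset[OF cont']) (use T in auto)
  ultimately obtain M where "\<And>z. z \<in> ?T \<times> K \<Longrightarrow> norm (case z of (t, x) \<Rightarrow> f' t x) \<le> M"
    using norm_le_on_compact by blast
  then have M: "\<And>t x. t \<in> ?T \<Longrightarrow> x \<in> K \<Longrightarrow> norm (f' t x) \<le> M" by force
  have int: "set_integrable lebesgue K (f t)" if "t \<in> ?T" for t
    using set_integrable_lebesgue_compact[OF K cont] that T by blast
  have "continuous_on K (\<lambda>x. (\<lambda>(t, x). f' t x) (0, x))"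
    by (rule continuous_on_compose2[OF cont']) (use \<open>\<epsilon> > 0\<close> in \<open>auto intro!: continuous_intros\<close>)
  then have int': "set_integrable lebesgue K (f' 0)"
    using set_integrable_lebesgue_compact[OF K] by simp
  have "((\<lambda>t. ((LINT x:K|lebesgue. f t x) - (LINT x:K|lebesgue. f 0 x)) /\<^sub>R t) \<longlongrightarrow>
      (LINT x:K|lebesgue. f' 0 x)) (at 0 within ?T)"
    unfolding tendsto_at_iff_sequentially
  proof (intro allI impI)
    fix X :: "nat \<Rightarrow> real"
    assume X: "\<forall>i. X i \<in> ?T - {0}" "X \<longlonglongrightarrow> 0"
    have XT: "X i \<in> ?T" "X i \<noteq> 0" for i using X(1) by auto
    have eq: "((LINT x:K|lebesgue. f (X i) x) - (LINT x:K|lebesgue. f 0 x)) /\<^sub>R X i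
        = (LINT x|lebesgue. indicator K x *\<^sub>R ((f (X i) x - f 0 x) /\<^sub>R X i))" for i
      using set_integral_diff(2)[OF int[OF XT(1)[of i]] int[OF T(3)]]
      unfolding set_lebesgue_integral_def scaleR_left_commute[of _ "inverse (X i)"]
      by (simp only: integral_scaleR_right)
    have "(\<lambda>i. LINT x|lebesgue. indicator K x *\<^sub>R ((f (X i) x - f 0 x) /\<^sub>R X i))
        \<longlonglongrightarrow> (LINT x|lebesgue. indicator K x *\<^sub>R f' 0 x)"
    proof (rule integral_dominated_convergence[where w="\<lambda>x. indicator K x *\<^sub>R M"])
      show "(\<lambda>x. indicator K x *\<^sub>R f' 0 x) \<in> borel_measurable lebesgue"
        using int' unfolding set_integrable_def by (rule borel_measurable_integrable)
      show "integrable lebesgue (\<lambda>x. indicator K x *\<^sub>R M)"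
        using set_integrable_lebesgue_compact[OF K continuous_on_const] unfolding set_integrable_def .
      fix i
      have "set_integrable lebesgue K (\<lambda>x. (f (X i) x - f 0 x) /\<^sub>R X i)"
        using int[OF XT(1)] int[OF T(3)] by (intro set_integrable_scaleR_right set_integral_diff)
      then show "(\<lambda>x. indicator K x *\<^sub>R ((f (X i) x - f 0 x) /\<^sub>R X i)) \<in> borel_measurable lebesgue"
        unfolding set_integrable_def by (rule borel_measurable_integrable)
      have "norm ((f (X i) x - f 0 x) /\<^sub>R X i) \<le> M" if "x \<in> K" for x
      proof -
        have "norm (f (X i) x - f 0 x) \<le> M * norm (X i - 0)"
        proof (rule differentiable_bound[of ?T _ "\<lambda>t v. v *\<^sub>R f' t x"])
          fix t assume t: "t \<in> ?T"
          then show "((\<lambda>s. f s x) has_derivative (\<lambda>v. v *\<^sub>R f' t x)) (at t within ?T)"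
            using deriv[OF _ that] T has_vector_derivative_at_within
            unfolding has_vector_derivative_def by blast
          show "onorm (\<lambda>v. v *\<^sub>R f' t x) \<le> M"
            using M[OF t that] by (intro onorm_le) (simp add: mult.commute[of M] mult_left_mono)
        qed (use XT(1)[of i] T in auto)
        then show ?thesis using XT(2)[of i] by (simp add: divide_simps mult.commute)
      qed
      then show "AE x in lebesgue. norm (indicator K x *\<^sub>R ((f (X i) x - f 0 x) /\<^sub>R X i)) \<le> indicator K x *\<^sub>R M"
        by (auto simp: indicator_def)
    next
      have "(\<lambda>i. (f (X i) x - f 0 x) /\<^sub>R X i) \<longlonglongrightarrow> f' 0 x" if "x \<in> K" for x
      proof -
        have "((\<lambda>s. f s x) has_vector_derivative f' 0 x) (at 0)"
          using deriv[OF _ that, of 0] \<open>\<epsilon> > 0\<close> by auto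
        then have "((\<lambda>t. (f t x - f 0 x) /\<^sub>R t) \<longlongrightarrow> f' 0 x) (at 0)"
          by (simp add: has_vector_derivative_0_iff)
        then show ?thesis
          using X XT(2) by (auto simp: tendsto_at_iff_sequentially comp_def)
      qed
      then have "(\<lambda>i. indicator K x *\<^sub>R ((f (X i) x - f 0 x) /\<^sub>R X i)) \<longlonglongrightarrow> indicator K x *\<^sub>R f' 0 x" for x
        by (cases "x \<in> K") auto
      then show "AE x in lebesgue. (\<lambda>i. indicator K x *\<^sub>R ((f (X i) x - f 0 x) /\<^sub>R X i)) \<longlonglongrightarrow> indicator K x *\<^sub>R f' 0 x"
        by simp
    qed
    then show "((\<lambda>t. ((LINT x:K|lebesgue. f t x) - (LINT x:K|lebesgue. f 0 x)) /\<^sub>R t) \<circ> X)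
        \<longlonglongrightarrow> (LINT x:K|lebesgue. f' 0 x)"
      unfolding comp_def eq by (simp add: set_lebesgue_integral_def)
  qed
  then show ?thesis
    unfolding has_vector_derivative_0_iff at_within_interior[OF T(2)] .
qed

lemma integral_lebesgue_translate:
  fixes g :: "'a::euclidean_space \<Rightarrow> 'b::euclidean_space"
  assumes "g \<in> borel_measurable borel"
  shows "(LINT x|lebesgue. g (c + x)) = (LINT x|lebesgue. g x)"
proof -
  have m: "(\<lambda>x. g (c + x)) \<in> borel_measurable borel" using assms by measurable
  have "(LINT x|lborel. g x) = (LINT x|distr lborel borel ((+) c). g x)"
    by (simp add: lborel_distr_plus)
  also have "\<dots> = (LINT x|lborel. g (c + x))"
    using assms by (intro integral_distr) auto
  finally show ?thesis using assms m by (simp add: integral_completion)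
qed

lemma set_integral_extend_support:
  fixes f :: "'a::euclidean_space \<Rightarrow> 'b::euclidean_space"
  assumes "A \<subseteq> B" "\<And>x. x \<in> B - A \<Longrightarrow> f x = 0"
  shows "(LINT x:A|M. f x) = (LINT x:B|M. f x)"
  unfolding set_lebesgue_integral_def
  by (rule Bochner_Integration.integral_cong) (use assms in \<open>auto simp: indicator_def\<close>)

text \<open>Extended by zero, \<open>f\<close> is of class \<open>C\<^sup>1\<close> on the whole space. The integral of \<open>f(t v + x)\<close> over \<open>x\<close> does
  not depend on \<open>t\<close> by translation invariance, and differentiation at \<open>t = 0\<close> under the integral sign gives
  the integral of the derivative of \<open>f\<close> in direction \<open>v\<close>.\<close>

lemma integral_dir_deriv_eq_0:
  fixes f :: "'a::euclidean_space \<Rightarrow> 'b::euclidean_space"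
  assumes "compact K" "K \<subseteq> U" "open U" "Ck_on 1 U f" and zero: "\<And>x. x \<in> U - K \<Longrightarrow> f x = 0"
  shows "(LINT x:K|lebesgue. dir_deriv f v x) = 0"
proof -
  define g where "g x = (if x \<in> K then f x else 0)" for x
  have K: "open (- K)" using assms(1) compact_imp_closed by blast
  have gU: "g x = f x" if "x \<in> U" for x using zero that by (auto simp: g_def)
  have g0: "g x = 0" if "x \<in> - K" for x using that by (auto simp: g_def)
  have "Ck_on 1 U g" using Ck_on_cong[OF \<open>open U\<close> gU, where k=1] assms(4) by simp
  moreover have "Ck_on 1 (- K) g"
    using Ck_on_cong[OF K, where f=g and g="\<lambda>x. 0" and k=1] g0 Ck_on_const by blast
  ultimately have "Ck_on 1 (U \<union> - K) g"
    by (auto intro: continuous_on_open_Un[OF \<open>open U\<close> K])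
  moreover have "U \<union> - K = UNIV" using assms(2) by blast
  ultimately have g: "Ck_on 1 UNIV g" by (simp only:)
  have dg: "dir_deriv g v x = dir_deriv f v x" if "x \<in> K" for x
    using dir_deriv_cong_open[OF \<open>open U\<close>, where x=x and f=g and g=f] gU that assms(2) by blast
  have dg0: "dir_deriv g v x = 0" if "x \<in> - K" for x
    using dir_deriv_cong_open[OF K, where x=x and f=g and g="\<lambda>x. 0"] g0 that
    by (simp add: dir_deriv_def)
  have cg: "continuous_on UNIV g" using Ck_on_continuous_on[OF g] .
  have cdg: "continuous_on UNIV (dir_deriv g v)" using g by simp
  obtain R where R: "\<And>x. x \<in> K \<Longrightarrow> norm x \<le> R"
    using \<open>compact K\<close> compact_imp_bounded bounded_pos by metis
  let ?B = "cball 0 (R + norm v) :: 'a set"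
  have KB: "K \<subseteq> ?B" using R by (auto intro!: add_increasing2)
  have out: "g (t *\<^sub>R v + x) = 0" if "t \<in> {-1<..<1}" "x \<notin> ?B" for t x
  proof (rule g0, rule ComplI)
    assume "t *\<^sub>R v + x \<in> K"
    then have "norm (t *\<^sub>R v + x) \<le> R" using R by blast
    moreover have "norm x \<le> norm (t *\<^sub>R v + x) + norm (t *\<^sub>R v)"
      using norm_triangle_ineq4[of "t *\<^sub>R v + x" "t *\<^sub>R v"] by simp
    moreover have "norm (t *\<^sub>R v) \<le> norm v" using that(1)
      by (simp add: mult_left_le_one_le abs_if)
    ultimately show False using that(2) by simp
  qed
  have "((\<lambda>t. LINT x:?B|lebesgue. g (t *\<^sub>R v + x)) has_vector_derivative
      (LINT x:?B|lebesgue. dir_deriv g v (0 *\<^sub>R v + x))) (at 0)"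
  proof (rule has_vector_derivative_set_integral_compact[where \<epsilon>=1])
    show "continuous_on ?B (\<lambda>x. g (t *\<^sub>R v + x))" for t
      by (rule continuous_on_compose2[OF cg]) (auto intro!: continuous_intros)
    show "continuous_on ({- 1<..<1} \<times> ?B) (\<lambda>(t, x). dir_deriv g v (t *\<^sub>R v + x))"
      unfolding case_prod_unfold
      by (rule continuous_on_compose2[OF cdg]) (auto intro!: continuous_intros)
    fix t x
    have "(g has_derivative (\<lambda>w. dir_deriv g w (t *\<^sub>R v + x))) (at (t *\<^sub>R v + x))"
      using Ck_on_has_derivative[OF g] by simp
    moreover have "((\<lambda>s. s *\<^sub>R v + x) has_derivative (\<lambda>s. s *\<^sub>R v)) (at t)"
      by (auto intro!: derivative_eq_intros)
    ultimately have d: "((\<lambda>s. g (s *\<^sub>R v + x)) has_derivative (\<lambda>s. dir_deriv g (s *\<^sub>R v) (t *\<^sub>R v + x))) (at t)"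
      using has_derivative_compose by blast
    have "dir_deriv g (s *\<^sub>R v) (t *\<^sub>R v + x) = s *\<^sub>R dir_deriv g v (t *\<^sub>R v + x)" for s
      using linear_simps(5)[OF has_derivative_bounded_linear[OF \<open>(g has_derivative _) _\<close>]] .
    with d show "((\<lambda>s. g (s *\<^sub>R v + x)) has_vector_derivative dir_deriv g v (t *\<^sub>R v + x)) (at t)"
      by (simp add: has_vector_derivative_def)
  qed auto
  moreover have "((\<lambda>t. LINT x:?B|lebesgue. g (t *\<^sub>R v + x)) has_vector_derivative 0) (at 0)"
  proof (rule has_vector_derivative_transform_within_open[OF has_vector_derivative_const])
    fix t :: real assume t: "t \<in> {-1<..<1}"
    have "(LINT x|lebesgue. g x) = (LINT x|lebesgue. g (t *\<^sub>R v + x))"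
      using integral_lebesgue_translate[OF borel_measurable_continuous_onI[OF cg]] by metis
    also have "\<dots> = (LINT x:?B|lebesgue. g (t *\<^sub>R v + x))"
      unfolding set_lebesgue_integral_def
      by (rule Bochner_Integration.integral_cong) (use out[OF t] in \<open>auto simp: indicator_def\<close>)
    finally show "(LINT x|lebesgue. g x) = (LINT x:?B|lebesgue. g (t *\<^sub>R v + x))" .
  qed auto
  ultimately have "0 = (LINT x:?B|lebesgue. dir_deriv g v (0 *\<^sub>R v + x))"
    using vector_derivative_unique_at by blast
  also have "\<dots> = (LINT x:?B|lebesgue. dir_deriv g v x)" by simp
  also have "\<dots> = (LINT x:K|lebesgue. dir_deriv g v x)"
    by (rule set_integral_extend_support[symmetric]) (use KB dg0 in auto)
  also have "\<dots> = (LINT x:K|lebesgue. dir_deriv f v x)"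
    using dg unfolding set_lebesgue_integral_def
    by (intro Bochner_Integration.integral_cong) (auto simp: indicator_def)
  finally show ?thesis by simp
qed

definition laplacian :: "('a::euclidean_space \<Rightarrow> 'b::real_normed_vector) \<Rightarrow> 'a \<Rightarrow> 'b" where
  "laplacian f x = (\<Sum>i\<in>Basis. dir_deriv (dir_deriv f i) i x)"

lemma dir_deriv_bilinear:
  assumes "bounded_bilinear B" "f differentiable (at x)" "g differentiable (at x)"
  shows "dir_deriv (\<lambda>x. B (f x) (g x)) v x = B (f x) (dir_deriv g v x) + B (dir_deriv f v x) (g x)"
  by (rule dir_deriv_eqI[OF bounded_bilinear.FDERIV[OF assms(1)]])
    (intro has_derivative_dir_deriv assms)+

lemma dir_deriv_diff:
  assumes "f differentiable (at x)" "g differentiable (at x)"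
  shows "dir_deriv (\<lambda>x. f x - g x) v x = dir_deriv f v x - dir_deriv g v x"
  by (rule dir_deriv_eqI[OF has_derivative_diff]) (intro has_derivative_dir_deriv assms)+

lemma continuous_on_laplacian:
  "Ck_on 2 U f \<Longrightarrow> continuous_on U (laplacian f)"
  unfolding laplacian_def by (intro continuous_on_sum) (simp add: numeral_2_eq_2)

text \<open>\<open>\<Delta>X \<bullet> w - X \<bullet> \<Delta>w\<close> is the divergence of a compactly supported field.\<close>

lemma greens_identity:
  fixes X w :: "'a::euclidean_space \<Rightarrow> 'b::euclidean_space"
  assumes K: "compact K" "K \<subseteq> U" "open U" and X: "Ck_on 2 U X" and w: "Ck_on 2 U w"
    and zero: "\<And>x. x \<in> U - K \<Longrightarrow> X x = 0"
  shows "(LINT x:K|lebesgue. laplacian X x \<bullet> w x) = (LINT x:K|lebesgue. X x \<bullet> laplacian w x)"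
proof -
  have "open (U - K)" using K compact_imp_closed by blast
  have X1: "Ck_on 1 U X" "Ck_on 1 U w" "Ck_on 1 U (dir_deriv X i)" "Ck_on 1 U (dir_deriv w i)" for i
    using Ck_on_mono[OF X, of 1] Ck_on_mono[OF w, of 1] X w
      Ck_on_dir_deriv[of 1 U X i] Ck_on_dir_deriv[of 1 U w i]
    by (simp_all only: numeral_2_eq_2 One_nat_def)
  define h where "h i x = dir_deriv X i x \<bullet> w x - X x \<bullet> dir_deriv w i x" for i x
  have zero': "dir_deriv X i x = 0" if "x \<in> U - K" for i x
    using dir_deriv_cong_open[OF \<open>open (U - K)\<close> that, where f=X and g="\<lambda>x. 0"] zero by (simp add: dir_deriv_def)
  have dh: "dir_deriv (h i) i x = dir_deriv (dir_deriv X i) i x \<bullet> w x - X x \<bullet> dir_deriv (dir_deriv w i) i x"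
    if "x \<in> U" for i x
  proof -
    note d = X1[THEN Ck_on_differentiable, OF _ that, simplified]
    show ?thesis unfolding h_def
      by (subst dir_deriv_diff, (intro differentiable_inner d)+)
        (simp add: dir_deriv_bilinear[OF bounded_bilinear_inner] d)
  qed
  have "(LINT x:K|lebesgue. laplacian X x \<bullet> w x) - (LINT x:K|lebesgue. X x \<bullet> laplacian w x)
      = (LINT x:K|lebesgue. laplacian X x \<bullet> w x - X x \<bullet> laplacian w x)"
    using continuous_on_subset[OF continuous_on_laplacian[OF X] K(2)]
      continuous_on_subset[OF continuous_on_laplacian[OF w] K(2)]
      continuous_on_subset[OF Ck_on_continuous_on[OF X] K(2)]
      continuous_on_subset[OF Ck_on_continuous_on[OF w] K(2)]
    by (intro set_integral_diff(2)[symmetric] set_integrable_lebesgue_compact K continuous_on_inner)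
  also have "\<dots> = (LINT x:K|lebesgue. \<Sum>i\<in>Basis. dir_deriv (h i) i x)"
    unfolding set_lebesgue_integral_def
    by (rule Bochner_Integration.integral_cong)
      (use K dh in \<open>auto simp: indicator_def laplacian_def inner_sum_left inner_sum_right sum_subtractf subset_iff\<close>)
  also have "\<dots> = (\<Sum>i\<in>Basis. LINT x:K|lebesgue. dir_deriv (h i) i x)"
    unfolding set_lebesgue_integral_def scaleR_sum_right
  proof (rule Bochner_Integration.integral_sum)
    fix i :: 'a
    have "Ck_on 1 U (h i)" unfolding h_def
      by (intro Ck_on_diff Ck_on_inner X1 K)
    then have "continuous_on K (dir_deriv (h i) i)"
      using K(2) by (auto intro: continuous_on_subset)
    then show "integrable lebesgue (\<lambda>x. indicator K x *\<^sub>R dir_deriv (h i) i x)"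
      using set_integrable_lebesgue_compact K unfolding set_integrable_def by blast
  qed
  also have "\<dots> = 0"
  proof (intro sum.neutral ballI integral_dir_deriv_eq_0[OF K])
    show "Ck_on 1 U (h i)" for i unfolding h_def
      by (intro Ck_on_diff Ck_on_inner X1 K)
    show "h i x = 0" if "x \<in> U - K" for i x using zero[OF that] zero'[OF that] by (simp add: h_def)
  qed
  finally show ?thesis by simp
qed

section \<open>The first variation of the bienergy\<close>

lemma Ck_on_inverse: 
  assumes "open S" "Ck_on k S f" "\<And>x. x \<in> S \<Longrightarrow> f x > (0::real)"
  shows "Ck_on k S (\<lambda>x. inverse (f x))"
proof -
  have "Ck_on k S (\<lambda>x. f x powr - 1)"
    by (rule Ck_on_compose_real[OF assms(1) _ assms(2) Ck_on_powr]) (use assms(3) in auto)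
  then show ?thesis
    by (rule Ck_on_cong[THEN iffD1, OF assms(1), rotated]) (use assms(3) in \<open>auto simp: powr_minus less_imp_le\<close>)
qed

lemma Ck_on_slice:
  assumes "open U" "t \<in> T" "Ck_on k (T \<times> U) F"
  shows "Ck_on k U (\<lambda>y. F (t, y))"
proof -
  have "bounded_linear (\<lambda>y. (0, y))"
    by (intro bounded_linear_Pair bounded_linear_ident bounded_linear_zero)
  from Ck_on_compose_affine[OF assms(1) this _ assms(3), of "(t, 0)"]
  show ?thesis using assms(2) by simp
qed

lemma dir_deriv_slice:
  assumes "F differentiable (at (t, x))"
  shows "dir_deriv (\<lambda>y. F (t, y)) v x = dir_deriv F (0, v) (t, x)"
proof (rule dir_deriv_eqI)
  have "((\<lambda>y. (t, y)) has_derivative (\<lambda>v. (0, v))) (at x)"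
    by (auto intro!: derivative_eq_intros)
  then show "((\<lambda>y. F (t, y)) has_derivative (\<lambda>v. dir_deriv F (0, v) (t, x))) (at x)"
    using has_derivative_compose has_derivative_dir_deriv[OF assms] by blast
qed

lemma has_vector_derivative_slice:
  fixes F :: "real \<times> 'a::real_normed_vector \<Rightarrow> 'b::real_normed_vector"
  assumes "F differentiable (at (t, x))"
  shows "((\<lambda>s. F (s, x)) has_vector_derivative dir_deriv F (1, 0) (t, x)) (at t)"
proof -
  note F = has_derivative_dir_deriv[OF assms]
  have "((\<lambda>s. (s, x)) has_derivative (\<lambda>s. (s, 0))) (at t)"
    by (auto intro!: derivative_eq_intros)
  then have "((\<lambda>s. F (s, x)) has_derivative (\<lambda>s. dir_deriv F (s, 0) (t, x))) (at t)"
    using has_derivative_compose F by blast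
  moreover have "(\<lambda>s. dir_deriv F (s, 0) (t, x)) = (\<lambda>s. s *\<^sub>R dir_deriv F (1, 0) (t, x))"
  proof
    fix s :: real
    have "dir_deriv F (s *\<^sub>R (1, 0)) (t, x) = s *\<^sub>R dir_deriv F (1, 0) (t, x)"
      by (rule linear_simps(5)[OF has_derivative_bounded_linear[OF F]])
    moreover have "s *\<^sub>R (1, 0) = (s, 0 :: 'a)" by simp
    ultimately show "dir_deriv F (s, 0) (t, x) = s *\<^sub>R dir_deriv F (1, 0) (t, x)" by (simp only:)
  qed
  ultimately show ?thesis unfolding has_vector_derivative_def by (simp only:)
qed

text \<open>The spatial Laplacian of a family of maps as an expression in joint derivatives of the family,
  which makes its smooth dependence on both variables evident.\<close>

lemma laplacian_slice:
  assumes "open T" "open U" "t \<in> T" "x \<in> U" "Ck_on 2 (T \<times> U) F"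
  shows "laplacian (\<lambda>y. F (t, y)) x = (\<Sum>i\<in>Basis. dir_deriv (dir_deriv F (0, i)) (0, i) (t, x))"
  unfolding laplacian_def
proof (rule sum.cong[OF refl])
  fix i :: 'b
  have F: "Ck_on 1 (T \<times> U) F" "Ck_on 1 (T \<times> U) (dir_deriv F (0, i))"
    using Ck_on_mono[OF assms(5), of 1] Ck_on_dir_deriv[of 1 _ F "(0, i)"] assms(5)
    by (simp_all only: numeral_2_eq_2 One_nat_def)
  have "dir_deriv (dir_deriv (\<lambda>y. F (t, y)) i) i x = dir_deriv (\<lambda>y. dir_deriv F (0, i) (t, y)) i x"
    by (rule dir_deriv_cong_open[OF \<open>open U\<close> \<open>x \<in> U\<close>])
      (intro dir_deriv_slice Ck_on_differentiable[OF F(1)], use assms in auto)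
  also have "\<dots> = dir_deriv (dir_deriv F (0, i)) (0, i) (t, x)"
    by (intro dir_deriv_slice Ck_on_differentiable[OF F(2)]) (use assms in auto)
  finally show "dir_deriv (dir_deriv (\<lambda>y. F (t, y)) i) i x = dir_deriv (dir_deriv F (0, i)) (0, i) (t, x)" .
qed

lemma laplacian_cong_open:
  assumes "open U" "x \<in> U" "\<And>y. y \<in> U \<Longrightarrow> f y = g y"
  shows "laplacian f x = laplacian g x"
proof -
  have "dir_deriv f i y = dir_deriv g i y" if "y \<in> U" for i y
    using dir_deriv_cong_open[OF assms(1) that, where f=f and g=g] assms(3) by blast
  then have "dir_deriv (dir_deriv f i) i x = dir_deriv (dir_deriv g i) i x" for i
    using dir_deriv_cong_open[OF assms(1,2), where f="dir_deriv f i" and g="dir_deriv g i"] by blast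
  then show ?thesis unfolding laplacian_def by simp
qed

lemma laplacian_diff:
  assumes "open U" "x \<in> U" "Ck_on 2 U f" "Ck_on 2 U g"
  shows "laplacian (\<lambda>y. f y - g y) x = laplacian f x - laplacian g x"
proof -
  have "dir_deriv (dir_deriv (\<lambda>y. f y - g y) i) i x = dir_deriv (dir_deriv f i) i x - dir_deriv (dir_deriv g i) i x" for i
  proof -
    have "dir_deriv (\<lambda>y. f y - g y) i y = dir_deriv f i y - dir_deriv g i y" if "y \<in> U" for y
      using that assms(3,4) by (intro dir_deriv_diff) (auto simp: numeral_2_eq_2)
    then have "dir_deriv (dir_deriv (\<lambda>y. f y - g y) i) i x = dir_deriv (\<lambda>y. dir_deriv f i y - dir_deriv g i y) i x"
      by (rule dir_deriv_cong_open[OF assms(1,2)])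
    also have "\<dots> = dir_deriv (dir_deriv f i) i x - dir_deriv (dir_deriv g i) i x"
      using assms by (intro dir_deriv_diff) (auto simp: numeral_2_eq_2)
    finally show ?thesis .
  qed
  then show ?thesis by (simp add: laplacian_def sum_subtractf)
qed

lemma bounded_linear_normal_vec: "bounded_linear (normal_vec b)"
proof -
  have eq: "normal_vec b = (\<lambda>p. (fst p, snd p *\<^sub>R (1 / b\<^sup>2)))" by (auto simp: normal_vec_def fun_eq_iff)
  show ?thesis unfolding eq
    by (intro bounded_linear_Pair bounded_linear_fst bounded_linear_scaleR_left[THEN bounded_linear_compose] bounded_linear_snd)
qed

lemma normal_vec_selfadjoint: "normal_vec b p \<bullet> q = p \<bullet> normal_vec b q"
  by (simp add: normal_vec_def inner_prod_def)

lemma ellipsoid_iff: "p \<in> ellipsoid b \<longleftrightarrow> p \<bullet> normal_vec b p = 1"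
  by (cases p) (simp add: ellipsoid_def normal_vec_def inner_prod_def power2_norm_eq_inner flip: power2_eq_square)

text \<open>On the ellipsoid the normal field cannot vanish, because its product with the position vector is
  \<open>1\<close>.\<close>

lemma normal_vec_pos: "p \<in> ellipsoid b \<Longrightarrow> normal_vec b p \<bullet> normal_vec b p > 0"
  by (auto simp: ellipsoid_iff)

text \<open>The coefficient \<open>\<lambda>\<close> for which \<open>\<Delta>\<phi> - \<lambda> A\<phi>\<close> is tangential, where \<open>A = normal_vec b\<close>.\<close>

definition normal_coeff ::
    "real \<Rightarrow> ('a::euclidean_space \<Rightarrow> (real ^ 'n) \<times> real) \<Rightarrow> 'a \<Rightarrow> real" where
  "normal_coeff b \<phi> x = (laplacian \<phi> x \<bullet> normal_vec b (\<phi> x)) / (normal_vec b (\<phi> x) \<bullet> normal_vec b (\<phi> x))"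

lemma tension_eq: "tension b \<phi> x = laplacian \<phi> x - normal_coeff b \<phi> x *\<^sub>R normal_vec b (\<phi> x)"
  by (simp add: tension_def cov_deriv_def tangent_proj_def laplacian_def normal_coeff_def
      sum_subtractf scaleR_sum_left inner_sum_left sum_divide_distrib)

text \<open>The gradient of the bienergy up to a normal component: its tangential part is the bitension
  field. Variation fields are tangential, so that the projection can be left out.\<close>

definition bienergy_gradient ::
    "real \<Rightarrow> ('a::euclidean_space \<Rightarrow> (real ^ 'n) \<times> real) \<Rightarrow> 'a \<Rightarrow> (real ^ 'n) \<times> real" where
  "bienergy_gradient b \<phi> x =
    laplacian (tension b \<phi>) x - normal_coeff b \<phi> x *\<^sub>R normal_vec b (tension b \<phi> x)"

lemma normal_coeff_cong_open:
  assumes "open U" "x \<in> U" "\<And>y. y \<in> U \<Longrightarrow> \<phi> y = \<psi> y"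
  shows "normal_coeff b \<phi> x = normal_coeff b \<psi> x"
  using laplacian_cong_open[OF assms(1,2), where f=\<phi> and g=\<psi>] assms(2,3) by (simp add: normal_coeff_def)

lemma tension_cong_open:
  assumes "open U" "x \<in> U" "\<And>y. y \<in> U \<Longrightarrow> \<phi> y = \<psi> y"
  shows "tension b \<phi> x = tension b \<psi> x"
  using laplacian_cong_open[OF assms(1,2), where f=\<phi> and g=\<psi>] normal_coeff_cong_open[OF assms(1,2), where \<phi>=\<phi> and \<psi>=\<psi>]
    assms(2,3) by (simp add: tension_eq)

lemma bienergy_gradient_cong_open:
  assumes "open U" "x \<in> U" "\<And>y. y \<in> U \<Longrightarrow> \<phi> y = \<psi> y"
  shows "bienergy_gradient b \<phi> x = bienergy_gradient b \<psi> x"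
proof -
  have t: "tension b \<phi> y = tension b \<psi> y" if "y \<in> U" for y
    using tension_cong_open[OF assms(1) that] assms(3) by blast
  show ?thesis unfolding bienergy_gradient_def
    using normal_coeff_cong_open[OF assms] t[OF assms(2)] laplacian_cong_open[OF assms(1,2) t] by simp
qed

text \<open>Length of the projection onto the orthogonal complement of the normal: a rational expression in
  \<open>\<Delta>\<phi>\<close> and \<open>A\<phi>\<close>, which can be differentiated along a family of maps.\<close>

lemma norm_tension:
  assumes "normal_vec b (\<phi> x) \<bullet> normal_vec b (\<phi> x) \<noteq> 0"
  shows "(norm (tension b \<phi> x))\<^sup>2 = laplacian \<phi> x \<bullet> laplacian \<phi> x -
    (laplacian \<phi> x \<bullet> normal_vec b (\<phi> x))\<^sup>2 / (normal_vec b (\<phi> x) \<bullet> normal_vec b (\<phi> x))"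
  using assms unfolding power2_norm_eq_inner tension_eq normal_coeff_def
  by (simp add: inner_diff_left inner_diff_right inner_commute field_simps power2_eq_square)

text \<open>Let \<open>L\<close> be the Laplacian of the family \<open>\<Phi> t\<close> and \<open>L'\<close> its derivative in \<open>t\<close>. Differentiating
  half the energy density at \<open>t = 0\<close> gives \<open>\<tau> \<bullet> L' - \<lambda> (\<tau> \<bullet> A V)\<close>. To move the Laplacian from the first term to \<open>\<tau>\<close>
  one does not have to exchange it with the derivative in \<open>t\<close>: Green's identity is applied to the
  finite difference \<open>\<Phi> t - \<Phi> 0\<close>, which vanishes outside \<open>K\<close>, and both sides are differentiated under the
  integral sign.\<close>

proposition first_variation_of_bienergy:
  fixes \<phi> :: "'a::euclidean_space \<Rightarrow> (real ^ 'n) \<times> real"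
  assumes U: "open U" and K: "compact K" "K \<subseteq> U" and "\<epsilon> > 0"
    and var: "variation b U K \<phi> \<epsilon> \<Phi>"
    and V: "\<And>x. x \<in> K \<Longrightarrow> ((\<lambda>t. \<Phi> t x) has_vector_derivative V x) (at 0)"
  shows "((\<lambda>t. bienergy b K (\<Phi> t)) has_real_derivative
    (LINT x:K|lebesgue. bienergy_gradient b \<phi> x \<bullet> V x)) (at 0)"
proof -
  define T where "T = {-\<epsilon><..<\<epsilon>}"
  have T: "open T" "0 \<in> T" using \<open>\<epsilon> > 0\<close> by (auto simp: T_def)
  define \<Psi> where "\<Psi> = (\<lambda>(t, x). \<Phi> t x)"
  have \<Phi>: "\<Phi> t = (\<lambda>y. \<Psi> (t, y))" for t by (simp add: \<Psi>_def)
  have W: "open (T \<times> U)" using T U by (simp add: open_Times)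
  have \<Psi>: "Ck_on k (T \<times> U) \<Psi>" for k
    using var unfolding variation_def smooth_map_def smooth_on_def T_def \<Psi>_def by blast
  have ell: "\<Psi> z \<in> ellipsoid b" if "z \<in> T \<times> U" for z
    using var that unfolding variation_def smooth_map_def T_def \<Psi>_def by blast
  have \<Phi>0: "\<Phi> 0 y = \<phi> y" if "y \<in> U" for y using var that by (simp add: variation_def)
  have \<Phi>out: "\<Phi> t y = \<phi> y" if "t \<in> T" "y \<in> U - K" for t y
    using var that by (simp add: variation_def T_def)
  define L where "L z = (\<Sum>i\<in>Basis. dir_deriv (dir_deriv \<Psi> (0, i)) (0, i) z)" for z
  define N where "N z = normal_vec b (\<Psi> z)" for z
  have L: "Ck_on k (T \<times> U) L" for k
    unfolding L_def by (intro Ck_on_sum Ck_on_dir_deriv \<Psi> W)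
  have N: "Ck_on k (T \<times> U) N" for k
    unfolding N_def by (rule Ck_on_compose_linear[OF W bounded_linear_normal_vec \<Psi>])
  have NN: "N z \<bullet> N z > 0" if "z \<in> T \<times> U" for z
    unfolding N_def using normal_vec_pos[OF ell[OF that]] .
  define L' where "L' = dir_deriv L (1, 0)"
  define N' where "N' = dir_deriv N (1, 0)"
  have cont: "continuous_on (T \<times> U) L" "continuous_on (T \<times> U) N"
      "continuous_on (T \<times> U) L'" "continuous_on (T \<times> U) N'" "continuous_on (T \<times> U) \<Psi>"
      "continuous_on (T \<times> U) (dir_deriv \<Psi> (1, 0))"
    unfolding L'_def N'_def
    using Ck_on_continuous_on[OF L[of 0]] Ck_on_continuous_on[OF N[of 0]]
      Ck_on_continuous_on[OF Ck_on_dir_deriv[OF L[of "Suc 0"]]]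
      Ck_on_continuous_on[OF Ck_on_dir_deriv[OF N[of "Suc 0"]]]
      Ck_on_continuous_on[OF \<Psi>[of 0]]
      Ck_on_continuous_on[OF Ck_on_dir_deriv[OF \<Psi>[of "Suc 0"]]]
    by this+
  have diff: "L differentiable (at z)" "N differentiable (at z)" "\<Psi> differentiable (at z)"
    if "z \<in> T \<times> U" for z
    using Ck_on_differentiable[OF L _ that] Ck_on_differentiable[OF N _ that]
      Ck_on_differentiable[OF \<Psi> _ that] by blast+
  have lap: "laplacian (\<Phi> t) x = L (t, x)" if "t \<in> T" "x \<in> U" for t x
    unfolding \<Phi> L_def by (rule laplacian_slice[OF T(1) U that \<Psi>])
  have dL: "((\<lambda>s. L (s, x)) has_vector_derivative L' (t, x)) (at t)"
    and dN: "((\<lambda>s. N (s, x)) has_vector_derivative N' (t, x)) (at t)"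
    and dPsi: "((\<lambda>s. \<Psi> (s, x)) has_vector_derivative dir_deriv \<Psi> (1, 0) (t, x)) (at t)"
    if "t \<in> T" "x \<in> U" for t x
    unfolding L'_def N'_def using that by (intro has_vector_derivative_slice diff; simp)+
  have VPsi: "V x = dir_deriv \<Psi> (1, 0) (0, x)" if "x \<in> K" for x
    using vector_derivative_unique_at[OF V[OF that]] dPsi[OF T(2), of x] that K
    unfolding \<Phi> by blast
  have VN: "N' (0, x) = normal_vec b (V x)" if "x \<in> K" for x
  proof -
    have "((\<lambda>s. N (s, x)) has_vector_derivative normal_vec b (V x)) (at 0)"
      unfolding N_def
      using bounded_linear.has_vector_derivative[OF bounded_linear_normal_vec V[OF that]]
      by (simp add: \<Phi>)
    then show ?thesis using vector_derivative_unique_at dN[OF T(2), of x] that K by blast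
  qed
  define e where "e t x = (norm (tension b (\<Phi> t) x))\<^sup>2" for t x
  have e: "e t x = L (t, x) \<bullet> L (t, x) - (L (t, x) \<bullet> N (t, x))\<^sup>2 / (N (t, x) \<bullet> N (t, x))"
    if "t \<in> T" "x \<in> U" for t x
    using norm_tension[of b "\<Phi> t" x] NN[of "(t, x)"] that unfolding e_def lap[OF that]
    by (simp add: \<Psi>_def N_def)
  define e' where "e' z = 2 * (L z \<bullet> L' z) -
    (2 * (L z \<bullet> N z) * (L z \<bullet> N' z + L' z \<bullet> N z) * (N z \<bullet> N z) - (L z \<bullet> N z)\<^sup>2 * (2 * (N z \<bullet> N' z)))
      / (N z \<bullet> N z)\<^sup>2" for z
  note inner_deriv = bounded_bilinear.has_vector_derivative[OF bounded_bilinear_inner,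
      folded has_real_derivative_iff_has_vector_derivative]
  have de: "((\<lambda>s. e s x) has_vector_derivative e' (t, x)) (at t)" if tx: "t \<in> T" "x \<in> U" for t x
  proof -
    have "((\<lambda>s. L (s, x) \<bullet> L (s, x) - (L (s, x) \<bullet> N (s, x))\<^sup>2 / (N (s, x) \<bullet> N (s, x)))
        has_real_derivative e' (t, x)) (at t)"
      using NN[of "(t, x)"] tx unfolding e'_def
      by (auto intro!: derivative_eq_intros inner_deriv dL dN
          simp: inner_commute power2_eq_square algebra_simps)
    then show ?thesis
      unfolding has_real_derivative_iff_has_vector_derivative
      by (rule has_vector_derivative_transform_within_open[OF _ T(1) tx(1)]) (use e tx in simp)
  qed
  have cont_e': "continuous_on (T \<times> U) e'"
    unfolding e'_def using NN by (intro continuous_intros cont) force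
  have cont_e: "continuous_on K (e t)" if "t \<in> T" for t
  proof -
    have "continuous_on (T \<times> U) (\<lambda>z. L z \<bullet> L z - (L z \<bullet> N z)\<^sup>2 / (N z \<bullet> N z))"
      using NN by (intro continuous_intros cont) force
    then have "continuous_on K (\<lambda>x. (\<lambda>z. L z \<bullet> L z - (L z \<bullet> N z)\<^sup>2 / (N z \<bullet> N z)) (t, x))"
      by (rule continuous_on_compose2) (use that K in \<open>auto intro!: continuous_intros\<close>)
    then show ?thesis using e that K by (subst continuous_on_cong[OF refl]) auto
  qed
  have slice0: "continuous_on K (\<lambda>x. F (0, x))" if "continuous_on (T \<times> U) F"
    for F :: "real \<times> 'a \<Rightarrow> 'c::real_normed_vector"
    by (rule continuous_on_compose2[OF that]) (use T K in \<open>auto intro!: continuous_intros\<close>)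
  have "((\<lambda>t. LINT x:K|lebesgue. e t x) has_vector_derivative (LINT x:K|lebesgue. e' (0, x))) (at 0)"
    by (rule has_vector_derivative_set_integral_compact[OF K(1) \<open>\<epsilon> > 0\<close>, where f'="\<lambda>t x. e' (t, x)"])
      (use cont_e de K in \<open>auto simp: T_def[symmetric] intro: continuous_on_subset[OF cont_e']\<close>)
  then have "((\<lambda>t. LINT x:K|lebesgue. e t x) has_real_derivative (LINT x:K|lebesgue. e' (0, x))) (at 0)"
    by (simp add: has_real_derivative_iff_has_vector_derivative)
  from DERIV_cmult[OF this, of "1 / 2"]
  have E: "((\<lambda>t. bienergy b K (\<Phi> t)) has_real_derivative 1 / 2 * (LINT x:K|lebesgue. e' (0, x))) (at 0)"
    by (simp add: bienergy_def e_def)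
  define \<tau> where "\<tau> = tension b (\<Phi> 0)"
  define c where "c z = (L z \<bullet> N z) * inverse (N z \<bullet> N z)" for z
  have c: "Ck_on k (T \<times> U) c" for k
    unfolding c_def by (intro Ck_on_mult Ck_on_inverse Ck_on_inner W L N NN)
  have coeff: "normal_coeff b (\<Phi> 0) x = c (0, x)" if "x \<in> U" for x
    using lap[OF T(2) that] by (simp add: normal_coeff_def c_def N_def \<Psi>_def divide_inverse)
  have \<tau>_eq: "\<tau> x = L (0, x) - c (0, x) *\<^sub>R N (0, x)" if "x \<in> U" for x
    using lap[OF T(2) that] coeff[OF that] by (simp add: \<tau>_def tension_eq N_def \<Psi>_def)
  have \<tau>: "Ck_on 2 U \<tau>"
  proof -
    have "Ck_on 2 U (\<lambda>y. L (0, y) - c (0, y) *\<^sub>R N (0, y))"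
      by (rule Ck_on_slice[OF U T(2) Ck_on_diff[OF W L Ck_on_scaleR[OF W c N]]])
    then show ?thesis by (simp only: Ck_on_cong[OF U \<tau>_eq, where k=2])
  qed
  have cont\<tau>: "continuous_on K \<tau>" "continuous_on K (laplacian \<tau>)"
    using continuous_on_subset[OF Ck_on_continuous_on[OF \<tau>] K(2)]
      continuous_on_subset[OF continuous_on_laplacian[OF \<tau>] K(2)] by auto
  have "((\<lambda>t. LINT x:K|lebesgue. (L (t, x) - L (0, x)) \<bullet> \<tau> x) has_vector_derivative
      (LINT x:K|lebesgue. L' (0, x) \<bullet> \<tau> x)) (at 0)"
  proof (rule has_vector_derivative_set_integral_compact[OF K(1) \<open>\<epsilon> > 0\<close>, folded T_def, where f'="\<lambda>t x. L' (t, x) \<bullet> \<tau> x"])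
    show "continuous_on K (\<lambda>x. (L (t, x) - L (0, x)) \<bullet> \<tau> x)" if "t \<in> T" for t
      using that T K by (intro continuous_intros cont\<tau> continuous_on_compose2[OF cont(1)]) auto
    show "continuous_on (T \<times> K) (\<lambda>(t, x). L' (t, x) \<bullet> \<tau> x)"
      unfolding case_prod_unfold using K
      by (intro continuous_intros continuous_on_compose2[OF cont\<tau>(1)] continuous_on_compose2[OF cont(3)]) auto
    show "((\<lambda>s. (L (s, x) - L (0, x)) \<bullet> \<tau> x) has_vector_derivative L' (t, x) \<bullet> \<tau> x) (at t)"
      if "t \<in> T" "x \<in> K" for t x
      using dL[of t x] that K
      by (auto intro!: bounded_linear.has_vector_derivative[OF bounded_linear_inner_left]
          derivative_eq_intros)
  qed
  moreover have "(LINT x:K|lebesgue. (L (t, x) - L (0, x)) \<bullet> \<tau> x)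
      = (LINT x:K|lebesgue. (\<Psi> (t, x) - \<Psi> (0, x)) \<bullet> laplacian \<tau> x)" if "t \<in> T" for t
  proof -
    have slice: "Ck_on 2 U (\<lambda>y. \<Psi> (t, y))" "Ck_on 2 U (\<lambda>y. \<Psi> (0, y))"
      using Ck_on_slice[OF U that \<Psi>] Ck_on_slice[OF U T(2) \<Psi>] by auto
    have "(LINT x:K|lebesgue. (L (t, x) - L (0, x)) \<bullet> \<tau> x)
        = (LINT x:K|lebesgue. laplacian (\<lambda>y. \<Psi> (t, y) - \<Psi> (0, y)) x \<bullet> \<tau> x)"
      unfolding set_lebesgue_integral_def
    proof (intro Bochner_Integration.integral_cong refl)
      fix x
      show "indicator K x *\<^sub>R ((L (t, x) - L (0, x)) \<bullet> \<tau> x)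
          = indicator K x *\<^sub>R (laplacian (\<lambda>y. \<Psi> (t, y) - \<Psi> (0, y)) x \<bullet> \<tau> x)"
        using laplacian_diff[OF U _ slice, of x] lap[OF that, of x] lap[OF T(2), of x] K(2)
        by (cases "x \<in> K") (auto simp: \<Phi>)
    qed
    also have "\<dots> = (LINT x:K|lebesgue. (\<Psi> (t, x) - \<Psi> (0, x)) \<bullet> laplacian \<tau> x)"
      using \<Phi>out[OF that] \<Phi>0
      by (intro greens_identity[OF K U _ \<tau>] Ck_on_diff U slice) (simp add: \<Psi>_def)
    finally show ?thesis .
  qed
  ultimately have "((\<lambda>t. LINT x:K|lebesgue. (\<Psi> (t, x) - \<Psi> (0, x)) \<bullet> laplacian \<tau> x) has_vector_derivative
      (LINT x:K|lebesgue. L' (0, x) \<bullet> \<tau> x)) (at 0)"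
    using has_vector_derivative_transform_within_open[OF _ T] by (metis (no_types, lifting))
  moreover have "((\<lambda>t. LINT x:K|lebesgue. (\<Psi> (t, x) - \<Psi> (0, x)) \<bullet> laplacian \<tau> x) has_vector_derivative
      (LINT x:K|lebesgue. dir_deriv \<Psi> (1, 0) (0, x) \<bullet> laplacian \<tau> x)) (at 0)"
  proof (rule has_vector_derivative_set_integral_compact[OF K(1) \<open>\<epsilon> > 0\<close>, folded T_def,
        where f'="\<lambda>t x. dir_deriv \<Psi> (1, 0) (t, x) \<bullet> laplacian \<tau> x"])
    show "continuous_on K (\<lambda>x. (\<Psi> (t, x) - \<Psi> (0, x)) \<bullet> laplacian \<tau> x)" if "t \<in> T" for t
      using that T K by (intro continuous_intros cont\<tau> continuous_on_compose2[OF cont(5)]) auto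
    show "continuous_on (T \<times> K) (\<lambda>(t, x). dir_deriv \<Psi> (1, 0) (t, x) \<bullet> laplacian \<tau> x)"
      unfolding case_prod_unfold using K
      by (intro continuous_intros continuous_on_compose2[OF cont\<tau>(2)] continuous_on_compose2[OF cont(6)]) auto
    show "((\<lambda>s. (\<Psi> (s, x) - \<Psi> (0, x)) \<bullet> laplacian \<tau> x) has_vector_derivative
        dir_deriv \<Psi> (1, 0) (t, x) \<bullet> laplacian \<tau> x) (at t)"
      if "t \<in> T" "x \<in> K" for t x
      using dPsi[of t x] that K
      by (auto intro!: bounded_linear.has_vector_derivative[OF bounded_linear_inner_left]
          derivative_eq_intros)
  qed
  ultimately have swap: "(LINT x:K|lebesgue. L' (0, x) \<bullet> \<tau> x)
      = (LINT x:K|lebesgue. dir_deriv \<Psi> (1, 0) (0, x) \<bullet> laplacian \<tau> x)"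
    using vector_derivative_unique_at by blast
  note int = set_integrable_lebesgue_compact[OF K(1)]
  note sl = slice0[OF cont(1)] slice0[OF cont(3)] slice0[OF cont(4)] slice0[OF cont(6)]
      slice0[OF Ck_on_continuous_on[OF c]] cont\<tau>
  have "1 / 2 * (LINT x:K|lebesgue. e' (0, x)) = (LINT x:K|lebesgue. 1 / 2 * e' (0, x))" by simp
  also have "\<dots> = (LINT x:K|lebesgue. L' (0, x) \<bullet> \<tau> x - c (0, x) * (\<tau> x \<bullet> N' (0, x)))"
    unfolding set_lebesgue_integral_def
  proof (intro Bochner_Integration.integral_cong refl)
    fix x
    \<comment> \<open>The product rule, with \<open>\<tau> = L - c N\<close> substituted for \<open>\<tau>\<close>.\<close>
    have "1 / 2 * e' (0, x) = L' (0, x) \<bullet> \<tau> x - c (0, x) * (\<tau> x \<bullet> N' (0, x))" if "x \<in> K"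
    proof -
      have x: "(0, x) \<in> T \<times> U" using that K T by auto
      then have "\<tau> x = L (0, x) - c (0, x) *\<^sub>R N (0, x)" using \<tau>_eq by simp
      then show ?thesis using NN[OF x] unfolding e'_def c_def
        by (simp only:) (simp add: inner_diff_left inner_diff_right inner_commute field_simps power2_eq_square)
    qed
    then show "indicator K x *\<^sub>R (1 / 2 * e' (0, x))
        = indicator K x *\<^sub>R (L' (0, x) \<bullet> \<tau> x - c (0, x) * (\<tau> x \<bullet> N' (0, x)))"
      by (cases "x \<in> K") auto
  qed
  also have "\<dots> = (LINT x:K|lebesgue. L' (0, x) \<bullet> \<tau> x) - (LINT x:K|lebesgue. c (0, x) * (\<tau> x \<bullet> N' (0, x)))"
    by (intro set_integral_diff(2) int continuous_intros sl)
  also have "\<dots> = (LINT x:K|lebesgue. dir_deriv \<Psi> (1, 0) (0, x) \<bullet> laplacian \<tau> x - c (0, x) * (\<tau> x \<bullet> N' (0, x)))"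
    unfolding swap by (intro set_integral_diff(2)[symmetric] int continuous_intros sl)
  also have "\<dots> = (LINT x:K|lebesgue. bienergy_gradient b \<phi> x \<bullet> V x)"
    unfolding set_lebesgue_integral_def
  proof (intro Bochner_Integration.integral_cong refl)
    fix x
    have "dir_deriv \<Psi> (1, 0) (0, x) \<bullet> laplacian \<tau> x - c (0, x) * (\<tau> x \<bullet> N' (0, x))
        = bienergy_gradient b \<phi> x \<bullet> V x" if "x \<in> K"
    proof -
      have x: "x \<in> U" using that K by blast
      have "bienergy_gradient b \<phi> x = bienergy_gradient b (\<Phi> 0) x"
        using bienergy_gradient_cong_open[OF U x] \<Phi>0 by metis
      also have "\<dots> = laplacian \<tau> x - c (0, x) *\<^sub>R normal_vec b (\<tau> x)"
        using coeff[OF x] by (simp add: bienergy_gradient_def \<tau>_def)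
      finally show ?thesis
        unfolding VPsi[OF that, symmetric] VN[OF that]
        by (simp add: inner_diff_left inner_diff_right inner_commute[of "V x"] normal_vec_selfadjoint)
    qed
    then show "indicator K x *\<^sub>R (dir_deriv \<Psi> (1, 0) (0, x) \<bullet> laplacian \<tau> x - c (0, x) * (\<tau> x \<bullet> N' (0, x)))
        = indicator K x *\<^sub>R (bienergy_gradient b \<phi> x \<bullet> V x)"
      by (cases "x \<in> K") auto
  qed
  finally show ?thesis using E by simp
qed

section \<open>Radial fields\<close>

text \<open>For \<open>\<delta> = 0\<close> this is \<open>|x|\<^sup>2\<^sup>s\<close>. A positive \<open>\<delta>\<close> makes it smooth at the origin; the formulas for the
  derivatives are the same in both cases.\<close>

definition rpow :: "real \<Rightarrow> real \<Rightarrow> 'a::euclidean_space \<Rightarrow> real" where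
  "rpow \<delta> s x = (\<delta> + x \<bullet> x) powr s"

lemma rpow_add: "rpow \<delta> s x * rpow \<delta> t x = rpow \<delta> (s + t) x"
  by (simp add: rpow_def powr_add)

lemma rpow_inner: "x \<noteq> 0 \<Longrightarrow> rpow 0 s x * (x \<bullet> x) = rpow 0 (s + 1) x"
  using powr_add[of "x \<bullet> x" s 1] by (simp add: rpow_def powr_one)

lemma rpow_pos: "x \<noteq> 0 \<Longrightarrow> rpow 0 s x > 0"
  by (simp add: rpow_def)

lemma rpow_0: "x \<noteq> 0 \<Longrightarrow> rpow 0 0 x = 1"
  by (simp add: rpow_def)

lemma rpow_norm: "rpow 0 s x = norm x powr (2 * s)"
proof -
  have "x \<bullet> x = norm x powr 2" by (simp add: dot_square_norm)
  then show ?thesis by (simp only: rpow_def add_0_left powr_powr)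
qed

lemma has_derivative_rpow:
  fixes x :: "'a::euclidean_space"
  assumes "\<delta> + x \<bullet> x > 0"
  shows "(rpow \<delta> s has_derivative (\<lambda>v. 2 * s * rpow \<delta> (s - 1) x * (x \<bullet> v))) (at x)"
proof -
  have "((\<lambda>t. t powr s) has_derivative (\<lambda>h. s * (\<delta> + x \<bullet> x) powr (s - 1) * h)) (at (\<delta> + x \<bullet> x))"
    using has_real_derivative_powr[OF assms, of s] unfolding has_field_derivative_def .
  moreover have "((\<lambda>x. \<delta> + x \<bullet> x) has_derivative (\<lambda>v. 2 * (x \<bullet> v))) (at x)"
    by (auto intro!: derivative_eq_intros simp: inner_commute)
  ultimately have "((\<lambda>x. (\<delta> + x \<bullet> x) powr s) has_derivative
      (\<lambda>v. s * (\<delta> + x \<bullet> x) powr (s - 1) * (2 * (x \<bullet> v)))) (at x)"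
    using has_derivative_compose by blast
  moreover have "rpow \<delta> s = (\<lambda>x::'a. (\<delta> + x \<bullet> x) powr s)" by (simp add: rpow_def fun_eq_iff)
  ultimately show ?thesis by (simp add: rpow_def mult_ac)
qed

lemma open_rpow_domain: "open {x::'a::euclidean_space. \<delta> + x \<bullet> x > 0}"
  by (intro open_Collect_less continuous_intros)

lemma Ck_on_rpow: "Ck_on k {x::'a::euclidean_space. \<delta> + x \<bullet> x > 0} (rpow \<delta> s)"
proof -
  have "Ck_on k {x::'a. \<delta> + x \<bullet> x > 0} (\<lambda>x. \<delta> + x \<bullet> x)"
    by (intro Ck_on_add Ck_on_inner Ck_on_const open_rpow_domain
        Ck_on_bounded_linear[OF bounded_linear_ident])
  then have "Ck_on k {x::'a. \<delta> + x \<bullet> x > 0} (\<lambda>x. (\<delta> + x \<bullet> x) powr s)"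
    by (intro Ck_on_compose_real[OF open_rpow_domain _ _ Ck_on_powr]) auto
  moreover have "rpow \<delta> s = (\<lambda>x::'a. (\<delta> + x \<bullet> x) powr s)" by (simp add: rpow_def fun_eq_iff)
  ultimately show ?thesis by simp
qed

lemma punctured_domain: "{x::'a::euclidean_space. 0 + x \<bullet> x > 0} = - {0}"
  by auto

lemmas Ck_on_rpow_punctured = Ck_on_rpow[of _ 0, unfolded punctured_domain]

lemma dir_deriv_rpow:
  "x \<noteq> 0 \<Longrightarrow> dir_deriv (rpow 0 s) v x = 2 * s * rpow 0 (s - 1) x * (x \<bullet> v)"
  by (intro dir_deriv_eqI has_derivative_rpow) simp

lemma has_derivative_rpow_scaleR:
  assumes "\<delta> + x \<bullet> x > 0"
  shows "((\<lambda>x. rpow \<delta> s x *\<^sub>R x) has_derivative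
    (\<lambda>v. rpow \<delta> s x *\<^sub>R v + (2 * s * rpow \<delta> (s - 1) x * (x \<bullet> v)) *\<^sub>R x)) (at x)"
  by (rule has_derivative_scaleR[OF has_derivative_rpow[OF assms] has_derivative_ident])

lemma open_punctured: "open (- {0::'a::euclidean_space})" by blast

lemma sum_Basis_inner_square: "(\<Sum>i\<in>Basis. (x \<bullet> i) * (x \<bullet> i)) = x \<bullet> x"
  using euclidean_inner[of x x] by simp

text \<open>The Laplacian of \<open>r\<^sup>p\<close> is \<open>p (p + n - 2) r\<^sup>p\<^sup>-\<^sup>2\<close>; here \<open>p = 2 s\<close>.\<close>

lemma laplacian_rpow:
  fixes x :: "'a::euclidean_space"
  assumes "x \<noteq> 0"
  shows "laplacian (rpow 0 s) x = 2 * s * (2 * s + DIM('a) - 2) * rpow 0 (s - 1) x"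
proof -
  have "dir_deriv (dir_deriv (rpow 0 s) i) i x
      = 2 * s * rpow 0 (s - 1) x * (i \<bullet> i) + 4 * s * (s - 1) * rpow 0 (s - 2) x * ((x \<bullet> i) * (x \<bullet> i))" for i
  proof -
    have "dir_deriv (dir_deriv (rpow 0 s) i) i x = dir_deriv (\<lambda>x. 2 * s * rpow 0 (s - 1) x * (x \<bullet> i)) i x"
      by (rule dir_deriv_cong_open[OF open_punctured]) (use assms dir_deriv_rpow in auto)
    also have "\<dots> = 2 * s * rpow 0 (s - 1) x * (i \<bullet> i) + 2 * s * (2 * (s - 1) * rpow 0 (s - 1 - 1) x * (x \<bullet> i)) * (x \<bullet> i)"
      by (rule dir_deriv_eqI) (use assms in \<open>auto intro!: derivative_eq_intros has_derivative_rpow\<close>)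
    finally show ?thesis by (simp add: algebra_simps)
  qed
  then have "laplacian (rpow 0 s) x
      = 2 * s * rpow 0 (s - 1) x * DIM('a) + 4 * s * (s - 1) * (rpow 0 (s - 2) x * (x \<bullet> x))"
    by (simp add: laplacian_def sum.distrib sum_distrib_left[symmetric] sum_Basis_inner_square mult.assoc)
  also have "rpow 0 (s - 2) x * (x \<bullet> x) = rpow 0 (s - 1) x"
    using rpow_inner[OF assms, of "s - 2"] by simp
  finally show ?thesis by (simp add: algebra_simps)
qed

text \<open>The Laplacian of \<open>r\<^sup>p x\<close> is \<open>p (p + n) r\<^sup>p\<^sup>-\<^sup>2 x\<close>; here \<open>p = 2 s\<close>.\<close>

lemma laplacian_rpow_scaleR:
  fixes x :: "'a::euclidean_space"
  assumes "x \<noteq> 0"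
  shows "laplacian (\<lambda>x. rpow 0 s x *\<^sub>R x) x = (2 * s * (2 * s + DIM('a)) * rpow 0 (s - 1) x) *\<^sub>R x"
proof -
  have d: "dir_deriv (\<lambda>x. rpow 0 s x *\<^sub>R x) i y
      = rpow 0 s y *\<^sub>R i + (2 * s * rpow 0 (s - 1) y * (y \<bullet> i)) *\<^sub>R y" if "y \<noteq> 0" for i y :: 'a
    by (rule dir_deriv_eqI[OF has_derivative_rpow_scaleR]) (use that in simp)
  have "dir_deriv (dir_deriv (\<lambda>x. rpow 0 s x *\<^sub>R x) i) i x
      = (4 * s * rpow 0 (s - 1) x) *\<^sub>R ((x \<bullet> i) *\<^sub>R i)
        + (2 * s * rpow 0 (s - 1) x * (i \<bullet> i) + 4 * s * (s - 1) * rpow 0 (s - 2) x * ((x \<bullet> i) * (x \<bullet> i))) *\<^sub>R x" for i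
  proof -
    have "dir_deriv (dir_deriv (\<lambda>x. rpow 0 s x *\<^sub>R x) i) i x
        = dir_deriv (\<lambda>y. rpow 0 s y *\<^sub>R i + (2 * s * rpow 0 (s - 1) y * (y \<bullet> i)) *\<^sub>R y) i x"
      by (rule dir_deriv_cong_open[OF open_punctured]) (use assms d in auto)
    also have "\<dots> = (2 * s * rpow 0 (s - 1) x * (x \<bullet> i)) *\<^sub>R i +
        ((2 * s * rpow 0 (s - 1) x * (x \<bullet> i)) *\<^sub>R i
          + (2 * s * rpow 0 (s - 1) x * (i \<bullet> i) + 2 * s * (2 * (s - 1) * rpow 0 (s - 1 - 1) x * (x \<bullet> i)) * (x \<bullet> i)) *\<^sub>R x)"
      by (rule dir_deriv_eqI) (use assms in \<open>auto intro!: derivative_eq_intros has_derivative_rpow\<close>)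
    finally show ?thesis by (simp add: algebra_simps) (simp flip: scaleR_add_left)
  qed
  moreover have "(\<Sum>i\<in>Basis. (4 * s * rpow 0 (s - 1) x) *\<^sub>R ((x \<bullet> i) *\<^sub>R i))
      = (4 * s * rpow 0 (s - 1) x) *\<^sub>R (\<Sum>i\<in>Basis. (x \<bullet> i) *\<^sub>R i)"
    by (rule scaleR_sum_right[symmetric])
  ultimately have "laplacian (\<lambda>x. rpow 0 s x *\<^sub>R x) x = (4 * s * rpow 0 (s - 1) x) *\<^sub>R (\<Sum>i\<in>Basis. (x \<bullet> i) *\<^sub>R i)
      + (2 * s * rpow 0 (s - 1) x * DIM('a) + 4 * s * (s - 1) * rpow 0 (s - 2) x * (\<Sum>i\<in>Basis. (x \<bullet> i) * (x \<bullet> i))) *\<^sub>R x"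
    by (simp add: laplacian_def sum.distrib scaleR_sum_left[symmetric] sum_distrib_left[symmetric])
  also have "\<dots> = (4 * s * rpow 0 (s - 1) x + 2 * s * rpow 0 (s - 1) x * DIM('a) + 4 * s * (s - 1) * (rpow 0 (s - 2) x * (x \<bullet> x))) *\<^sub>R x"
    unfolding sum_Basis_inner_square euclidean_representation by (simp add: algebra_simps)
  also have "rpow 0 (s - 2) x * (x \<bullet> x) = rpow 0 (s - 1) x"
    using rpow_inner[OF assms, of "s - 2"] by simp
  finally show ?thesis by (simp add: algebra_simps)
qed

lemma dir_deriv_bounded_linear:
  assumes "bounded_linear L" "f differentiable (at x)"
  shows "dir_deriv (\<lambda>x. L (f x)) v x = L (dir_deriv f v x)"
  by (rule dir_deriv_eqI[OF bounded_linear.has_derivative[OF assms(1)]]) (intro has_derivative_dir_deriv assms)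

lemma laplacian_bounded_linear:
  assumes "open U" "x \<in> U" "bounded_linear L" "Ck_on 2 U f"
  shows "laplacian (\<lambda>x. L (f x)) x = L (laplacian f x)"
proof -
  have "dir_deriv (dir_deriv (\<lambda>x. L (f x)) i) i x = L (dir_deriv (dir_deriv f i) i x)" for i
  proof -
    have "dir_deriv (\<lambda>x. L (f x)) i y = L (dir_deriv f i y)" if "y \<in> U" for y
      using that assms(4) by (intro dir_deriv_bounded_linear assms(3)) (auto simp: numeral_2_eq_2)
    then have "dir_deriv (dir_deriv (\<lambda>x. L (f x)) i) i x = dir_deriv (\<lambda>y. L (dir_deriv f i y)) i x"
      by (rule dir_deriv_cong_open[OF assms(1,2)])
    also have "\<dots> = L (dir_deriv (dir_deriv f i) i x)"
      using assms by (intro dir_deriv_bounded_linear) (auto simp: numeral_2_eq_2)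
    finally show ?thesis .
  qed
  then show ?thesis
    by (simp add: laplacian_def linear_sum[OF bounded_linear.linear[OF assms(3)]])
qed

lemma fst_laplacian: "open U \<Longrightarrow> x \<in> U \<Longrightarrow> Ck_on 2 U f \<Longrightarrow> fst (laplacian f x) = laplacian (\<lambda>x. fst (f x)) x"
  and snd_laplacian: "open U \<Longrightarrow> x \<in> U \<Longrightarrow> Ck_on 2 U f \<Longrightarrow> snd (laplacian f x) = laplacian (\<lambda>x. snd (f x)) x"
  using laplacian_bounded_linear[OF _ _ bounded_linear_fst] laplacian_bounded_linear[OF _ _ bounded_linear_snd]
  by metis+

text \<open>The rotationally equivariant fields with power-law coefficients. The Laplacian and the linear map
  \<open>normal_vec b\<close> act on the two coefficients \<open>\<alpha>\<close> and \<open>\<beta>\<close> only, apart from a shift of the exponents.\<close>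

definition radial_field :: "real \<Rightarrow> real \<Rightarrow> real \<Rightarrow> real \<Rightarrow> 'a::euclidean_space \<Rightarrow> 'a \<times> real" where
  "radial_field s t \<alpha> \<beta> x = (\<alpha> *\<^sub>R (rpow 0 s x *\<^sub>R x), \<beta> * rpow 0 t x)"

lemma Ck_on_radial_field: "Ck_on k (- {0}) (radial_field s t \<alpha> \<beta>)"
  unfolding radial_field_def[abs_def]
  by (intro Ck_on_Pair Ck_on_scaleR Ck_on_mult Ck_on_const Ck_on_rpow_punctured open_punctured
      Ck_on_bounded_linear[OF bounded_linear_ident])

lemma laplacian_radial_field:
  fixes x :: "'a::euclidean_space"
  assumes "x \<noteq> 0"
  shows "laplacian (radial_field s t \<alpha> \<beta>) x = radial_field (s - 1) (t - 1)
    (2 * s * (2 * s + DIM('a)) * \<alpha>) (2 * t * (2 * t + DIM('a) - 2) * \<beta>) x"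
proof -
  have x: "x \<in> - {0}" using assms by simp
  have C: "Ck_on 2 (- {0}) (\<lambda>x::'a. rpow 0 s x *\<^sub>R x)"
    by (intro Ck_on_scaleR Ck_on_rpow_punctured open_punctured Ck_on_bounded_linear[OF bounded_linear_ident])
  have "laplacian (radial_field s t \<alpha> \<beta>) x
      = (laplacian (\<lambda>x. \<alpha> *\<^sub>R (rpow 0 s x *\<^sub>R x)) x, laplacian (\<lambda>x. \<beta> * rpow 0 t x) x)"
    using fst_laplacian[OF open_punctured x Ck_on_radial_field, of s t \<alpha> \<beta>]
      snd_laplacian[OF open_punctured x Ck_on_radial_field, of s t \<alpha> \<beta>]
    by (intro prod_eqI) (simp_all add: radial_field_def)
  also have "laplacian (\<lambda>x. \<alpha> *\<^sub>R (rpow 0 s x *\<^sub>R x)) x = \<alpha> *\<^sub>R laplacian (\<lambda>x. rpow 0 s x *\<^sub>R x) x"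
    by (rule laplacian_bounded_linear[OF open_punctured x bounded_linear_scaleR_right C])
  also have "laplacian (\<lambda>x. \<beta> * rpow 0 t x) x = \<beta> * laplacian (rpow 0 t) x"
    by (rule laplacian_bounded_linear[OF open_punctured x bounded_linear_mult_right Ck_on_rpow_punctured])
  finally show ?thesis
    unfolding radial_field_def[of "s - 1"] laplacian_rpow[OF assms] laplacian_rpow_scaleR[OF assms]
    by (simp add: mult_ac)
qed

lemma normal_vec_radial_field:
  "normal_vec b (radial_field s t \<alpha> \<beta> x) = radial_field s t \<alpha> (\<beta> / b\<^sup>2) x"
  by (simp add: normal_vec_def radial_field_def)

lemma radial_field_inner:
  assumes "x \<noteq> 0"
  shows "radial_field s t \<alpha> \<beta> x \<bullet> radial_field s' t' \<alpha>' \<beta>' x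
    = \<alpha> * \<alpha>' * rpow 0 (s + s' + 1) x + \<beta> * \<beta>' * rpow 0 (t + t') x"
  using rpow_inner[OF assms, of "s + s'"] rpow_add[of 0 s x s'] rpow_add[of 0 t x t']
  by (simp add: radial_field_def inner_prod_def mult.assoc) (simp add: mult_ac)

lemma radial_field_rpow_mult:
  "(k * rpow 0 u x) *\<^sub>R radial_field s t \<alpha> \<beta> x = radial_field (s + u) (t + u) (k * \<alpha>) (k * \<beta>) x"
  using rpow_add[of 0 s x u] rpow_add[of 0 t x u]
  by (simp add: radial_field_def mult_ac)

lemma radial_field_diff:
  "radial_field s t \<alpha> \<beta> x - radial_field s t \<alpha>' \<beta>' x = radial_field s t (\<alpha> - \<alpha>') (\<beta> - \<beta>') x"
  by (simp add: radial_field_def algebra_simps)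

section \<open>Tension field and bienergy gradient of the maps \<open>phi b a\<close>\<close>

lemma phi_eq_radial_field:
  "x \<noteq> 0 \<Longrightarrow> phi b a x = radial_field (- 1 / 2) 0 (sin a) (b * cos a) x"
  by (simp add: phi_def radial_field_def rpow_0 rpow_norm powr_minus)

text \<open>The squared length of the normal field along the map \<open>phi b a\<close>.\<close>

definition normal_vec_sq :: "real \<Rightarrow> real \<Rightarrow> real" where
  "normal_vec_sq b a = (sin a)\<^sup>2 + (cos a)\<^sup>2 / b\<^sup>2"

lemma normal_vec_sq_pos: "b > 0 \<Longrightarrow> normal_vec_sq b a > 0"
  using sin_cos_squared_add[of a] unfolding normal_vec_sq_def
  by (cases "sin a = 0") (auto intro!: add_pos_nonneg)

lemma laplacian_phi:
  fixes x :: "real ^ 'n"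
  assumes "x \<noteq> 0"
  shows "laplacian (phi b a) x = radial_field (- 3 / 2) (- 1) (- (real CARD('n) - 1) * sin a) 0 x"
proof -
  have "laplacian (phi b a) x = laplacian (radial_field (- 1 / 2) 0 (sin a) (b * cos a)) x"
    by (rule laplacian_cong_open[OF open_punctured]) (use assms phi_eq_radial_field in auto)
  then show ?thesis by (simp add: laplacian_radial_field[OF assms])
qed

lemma normal_vec_phi:
  assumes "x \<noteq> 0"
  shows "normal_vec b (phi b a x) = radial_field (- 1 / 2) 0 (sin a) (cos a / b) x"
  by (simp add: phi_eq_radial_field[OF assms] normal_vec_radial_field power2_eq_square)

lemma normal_coeff_phi:
  fixes x :: "real ^ 'n"
  assumes "x \<noteq> 0" "b > 0"
  shows "normal_coeff b (phi b a) x = - ((real CARD('n) - 1) * (sin a)\<^sup>2 / normal_vec_sq b a) * rpow 0 (- 1) x"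
proof -
  have "radial_field (- 1 / 2) 0 (sin a) (cos a / b) x \<bullet> radial_field (- 1 / 2) 0 (sin a) (cos a / b) x = normal_vec_sq b a"
    using assms by (simp add: radial_field_inner rpow_0 normal_vec_sq_def power2_eq_square)
  then show ?thesis
    unfolding normal_coeff_def laplacian_phi[OF assms(1)] normal_vec_phi[OF assms(1)]
    by (simp only:) (simp add: radial_field_inner[OF assms(1)] power2_eq_square algebra_simps diff_divide_distrib)
qed

definition tension_coeff :: "real \<Rightarrow> real \<Rightarrow> real \<Rightarrow> real" where
  "tension_coeff n b a = (n - 1) * sin a * cos a / (b * normal_vec_sq b a)"

text \<open>As \<open>\<Delta>\<phi> = -(n - 1) sin a (u, 0) / |x|\<^sup>2\<close>, its tangential part is a multiple of the polar
  direction \<open>(cos a u, - b sin a)\<close>.\<close>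

lemma tension_phi:
  fixes x :: "real ^ 'n"
  assumes "x \<noteq> 0" "b > 0"
  shows "tension b (phi b a) x = radial_field (- 3 / 2) (- 1)
    (- tension_coeff CARD('n) b a * cos a / b) (tension_coeff CARD('n) b a * sin a) x"
proof -
  let ?n = "real CARD('n)" and ?D = "normal_vec_sq b a"
  have D: "?D > 0" using normal_vec_sq_pos assms by blast
  have 1: "- (?n - 1) * sin a - - ((?n - 1) * (sin a)\<^sup>2 / ?D) * sin a = - tension_coeff ?n b a * cos a / b"
  proof -
    have "- (?n - 1) * sin a - - ((?n - 1) * (sin a)\<^sup>2 / ?D) * sin a = - (?n - 1) * sin a * (?D - (sin a)\<^sup>2) / ?D"
      using D by (simp add: field_simps)
    also have "?D - (sin a)\<^sup>2 = (cos a)\<^sup>2 / b\<^sup>2" by (simp add: normal_vec_sq_def)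
    finally show ?thesis using D assms(2)
      by (simp only:) (simp add: tension_coeff_def field_simps power2_eq_square)
  qed
  have 2: "0 - - ((?n - 1) * (sin a)\<^sup>2 / ?D) * (cos a / b) = tension_coeff ?n b a * sin a"
    by (simp add: tension_coeff_def power2_eq_square mult_ac)
  have "tension b (phi b a) x = radial_field (- 3 / 2) (- 1) (- (?n - 1) * sin a) 0 x
      - radial_field (- 1 / 2 + - 1) (0 + - 1) (- ((?n - 1) * (sin a)\<^sup>2 / ?D) * sin a) (- ((?n - 1) * (sin a)\<^sup>2 / ?D) * (cos a / b)) x"
    unfolding tension_eq laplacian_phi[OF assms(1)] normal_vec_phi[OF assms(1)] normal_coeff_phi[OF assms]
      radial_field_rpow_mult ..
  also have "- 1 / 2 + - 1 = (- 3 / 2 :: real)" by simp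
  also have "0 + - 1 = (- 1 :: real)" by simp
  finally show ?thesis unfolding radial_field_diff 1 2 .
qed

lemma bienergy_gradient_phi:
  fixes x :: "real ^ 'n" and a b :: real
  assumes "x \<noteq> 0" "b > 0"
  defines "\<kappa> \<equiv> (real CARD('n) - 1) * (sin a)\<^sup>2 / normal_vec_sq b a"
  shows "bienergy_gradient b (phi b a) x = radial_field (- 5 / 2) (- 2)
    (tension_coeff CARD('n) b a * (3 * (real CARD('n) - 3) - \<kappa>) * cos a / b)
    (tension_coeff CARD('n) b a * (\<kappa> / b\<^sup>2 - 2 * (real CARD('n) - 4)) * sin a) x"
proof -
  let ?n = "real CARD('n)" and ?c = "tension_coeff CARD('n) b a"
  have "laplacian (tension b (phi b a)) x = laplacian (radial_field (- 3 / 2) (- 1) (- ?c * cos a / b) (?c * sin a)) x"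
    by (rule laplacian_cong_open[OF open_punctured]) (use assms tension_phi in auto)
  also have "\<dots> = radial_field (- 5 / 2) (- 2) (3 * (?n - 3) * ?c * cos a / b) (- 2 * (?n - 4) * ?c * sin a) x"
    unfolding laplacian_radial_field[OF assms(1)] by (simp add: algebra_simps diff_divide_distrib)
  finally have lap: "laplacian (tension b (phi b a)) x = \<dots>" .
  have e1: "3 * (?n - 3) * ?c * cos a / b - - \<kappa> * (- ?c * cos a / b) = ?c * (3 * (?n - 3) - \<kappa>) * cos a / b"
    and e2: "- 2 * (?n - 4) * ?c * sin a - - \<kappa> * (?c * sin a / b\<^sup>2) = ?c * (\<kappa> / b\<^sup>2 - 2 * (?n - 4)) * sin a"
    using assms(2) by (simp_all add: field_simps)
  have "bienergy_gradient b (phi b a) x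
      = radial_field (- 5 / 2) (- 2) (3 * (?n - 3) * ?c * cos a / b) (- 2 * (?n - 4) * ?c * sin a) x
        - radial_field (- 3 / 2 + - 1) (- 1 + - 1) (- \<kappa> * (- ?c * cos a / b)) (- \<kappa> * (?c * sin a / b\<^sup>2)) x"
    unfolding bienergy_gradient_def lap normal_coeff_phi[OF assms(1,2)] tension_phi[OF assms(1,2)]
      normal_vec_radial_field radial_field_rpow_mult \<kappa>_def ..
  also have "- 3 / 2 + - 1 = (- 5 / 2 :: real)" by simp
  also have "- 1 + - 1 = (- 2 :: real)" by simp
  finally show ?thesis unfolding radial_field_diff e1 e2 .
qed

section \<open>Integrability of the inverse fourth power of the norm\<close>

lemma dyadic_shell:
  assumes "0 < r" "r < (1::real)"
  obtains k :: nat where "(1 / 2) ^ Suc k \<le> r" "r \<le> (1 / 2) ^ k"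
proof -
  have "\<exists>k. (1 / 2) ^ Suc k \<le> r"
  proof -
    obtain k where "(1 / 2) ^ k < r" using real_arch_pow_inv[OF assms(1), of "1 / 2"] by auto
    moreover have "(1 / 2 :: real) ^ Suc k \<le> (1 / 2) ^ k" by (rule power_decreasing) auto
    ultimately show ?thesis by (intro exI[of _ k]) linarith
  qed
  then have k: "(1 / 2) ^ Suc (LEAST k. (1 / 2) ^ Suc k \<le> r) \<le> r" by (rule LeastI_ex)
  moreover have "r \<le> (1 / 2) ^ (LEAST k. (1 / 2) ^ Suc k \<le> r)"
  proof (cases "LEAST k. (1 / 2) ^ Suc k \<le> r")
    case 0
    then show ?thesis using assms by simp
  next
    case (Suc j)
    then have "\<not> (1 / 2) ^ Suc j \<le> r" using not_less_Least[of j] by (metis lessI)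
    then show ?thesis using Suc by simp
  qed
  ultimately show ?thesis using that by blast
qed

lemma term_le_suminf: "g k \<le> suminf g" for g :: "nat \<Rightarrow> ennreal"
  using sum_le_suminf[of g "{k}"] by simp

lemma rpow_measurable [measurable]: "rpow \<delta> s \<in> borel_measurable borel"
  unfolding rpow_def[abs_def] by measurable

text \<open>The term whose index is that of the dyadic shell of \<open>x\<close> already dominates \<open>|x|\<^sup>-\<^sup>4\<close> inside the unit ball.\<close>

lemma rpow_minus_2_le_dyadic_sum:
  fixes x :: "'a::euclidean_space"
  shows "indicator (ball 0 1) x * ennreal (rpow 0 (- 2) x)
    \<le> (\<Sum>k. ennreal (16 ^ Suc k) * indicator (cball 0 ((1 / 2) ^ k)) x)"
proof (cases "x \<in> ball 0 1 - {0}")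
  case True
  then have "0 < norm x" "norm x < 1" by auto
  then obtain k where k: "(1 / 2) ^ Suc k \<le> norm x" "norm x \<le> (1 / 2) ^ k" by (rule dyadic_shell)
  have "rpow 0 (- 2) x = inverse (norm x ^ 4)"
    using \<open>0 < norm x\<close> powr_realpow[of "norm x" 4] by (simp add: rpow_norm powr_minus)
  also have "\<dots> \<le> inverse (((1 / 2) ^ Suc k) ^ 4)"
    using k by (intro le_imp_inverse_le power_mono) auto
  also have "((1 / 2 :: real) ^ Suc k) ^ 4 = (1 / 16) ^ Suc k"
    by (simp add: power_mult[symmetric] power_divide mult.commute[of _ 4] power_mult[of _ 4])
  also have "inverse ((1 / 16 :: real) ^ Suc k) = 16 ^ Suc k" by (simp add: power_divide)
  finally have "ennreal (rpow 0 (- 2) x) \<le> ennreal (16 ^ Suc k) * indicator (cball 0 ((1 / 2) ^ k)) x"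
    using k(2) by (simp add: ennreal_leI)
  also have "\<dots> \<le> (\<Sum>k. ennreal (16 ^ Suc k) * indicator (cball 0 ((1 / 2) ^ k)) x)"
    by (rule term_le_suminf)
  finally show ?thesis using True by simp
next
  case False
  then have "indicator (ball 0 1) x * ennreal (rpow 0 (- 2) x) = 0"
    by (auto simp: rpow_norm indicator_def)
  then show ?thesis by (simp only: zero_le)
qed

text \<open>The ball of radius \<open>2\<^sup>-\<^sup>k\<close> has volume proportional to \<open>2\<^sup>-\<^sup>k\<^sup>n\<close>, and the sum of \<open>16\<^sup>k 2\<^sup>-\<^sup>k\<^sup>n\<close> converges for
  \<open>n \<ge> 5\<close>.\<close>

lemma integrable_rpow_minus_2:
  assumes "DIM('a::euclidean_space) \<ge> 5"
  shows "set_integrable lebesgue (ball 0 1 :: 'a set) (rpow 0 (- 2))"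
proof -
  have m: "(\<lambda>x::'a. indicator (ball 0 1) x *\<^sub>R rpow 0 (- 2) x) \<in> borel_measurable lborel"
    by (intro borel_measurable_scaleR borel_measurable_indicator) simp_all
  have [measurable]: "cball 0 r \<in> sets (borel :: 'a measure)" for r by simp
  have dyad: "(\<lambda>x::'a. ennreal (16 ^ Suc k) * indicator (cball 0 ((1 / 2) ^ k)) x) \<in> borel_measurable lborel" for k
    by measurable
  define V where "V = unit_ball_vol (real DIM('a))"
  have V: "V \<ge> 0" by (simp add: V_def)
  have "(\<integral>\<^sup>+ x. ennreal (norm (indicator (ball 0 1) x *\<^sub>R rpow 0 (- 2) (x::'a))) \<partial>lborel)
      \<le> (\<integral>\<^sup>+ x. (\<Sum>k. ennreal (16 ^ Suc k) * indicator (cball 0 ((1 / 2) ^ k)) (x::'a)) \<partial>lborel)"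
  proof (rule nn_integral_mono)
    fix x :: 'a
    have "ennreal (norm (indicator (ball 0 1) x *\<^sub>R rpow 0 (- 2) x)) = indicator (ball 0 1) x * ennreal (rpow 0 (- 2) x)"
      by (auto simp: indicator_def rpow_def)
    then show "ennreal (norm (indicator (ball 0 1) x *\<^sub>R rpow 0 (- 2) x))
      \<le> (\<Sum>k. ennreal (16 ^ Suc k) * indicator (cball 0 ((1 / 2) ^ k)) x)"
      using rpow_minus_2_le_dyadic_sum[of x] by simp
  qed
  also have "\<dots> = (\<Sum>k. \<integral>\<^sup>+ x. ennreal (16 ^ Suc k) * indicator (cball 0 ((1 / 2) ^ k)) (x::'a) \<partial>lborel)"
    by (rule nn_integral_suminf[OF dyad])
  also have "\<dots> \<le> (\<Sum>k. ennreal (16 * V * (1 / 2) ^ k))"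
  proof (intro suminf_le summableI)
    fix k :: nat
    have "16 ^ Suc k * (V * ((1 / 2) ^ k) ^ DIM('a)) \<le> 16 ^ Suc k * (V * ((1 / 2 :: real) ^ k) ^ 5)"
      using assms V by (intro mult_left_mono power_decreasing) (auto simp: power_le_one)
    also have "((1 / 2 :: real) ^ k) ^ 5 = (1 / 32) ^ k"
      by (simp add: power_mult[symmetric] power_divide mult.commute[of _ 5] power_mult[of _ 5])
    also have "16 ^ Suc k * (V * (1 / 32) ^ k) = 16 * V * (16 * (1 / 32)) ^ k"
      by (simp only: power_mult_distrib power_Suc mult_ac)
    finally have "16 ^ Suc k * (V * ((1 / 2) ^ k) ^ DIM('a)) \<le> 16 * V * (1 / 2) ^ k" by simp
    then have "ennreal (16 ^ Suc k) * emeasure lborel (cball 0 ((1 / 2) ^ k) :: 'a set) \<le> ennreal (16 * V * (1 / 2) ^ k)"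
      using V by (simp add: emeasure_cball V_def flip: ennreal_mult)
    then show "(\<integral>\<^sup>+ x. ennreal (16 ^ Suc k) * indicator (cball 0 ((1 / 2) ^ k)) (x::'a) \<partial>lborel)
        \<le> ennreal (16 * V * (1 / 2) ^ k)"
      by (subst nn_integral_cmult_indicator) auto
  qed
  also have "\<dots> = ennreal (\<Sum>k. 16 * V * (1 / 2) ^ k)"
    using V by (intro suminf_ennreal2) (auto intro!: summable_mult summable_geometric)
  also have "\<dots> < \<infinity>" by simp
  finally have "integrable lborel (\<lambda>x::'a. indicator (ball 0 1) x *\<^sub>R rpow 0 (- 2) x)"
    using m by (intro integrableI_bounded)
  then show ?thesis unfolding set_integrable_def using m by (subst integrable_completion) auto
qed

section \<open>Weak derivatives as dominated limits\<close>

lemma test_function_Ck: "test_function \<Omega> \<psi> \<Longrightarrow> Ck_on k UNIV \<psi>"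
  by (simp add: test_function_def smooth_on_def)

text \<open>The derivatives vanish off the support as well, because its complement is open.\<close>

lemma test_function_support:
  assumes "test_function \<Omega> \<psi>"
  obtains K where "compact K" "K \<subseteq> \<Omega>" "\<forall>x. x \<notin> K \<longrightarrow> \<psi> x = 0" "\<forall>x v. x \<notin> K \<longrightarrow> dir_deriv \<psi> v x = 0"
proof (rule that[of "closure {x. \<psi> x \<noteq> 0}"])
  let ?K = "closure {x. \<psi> x \<noteq> 0}"
  show "compact ?K" "?K \<subseteq> \<Omega>" using assms unfolding test_function_def by blast+
  have z: "\<psi> y = 0" if "y \<notin> ?K" for y
  proof (rule ccontr)
    assume "\<psi> y \<noteq> 0"
    then have "y \<in> {x. \<psi> x \<noteq> 0}" by blast
    from subsetD[OF closure_subset this] show False using that by contradiction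
  qed
  then show "\<forall>x. x \<notin> ?K \<longrightarrow> \<psi> x = 0" by blast
  show "\<forall>x v. x \<notin> ?K \<longrightarrow> dir_deriv \<psi> v x = 0"
  proof (intro allI impI)
    fix x v assume that: "x \<notin> ?K"
    have "dir_deriv \<psi> v x = dir_deriv (\<lambda>y. 0) v x"
    proof (rule dir_deriv_cong_open)
      show "open (- ?K)" "x \<in> - ?K" using that by auto
      show "\<psi> y = 0" if "y \<in> - ?K" for y by (rule z) (use that in simp)
    qed
    then show "dir_deriv \<psi> v x = 0" by (simp add: dir_deriv_def)
  qed
qed

lemma test_function_bounded:
  assumes "test_function \<Omega> \<psi>"
  obtains M where "M > 0" "\<forall>x. \<bar>\<psi> x\<bar> \<le> M" "\<forall>x. \<bar>dir_deriv \<psi> v x\<bar> \<le> M"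
proof -
  obtain K where K: "compact K" "K \<subseteq> \<Omega>" and zero: "\<forall>x. x \<notin> K \<longrightarrow> \<psi> x = 0" "\<forall>x v. x \<notin> K \<longrightarrow> dir_deriv \<psi> v x = 0"
    by (rule test_function_support[OF assms])
  have "continuous_on K \<psi>"
    by (rule continuous_on_subset[OF Ck_on_continuous_on[OF test_function_Ck[OF assms, of 0]]]) simp
  from norm_le_on_compact[OF K(1) this] obtain M1 where M1: "M1 > 0" "\<And>x. x \<in> K \<Longrightarrow> norm (\<psi> x) \<le> M1" by blast
  have "continuous_on K (dir_deriv \<psi> v)"
    by (rule continuous_on_subset[OF Ck_on_continuous_on[OF Ck_on_dir_deriv[OF test_function_Ck[OF assms, of "Suc 0"]]]]) simp
  from norm_le_on_compact[OF K(1) this] obtain M2 where M2: "M2 > 0" "\<And>x. x \<in> K \<Longrightarrow> norm (dir_deriv \<psi> v x) \<le> M2" by blast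
  show ?thesis
  proof (rule that[of "M1 + M2"])
    show "M1 + M2 > 0" using M1(1) M2(1) by simp
    have "\<bar>\<psi> x\<bar> \<le> M1 + M2" for x
      using M1(1) M1(2)[of x] M2(1) zero(1) by (cases "x \<in> K") auto
    then show "\<forall>x. \<bar>\<psi> x\<bar> \<le> M1 + M2" by blast
    have "\<bar>dir_deriv \<psi> v x\<bar> \<le> M1 + M2" for x
      using M1(1) M2(1) M2(2)[of x] zero(2) by (cases "x \<in> K") auto
    then show "\<forall>x. \<bar>dir_deriv \<psi> v x\<bar> \<le> M1 + M2" by blast
  qed
qed

lemma weak_deriv_C1:
  fixes u :: "'a::euclidean_space \<Rightarrow> 'b::euclidean_space"
  assumes u: "Ck_on 1 UNIV u"
  shows "weak_deriv \<Omega> i u (dir_deriv u i)"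
  unfolding weak_deriv_def
proof (intro allI impI)
  fix \<psi> :: "'a \<Rightarrow> real" assume \<psi>: "test_function \<Omega> \<psi>"
  obtain K where K: "compact K" "K \<subseteq> \<Omega>"
    and zero: "\<forall>x. x \<notin> K \<longrightarrow> \<psi> x = 0" "\<forall>x v. x \<notin> K \<longrightarrow> dir_deriv \<psi> v x = 0"
    by (rule test_function_support[OF \<psi>])
  have \<psi>1: "Ck_on 1 UNIV \<psi>" using test_function_Ck[OF \<psi>] .
  have cont: "continuous_on K \<psi>" "continuous_on K (dir_deriv \<psi> i)" "continuous_on K u" "continuous_on K (dir_deriv u i)"
    using Ck_on_continuous_on[OF \<psi>1] Ck_on_continuous_on[OF u] \<psi>1 u
    by (auto intro: continuous_on_subset)
  have product_rule: "dir_deriv (\<lambda>x. \<psi> x *\<^sub>R u x) i x = \<psi> x *\<^sub>R dir_deriv u i x + dir_deriv \<psi> i x *\<^sub>R u x" for x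
    by (rule dir_deriv_bilinear[OF bounded_bilinear_scaleR Ck_on_differentiable[OF \<psi>1] Ck_on_differentiable[OF u]]) auto
  have "(LINT x:K|lebesgue. dir_deriv (\<lambda>x. \<psi> x *\<^sub>R u x) i x) = 0"
    by (rule integral_dir_deriv_eq_0[OF K(1) subset_UNIV open_UNIV Ck_on_scaleR[OF open_UNIV \<psi>1 u]])
      (use zero(1) in simp)
  then have "0 = (LINT x:K|lebesgue. dir_deriv (\<lambda>x. \<psi> x *\<^sub>R u x) i x)" by (rule sym)
  also have "\<dots> = (LINT x:K|lebesgue. \<psi> x *\<^sub>R dir_deriv u i x + dir_deriv \<psi> i x *\<^sub>R u x)"
    unfolding product_rule ..
  also have "\<dots> = (LINT x:K|lebesgue. \<psi> x *\<^sub>R dir_deriv u i x) + (LINT x:K|lebesgue. dir_deriv \<psi> i x *\<^sub>R u x)"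
    by (intro set_integral_add set_integrable_lebesgue_compact K continuous_intros cont)
  also have "(LINT x:K|lebesgue. \<psi> x *\<^sub>R dir_deriv u i x) = (LINT x:\<Omega>|lebesgue. \<psi> x *\<^sub>R dir_deriv u i x)"
    by (rule set_integral_extend_support[OF K(2)]) (use zero in simp)
  also have "(LINT x:K|lebesgue. dir_deriv \<psi> i x *\<^sub>R u x) = (LINT x:\<Omega>|lebesgue. dir_deriv \<psi> i x *\<^sub>R u x)"
    by (rule set_integral_extend_support[OF K(2)]) (use zero in simp)
  finally show "(LINT x:\<Omega>|lebesgue. dir_deriv \<psi> i x *\<^sub>R u x) = - (LINT x:\<Omega>|lebesgue. \<psi> x *\<^sub>R dir_deriv u i x)"
    using eq_neg_iff_add_eq_0 add.commute by metis
qed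

lemma set_integral_scaled_limit:
  fixes U :: "nat \<Rightarrow> 'a::euclidean_space \<Rightarrow> 'b::euclidean_space"
  assumes \<Omega>: "\<Omega> \<in> sets lebesgue" and g: "continuous_on UNIV g" "\<And>x. \<bar>g x\<bar> \<le> M" "M \<ge> 0"
    and U: "\<And>m. continuous_on UNIV (U m)" and u: "set_borel_measurable lebesgue \<Omega> u"
    and h: "set_integrable lebesgue \<Omega> h"
    and bound: "AE x in lebesgue. x \<in> \<Omega> \<longrightarrow> (\<forall>m. norm (U m x) \<le> h x)"
    and lim: "AE x in lebesgue. x \<in> \<Omega> \<longrightarrow> (\<lambda>m. U m x) \<longlonglongrightarrow> u x"
  shows "(\<lambda>m. LINT x:\<Omega>|lebesgue. g x *\<^sub>R U m x) \<longlonglongrightarrow> (LINT x:\<Omega>|lebesgue. g x *\<^sub>R u x)"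
  unfolding set_lebesgue_integral_def
proof (rule integral_dominated_convergence[where w="\<lambda>x. M * (indicator \<Omega> x *\<^sub>R h x)"])
  have gm: "g \<in> borel_measurable lebesgue" and Um: "U m \<in> borel_measurable lebesgue" for m
    using g(1) U by (auto intro!: measurable_completion borel_measurable_continuous_onI)
  have "(\<lambda>x. g x *\<^sub>R (indicator \<Omega> x *\<^sub>R u x)) \<in> borel_measurable lebesgue"
    using gm u unfolding set_borel_measurable_def by (rule borel_measurable_scaleR)
  then show "(\<lambda>x. indicator \<Omega> x *\<^sub>R g x *\<^sub>R u x) \<in> borel_measurable lebesgue"
    by (simp add: mult.commute)
  show "(\<lambda>x. indicator \<Omega> x *\<^sub>R g x *\<^sub>R U m x) \<in> borel_measurable lebesgue" for m
    by (intro borel_measurable_scaleR gm Um borel_measurable_indicator \<Omega>)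
  show "integrable lebesgue (\<lambda>x. M * (indicator \<Omega> x *\<^sub>R h x))"
    using h unfolding set_integrable_def by (rule integrable_mult_right)
  show "AE x in lebesgue. (\<lambda>m. indicator \<Omega> x *\<^sub>R g x *\<^sub>R U m x) \<longlonglongrightarrow> indicator \<Omega> x *\<^sub>R g x *\<^sub>R u x"
    using lim by eventually_elim (auto simp: indicator_def intro!: tendsto_intros)
  show "AE x in lebesgue. norm (indicator \<Omega> x *\<^sub>R g x *\<^sub>R U m x) \<le> M * (indicator \<Omega> x *\<^sub>R h x)" for m
    using bound by eventually_elim (use g in \<open>auto simp: indicator_def intro!: mult_mono\<close>)
qed

text \<open>Test functions and their derivatives are bounded, so that both sides of the integration by parts
  formula pass to the limit by dominated convergence. This yields weak derivatives across a singularity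
  without cutting it out.\<close>

lemma weak_deriv_limit:
  fixes U :: "nat \<Rightarrow> 'a::euclidean_space \<Rightarrow> 'b::euclidean_space"
  assumes \<Omega>: "\<Omega> \<in> sets lebesgue" and U: "\<And>m. Ck_on 1 UNIV (U m)"
    and meas: "set_borel_measurable lebesgue \<Omega> u" "set_borel_measurable lebesgue \<Omega> v"
    and h: "set_integrable lebesgue \<Omega> h"
    and bound: "AE x in lebesgue. x \<in> \<Omega> \<longrightarrow> (\<forall>m. norm (U m x) \<le> h x)"
      "AE x in lebesgue. x \<in> \<Omega> \<longrightarrow> (\<forall>m. norm (dir_deriv (U m) i x) \<le> h x)"
    and lim: "AE x in lebesgue. x \<in> \<Omega> \<longrightarrow> (\<lambda>m. U m x) \<longlonglongrightarrow> u x"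
      "AE x in lebesgue. x \<in> \<Omega> \<longrightarrow> (\<lambda>m. dir_deriv (U m) i x) \<longlonglongrightarrow> v x"
  shows "weak_deriv \<Omega> i u v"
  unfolding weak_deriv_def
proof (intro allI impI)
  fix \<psi> :: "'a \<Rightarrow> real" assume \<psi>: "test_function \<Omega> \<psi>"
  obtain M where M: "M > 0" "\<forall>x. \<bar>\<psi> x\<bar> \<le> M" "\<forall>x. \<bar>dir_deriv \<psi> i x\<bar> \<le> M"
    by (rule test_function_bounded[OF \<psi>, where v=i])
  have M0: "M \<ge> 0" using M(1) by simp
  have c: "continuous_on UNIV \<psi>" "continuous_on UNIV (dir_deriv \<psi> i)"
      "continuous_on UNIV (U m)" "continuous_on UNIV (dir_deriv (U m) i)" for m
    using test_function_Ck[OF \<psi>, of 1] Ck_on_continuous_on[OF test_function_Ck[OF \<psi>, of 0]]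
      U[of m] Ck_on_continuous_on[OF U[of m]] by auto
  have "(\<lambda>m. LINT x:\<Omega>|lebesgue. dir_deriv \<psi> i x *\<^sub>R U m x) \<longlonglongrightarrow> (LINT x:\<Omega>|lebesgue. dir_deriv \<psi> i x *\<^sub>R u x)"
    by (rule set_integral_scaled_limit[OF \<Omega> c(2) M(3)[rule_format] M0 c(3) meas(1) h bound(1) lim(1)])
  moreover have "(\<lambda>m. - (LINT x:\<Omega>|lebesgue. \<psi> x *\<^sub>R dir_deriv (U m) i x)) \<longlonglongrightarrow> - (LINT x:\<Omega>|lebesgue. \<psi> x *\<^sub>R v x)"
    by (intro tendsto_minus set_integral_scaled_limit[OF \<Omega> c(1) M(2)[rule_format] M0 c(4) meas(2) h bound(2) lim(2)])
  moreover have "(LINT x:\<Omega>|lebesgue. dir_deriv \<psi> i x *\<^sub>R U m x) = - (LINT x:\<Omega>|lebesgue. \<psi> x *\<^sub>R dir_deriv (U m) i x)" for m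
    using weak_deriv_C1[OF U] \<psi> unfolding weak_deriv_def by blast
  ultimately show "(LINT x:\<Omega>|lebesgue. dir_deriv \<psi> i x *\<^sub>R u x) = - (LINT x:\<Omega>|lebesgue. \<psi> x *\<^sub>R v x)"
    using LIMSEQ_unique by simp
qed

section \<open>Membership in the Sobolev space\<close>

text \<open>The map \<open>phi b a\<close> with \<open>x / |x|\<close> replaced by \<open>x / sqrt (\<delta> + |x|\<^sup>2)\<close>. The following two definitions
  are its first and second derivatives. They make sense at \<open>\<delta> = 0\<close> as well, where they are the
  candidates for the weak derivatives.\<close>

definition regularised_phi :: "real \<Rightarrow> real \<Rightarrow> real \<Rightarrow> 'a::euclidean_space \<Rightarrow> 'a \<times> real" where
  "regularised_phi b a \<delta> x = (sin a *\<^sub>R (rpow \<delta> (- 1 / 2) x *\<^sub>R x), b * cos a)"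

definition regularised_phi_D1 :: "real \<Rightarrow> 'a::euclidean_space \<Rightarrow> real \<Rightarrow> 'a \<Rightarrow> 'a \<times> real" where
  "regularised_phi_D1 a i \<delta> x = (sin a *\<^sub>R (rpow \<delta> (- 1 / 2) x *\<^sub>R i - (rpow \<delta> (- 3 / 2) x * (x \<bullet> i)) *\<^sub>R x), 0)"

definition regularised_phi_D2 :: "real \<Rightarrow> 'a::euclidean_space \<Rightarrow> 'a \<Rightarrow> real \<Rightarrow> 'a \<Rightarrow> 'a \<times> real" where
  "regularised_phi_D2 a i j \<delta> x = (sin a *\<^sub>R ((3 * rpow \<delta> (- 5 / 2) x * (x \<bullet> i) * (x \<bullet> j)) *\<^sub>R x
    - (rpow \<delta> (- 3 / 2) x * (x \<bullet> j)) *\<^sub>R i - (rpow \<delta> (- 3 / 2) x * (x \<bullet> i)) *\<^sub>R j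
    - (rpow \<delta> (- 3 / 2) x * (i \<bullet> j)) *\<^sub>R x), 0)"

lemma regularised_domain: "\<delta> > 0 \<Longrightarrow> \<delta> + x \<bullet> x > 0"
  by (simp add: add_pos_nonneg)

lemma dir_deriv_regularised_phi:
  assumes "\<delta> > 0"
  shows "dir_deriv (regularised_phi b a \<delta>) i x = regularised_phi_D1 a i \<delta> x"
  unfolding regularised_phi_def[abs_def] regularised_phi_D1_def
  by (rule dir_deriv_eqI)
    (auto intro!: derivative_eq_intros has_derivative_rpow regularised_domain[OF assms] simp: fun_eq_iff algebra_simps)

lemma dir_deriv_regularised_phi_D1:
  assumes "\<delta> > 0"
  shows "dir_deriv (regularised_phi_D1 a i \<delta>) j x = regularised_phi_D2 a i j \<delta> x"
  unfolding regularised_phi_D1_def[abs_def] regularised_phi_D2_def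
  by (rule dir_deriv_eqI)
    (auto intro!: derivative_eq_intros has_derivative_rpow regularised_domain[OF assms]
      simp: fun_eq_iff algebra_simps inner_commute)

lemma Ck_on_rpow_UNIV:
  assumes "\<delta> > 0"
  shows "Ck_on k (UNIV :: 'a::euclidean_space set) (rpow \<delta> s)"
proof -
  have "{x :: 'a. \<delta> + x \<bullet> x > 0} = UNIV" using regularised_domain[OF assms] by blast
  then show ?thesis using Ck_on_rpow[where 'a='a] by metis
qed

lemma Ck_on_regularised_phi: "\<delta> > 0 \<Longrightarrow> Ck_on k UNIV (regularised_phi b a \<delta>)"
  unfolding regularised_phi_def[abs_def]
  by (intro Ck_on_Pair Ck_on_scaleR Ck_on_const Ck_on_rpow_UNIV open_UNIV Ck_on_bounded_linear[OF bounded_linear_ident])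

lemma Ck_on_regularised_phi_D1: "\<delta> > 0 \<Longrightarrow> Ck_on k UNIV (regularised_phi_D1 a i \<delta>)"
  unfolding regularised_phi_D1_def[abs_def]
  by (intro Ck_on_Pair Ck_on_scaleR Ck_on_diff Ck_on_mult Ck_on_inner Ck_on_const Ck_on_rpow_UNIV open_UNIV
      Ck_on_bounded_linear[OF bounded_linear_ident])

lemma rpow_tendsto:
  assumes "x \<noteq> 0" "\<delta> \<longlonglongrightarrow> 0"
  shows "(\<lambda>m. rpow (\<delta> m) s x) \<longlonglongrightarrow> rpow 0 s x"
  unfolding rpow_def using assms by (intro tendsto_intros) auto

lemma norm_le_rpow: "\<delta> \<ge> 0 \<Longrightarrow> norm x \<le> rpow \<delta> (1 / 2) x"
  unfolding rpow_def powr_half_sqrt[OF add_nonneg_nonneg[OF _ inner_ge_zero]] norm_eq_sqrt_inner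
  by simp

text \<open>Each factor \<open>|x|\<close> is worth half a power of \<open>\<delta> + |x|\<^sup>2\<close>, uniformly in \<open>\<delta>\<close>.\<close>

lemma rpow_norm_le: "\<delta> \<ge> 0 \<Longrightarrow> rpow \<delta> s x * norm x \<le> rpow \<delta> (s + 1 / 2) x"
  using mult_left_mono[OF norm_le_rpow, of \<delta> "rpow \<delta> s x" x] rpow_add[of \<delta> s x "1 / 2"]
  by (simp add: rpow_def)

lemma rpow_nonneg [simp]: "rpow \<delta> s x \<ge> 0"
  by (simp add: rpow_def)

lemma abs_rpow [simp]: "\<bar>rpow \<delta> s x\<bar> = rpow \<delta> s x"
  by (rule abs_of_nonneg[OF rpow_nonneg])

lemma norm_regularised_phi_le: "\<delta> \<ge> 0 \<Longrightarrow> norm (regularised_phi b a \<delta> x) \<le> 1 + \<bar>b\<bar>"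
proof -
  assume \<delta>: "\<delta> \<ge> 0"
  have "norm (regularised_phi b a \<delta> x) \<le> norm (sin a *\<^sub>R (rpow \<delta> (- 1 / 2) x *\<^sub>R x)) + norm (b * cos a)"
    unfolding regularised_phi_def by (rule norm_Pair_le)
  also have "norm (b * cos a) \<le> \<bar>b\<bar>" by (simp add: abs_mult mult_left_le)
  also have "norm (sin a *\<^sub>R (rpow \<delta> (- 1 / 2) x *\<^sub>R x)) \<le> rpow \<delta> (- 1 / 2) x * norm x"
    by (simp add: abs_mult mult_left_le_one_le mult.assoc)
  also have "\<dots> \<le> rpow \<delta> 0 x" using rpow_norm_le[OF \<delta>, of "- 1 / 2" x] by simp
  also have "\<dots> \<le> 1" by (simp add: rpow_def)
  finally show ?thesis by simp
qed

lemma norm_regularised_phi_D1_le: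
  assumes "\<delta> \<ge> 0" "norm i = 1"
  shows "norm (regularised_phi_D1 a i \<delta> x) \<le> 2 * rpow \<delta> (- 1 / 2) x"
proof -
  have "norm (regularised_phi_D1 a i \<delta> x) \<le> norm (rpow \<delta> (- 1 / 2) x *\<^sub>R i - (rpow \<delta> (- 3 / 2) x * (x \<bullet> i)) *\<^sub>R x)"
    by (simp add: regularised_phi_D1_def norm_Pair mult_left_le_one_le)
  also have "\<dots> \<le> norm (rpow \<delta> (- 1 / 2) x *\<^sub>R i) + norm ((rpow \<delta> (- 3 / 2) x * (x \<bullet> i)) *\<^sub>R x)"
    by (rule norm_triangle_ineq4)
  also have "norm ((rpow \<delta> (- 3 / 2) x * (x \<bullet> i)) *\<^sub>R x) \<le> rpow \<delta> (- 3 / 2) x * norm x * norm x"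
    using Cauchy_Schwarz_ineq2[of x i] assms(2) rpow_nonneg[of \<delta> "- 3 / 2" x]
    by (simp add: abs_mult mult_mono mult_left_mono)
  also have "\<dots> \<le> rpow \<delta> (- 1) x * norm x"
    using rpow_norm_le[OF assms(1), of "- 3 / 2" x] by (simp add: mult_right_mono)
  also have "\<dots> \<le> rpow \<delta> (- 1 / 2) x"
    using rpow_norm_le[OF assms(1), of "- 1" x] by simp
  finally show ?thesis using assms(2) rpow_nonneg[of \<delta> "- 1 / 2" x] by simp
qed

lemma norm_regularised_phi_D2_le:
  assumes \<delta>: "\<delta> \<ge> 0" and ij: "norm i = 1" "norm j = 1"
  shows "norm (regularised_phi_D2 a i j \<delta> x) \<le> 6 * rpow \<delta> (- 1) x"
proof -
  let ?P = "rpow \<delta> (- 5 / 2) x" and ?Q = "rpow \<delta> (- 3 / 2) x"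
  have P: "?P * norm x * norm x * norm x \<le> rpow \<delta> (- 1) x"
  proof -
    have "?P * norm x * norm x * norm x \<le> rpow \<delta> (- 2) x * norm x * norm x"
      using rpow_norm_le[OF \<delta>, of "- 5 / 2" x] by (simp add: mult_right_mono)
    also have "\<dots> \<le> ?Q * norm x"
      using rpow_norm_le[OF \<delta>, of "- 2" x] by (simp add: mult_right_mono)
    also have "\<dots> \<le> rpow \<delta> (- 1) x" using rpow_norm_le[OF \<delta>, of "- 3 / 2" x] by simp
    finally show ?thesis .
  qed
  have Q: "?Q * norm x \<le> rpow \<delta> (- 1) x" using rpow_norm_le[OF \<delta>, of "- 3 / 2" x] by simp
  have xi: "\<bar>x \<bullet> i\<bar> \<le> norm x" and xj: "\<bar>x \<bullet> j\<bar> \<le> norm x" and iij: "\<bar>i \<bullet> j\<bar> \<le> 1"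
    using Cauchy_Schwarz_ineq2[of x i] Cauchy_Schwarz_ineq2[of x j] Cauchy_Schwarz_ineq2[of i j] ij by auto
  have "norm (regularised_phi_D2 a i j \<delta> x) \<le> norm ((3 * ?P * (x \<bullet> i) * (x \<bullet> j)) *\<^sub>R x
      - (?Q * (x \<bullet> j)) *\<^sub>R i - (?Q * (x \<bullet> i)) *\<^sub>R j - (?Q * (i \<bullet> j)) *\<^sub>R x)"
    by (simp add: regularised_phi_D2_def norm_Pair mult_left_le_one_le)
  also have "\<dots> \<le> norm ((3 * ?P * (x \<bullet> i) * (x \<bullet> j)) *\<^sub>R x) + norm ((?Q * (x \<bullet> j)) *\<^sub>R i)
      + norm ((?Q * (x \<bullet> i)) *\<^sub>R j) + norm ((?Q * (i \<bullet> j)) *\<^sub>R x)"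
    by (intro order_trans[OF norm_triangle_ineq4] add_right_mono order.refl)
  also have "\<dots> = 3 * (?P * \<bar>x \<bullet> i\<bar> * \<bar>x \<bullet> j\<bar> * norm x) + ?Q * \<bar>x \<bullet> j\<bar> + ?Q * \<bar>x \<bullet> i\<bar> + ?Q * \<bar>i \<bullet> j\<bar> * norm x"
    using ij by (simp add: abs_mult)
  also have "\<dots> \<le> 3 * (?P * norm x * norm x * norm x) + ?Q * norm x + ?Q * norm x + ?Q * 1 * norm x"
    using xi xj iij rpow_nonneg[of \<delta>]
    by (intro add_mono mult_left_mono mult_mono order.refl mult_nonneg_nonneg) auto
  also have "\<dots> \<le> 6 * rpow \<delta> (- 1) x" using P Q unfolding mult_1_right by linarith
  finally show ?thesis .
qed

text \<open>One dominating function for all the bounds above: inside the unit ball the power \<open>-2\<close> is the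
  largest that occurs, and \<open>\<delta>\<close> only decreases it.\<close>

lemma rpow_le_rpow_minus_2:
  assumes "\<delta> \<ge> 0" "x \<in> ball 0 1 - {0}" "- 2 \<le> s" "s \<le> 0"
  shows "rpow \<delta> s x \<le> rpow 0 (- 2) x"
proof -
  have "x \<bullet> x \<le> 1" using assms(2) by (simp add: dot_square_norm power_le_one)
  have "rpow \<delta> s x \<le> rpow 0 s x"
    unfolding rpow_def using assms by (intro powr_mono2') auto
  also have "\<dots> \<le> rpow 0 (- 2) x"
    unfolding rpow_def using assms \<open>x \<bullet> x \<le> 1\<close> by (intro powr_mono') auto
  finally show ?thesis .
qed

lemma phi_eq_regularised_phi: "phi b a x = regularised_phi b a 0 x"
  by (simp add: phi_def regularised_phi_def rpow_norm powr_minus)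

lemma set_borel_measurable_ballI:
  fixes u :: "'a::euclidean_space \<Rightarrow> 'b::euclidean_space"
  assumes "u \<in> borel_measurable borel"
  shows "set_borel_measurable lebesgue (ball 0 1) u"
proof -
  have "(\<lambda>x. indicator (ball 0 1) x *\<^sub>R u x) \<in> borel_measurable borel"
    by (intro borel_measurable_scaleR borel_measurable_indicator assms) simp
  then show ?thesis
    unfolding set_borel_measurable_def by (intro measurable_completion) simp
qed

lemma set_borel_measurable_regularised_phi:
  "set_borel_measurable lebesgue (ball 0 1) (regularised_phi b a 0)"
  "set_borel_measurable lebesgue (ball 0 1) (regularised_phi_D1 a i 0)"
  "set_borel_measurable lebesgue (ball 0 1) (regularised_phi_D2 a i j 0)"
  unfolding regularised_phi_def[abs_def] regularised_phi_D1_def[abs_def] regularised_phi_D2_def[abs_def]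
  by (intro set_borel_measurable_ballI borel_measurable_Pair; measurable)+

lemma L2_on_of_bound:
  fixes u :: "'a::euclidean_space \<Rightarrow> 'b::euclidean_space"
  assumes "DIM('a) \<ge> 5" "set_borel_measurable lebesgue (ball 0 1) u"
    and "\<And>x. x \<in> ball 0 1 - {0} \<Longrightarrow> (norm (u x))\<^sup>2 \<le> C * rpow 0 (- 2) x"
  shows "L2_on (ball 0 1) u"
  unfolding L2_on_def
proof
  have "(\<lambda>x. (norm (indicator (ball 0 1) x *\<^sub>R u x))\<^sup>2) \<in> borel_measurable lebesgue"
    using assms(2) unfolding set_borel_measurable_def by measurable
  moreover have "(norm (indicator (ball 0 1) x *\<^sub>R u x))\<^sup>2 = indicator (ball 0 1) x *\<^sub>R (norm (u x))\<^sup>2" for x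
    by (simp add: indicator_def)
  ultimately have m: "(\<lambda>x. indicator (ball 0 1) x *\<^sub>R (norm (u x))\<^sup>2) \<in> borel_measurable lebesgue" by simp
  have "AE x in lebesgue. x \<noteq> (0::'a)" by (rule AE_not_in[of "{0}", simplified]) simp
  then have "AE x in lebesgue. norm (indicator (ball 0 1) x *\<^sub>R (norm (u x))\<^sup>2)
      \<le> norm (C * (indicator (ball 0 1) x *\<^sub>R rpow 0 (- 2) x))"
    by eventually_elim (use assms(3) in \<open>auto simp: indicator_def intro: order_trans[OF _ abs_ge_self]\<close>)
  then show "set_integrable lebesgue (ball 0 1) (\<lambda>x. (norm (u x))\<^sup>2)"
    unfolding set_integrable_def
    by (rule Bochner_Integration.integrable_bound[rotated 2])
      (use m integrable_rpow_minus_2[OF assms(1)] in \<open>auto simp: set_integrable_def\<close>)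
qed (rule assms(2))

text \<open>The regularised maps and their first and second derivatives are dominated by a multiple of
  \<open>|x|\<^sup>-\<^sup>4\<close>; so are the squares of the limits, since the second derivatives are of order \<open>|x|\<^sup>-\<^sup>2\<close>.\<close>

lemma sobolev_phi:
  assumes "CARD('n) \<ge> 5"
  shows "sobolev 2 (ball 0 1) (phi b a :: real ^ 'n \<Rightarrow> _)"
proof -
  have dim: "DIM(real ^ 'n) \<ge> 5" using assms by simp
  have phi: "phi b a = (regularised_phi b a 0 :: real ^ 'n \<Rightarrow> _)" using phi_eq_regularised_phi by blast
  define \<delta> where "\<delta> m = inverse (real (Suc m))" for m
  have \<delta>: "\<delta> m > 0" "\<delta> m \<ge> 0" "\<delta> \<longlonglongrightarrow> 0" for m
    unfolding \<delta>_def[abs_def] using LIMSEQ_inverse_real_of_nat by auto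
  \<comment> \<open>The constant exceeds \<open>1 + |b|\<close>, \<open>2\<close> and \<open>6\<close>, the bounds for the derivatives of order \<open>0\<close>, \<open>1\<close> and \<open>2\<close>.\<close>
  define h where "h x = (7 + \<bar>b\<bar>) * rpow 0 (- 2) x" for x :: "real ^ 'n"
  have h: "set_integrable lebesgue (ball 0 1) h"
    using integrable_rpow_minus_2[OF dim] unfolding h_def by (rule set_integrable_mult_right)
  have small: "rpow \<epsilon> s x \<le> rpow 0 (- 2) x"
    if "\<epsilon> \<ge> 0" "x \<in> ball 0 1 - {0}" "s \<in> {- 2..0}" for \<epsilon> s and x :: "real ^ 'n"
    using rpow_le_rpow_minus_2[of \<epsilon> x s] that by simp
  have one: "1 \<le> rpow 0 (- 2) x" if "x \<in> ball 0 1 - {0}" for x :: "real ^ 'n"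
    using small[of 0 x 0] that by (simp add: rpow_def)
  have reg_bound: "norm (regularised_phi b a \<epsilon> x) \<le> h x" if "\<epsilon> \<ge> 0" "x \<in> ball 0 1 - {0}" for \<epsilon> and x :: "real ^ 'n"
  proof -
    have "norm (regularised_phi b a \<epsilon> x) \<le> (7 + \<bar>b\<bar>) * 1" using norm_regularised_phi_le[OF that(1), of b a x] by simp
    also have "\<dots> \<le> h x" unfolding h_def using one[OF that(2)] by (intro mult_left_mono) auto
    finally show ?thesis .
  qed
  have D1_bound: "norm (regularised_phi_D1 a i \<epsilon> x) \<le> h x" if "\<epsilon> \<ge> 0" "x \<in> ball 0 1 - {0}" "norm i = 1" for \<epsilon> i and x :: "real ^ 'n"
  proof -
    have "norm (regularised_phi_D1 a i \<epsilon> x) \<le> 2 * rpow 0 (- 2) x"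
      using norm_regularised_phi_D1_le[OF that(1,3), of a x] small[OF that(1,2), of "- 1 / 2"] by simp
    also have "\<dots> \<le> h x" unfolding h_def using rpow_nonneg by (intro mult_right_mono) auto
    finally show ?thesis .
  qed
  have D2_bound: "norm (regularised_phi_D2 a i j \<epsilon> x) \<le> h x" if "\<epsilon> \<ge> 0" "x \<in> ball 0 1 - {0}" "norm i = 1" "norm j = 1" for \<epsilon> i j and x :: "real ^ 'n"
  proof -
    have "norm (regularised_phi_D2 a i j \<epsilon> x) \<le> 6 * rpow 0 (- 2) x"
      using norm_regularised_phi_D2_le[OF that(1,3,4), of a x] small[OF that(1,2), of "- 1"] by simp
    also have "\<dots> \<le> h x" unfolding h_def using rpow_nonneg by (intro mult_right_mono) auto
    finally show ?thesis .
  qed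
  have sq: "t\<^sup>2 \<le> k\<^sup>2 * rpow 0 (- 2) x"
    if "0 \<le> t" "t \<le> k * rpow 0 s x" "x \<in> ball 0 1 - {0}" "s \<in> {- 1..0}" for t k s and x :: "real ^ 'n"
  proof -
    have "t\<^sup>2 \<le> (k * rpow 0 s x)\<^sup>2" using that by (intro power_mono) auto
    also have "\<dots> = k\<^sup>2 * rpow 0 (2 * s) x"
      using rpow_add[of 0 s x s] by (simp add: power2_eq_square mult_ac)
    also have "\<dots> \<le> k\<^sup>2 * rpow 0 (- 2) x"
      using small[of 0 x "2 * s"] that by (intro mult_left_mono) auto
    finally show ?thesis .
  qed
  have L0: "L2_on (ball 0 1) (regularised_phi b a 0 :: real ^ 'n \<Rightarrow> _)"
    by (rule L2_on_of_bound[OF dim set_borel_measurable_regularised_phi(1)])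
      (rule sq[where s=0 and k="1 + \<bar>b\<bar>"], use norm_regularised_phi_le[of 0 b a] in \<open>auto simp: rpow_def\<close>)
  have L1: "L2_on (ball 0 1) (regularised_phi_D1 a i 0)" if "norm i = 1" for i :: "real ^ 'n"
    by (rule L2_on_of_bound[OF dim set_borel_measurable_regularised_phi(2)])
      (rule sq[where s="- 1 / 2" and k=2], use norm_regularised_phi_D1_le[OF _ that, of 0 a] in auto)
  have L2: "L2_on (ball 0 1) (regularised_phi_D2 a i j 0)" if "norm i = 1" "norm j = 1" for i j :: "real ^ 'n"
    by (rule L2_on_of_bound[OF dim set_borel_measurable_regularised_phi(3)])
      (rule sq[where s="- 1" and k=6], use norm_regularised_phi_D2_le[OF _ that, of 0 a] in auto)
  have AE: "AE x in lebesgue. x \<in> ball 0 1 \<longrightarrow> P x" if "\<And>x. x \<in> ball 0 1 - {0} \<Longrightarrow> P x"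
    for P :: "real ^ 'n \<Rightarrow> bool"
  proof -
    have "AE x in lebesgue. x \<noteq> (0 :: real ^ 'n)" by (rule AE_not_in[of "{0}", simplified]) simp
    then show ?thesis by eventually_elim (use that in auto)
  qed
  have W1: "weak_deriv (ball 0 1) i (regularised_phi b a 0) (regularised_phi_D1 a i 0)" if i: "norm i = 1" for i :: "real ^ 'n"
  proof (rule weak_deriv_limit[where U="\<lambda>m. regularised_phi b a (\<delta> m)" and h=h])
    show "AE x in (lebesgue :: (real ^ 'n) measure). x \<in> ball 0 1 \<longrightarrow> (\<lambda>m. regularised_phi b a (\<delta> m) x) \<longlonglongrightarrow> regularised_phi b a 0 x"
      unfolding regularised_phi_def by (intro AE tendsto_intros rpow_tendsto \<delta>) auto
    show "AE x in (lebesgue :: (real ^ 'n) measure). x \<in> ball 0 1 \<longrightarrow> (\<lambda>m. dir_deriv (regularised_phi b a (\<delta> m)) i x) \<longlonglongrightarrow> regularised_phi_D1 a i 0 x"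
      unfolding dir_deriv_regularised_phi[OF \<delta>(1)] unfolding regularised_phi_D1_def by (intro AE tendsto_intros rpow_tendsto \<delta>) auto
    show "AE x in (lebesgue :: (real ^ 'n) measure). x \<in> ball 0 1 \<longrightarrow> (\<forall>m. norm (regularised_phi b a (\<delta> m) x) \<le> h x)"
      by (intro AE allI reg_bound \<delta>)
    show "AE x in (lebesgue :: (real ^ 'n) measure). x \<in> ball 0 1 \<longrightarrow> (\<forall>m. norm (dir_deriv (regularised_phi b a (\<delta> m)) i x) \<le> h x)"
      unfolding dir_deriv_regularised_phi[OF \<delta>(1)] by (intro AE allI D1_bound \<delta> i)
  qed (intro Ck_on_regularised_phi \<delta> h set_borel_measurable_regularised_phi lmeasurable_ball[THEN fmeasurableD])+
  have W2: "weak_deriv (ball 0 1) j (regularised_phi_D1 a i 0) (regularised_phi_D2 a i j 0)" if ij: "norm i = 1" "norm j = 1" for i j :: "real ^ 'n"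
  proof (rule weak_deriv_limit[where U="\<lambda>m. regularised_phi_D1 a i (\<delta> m)" and h=h])
    show "AE x in (lebesgue :: (real ^ 'n) measure). x \<in> ball 0 1 \<longrightarrow> (\<lambda>m. regularised_phi_D1 a i (\<delta> m) x) \<longlonglongrightarrow> regularised_phi_D1 a i 0 x"
      unfolding regularised_phi_D1_def by (intro AE tendsto_intros rpow_tendsto \<delta>) auto
    show "AE x in (lebesgue :: (real ^ 'n) measure). x \<in> ball 0 1 \<longrightarrow> (\<lambda>m. dir_deriv (regularised_phi_D1 a i (\<delta> m)) j x) \<longlonglongrightarrow> regularised_phi_D2 a i j 0 x"
      unfolding dir_deriv_regularised_phi_D1[OF \<delta>(1)] unfolding regularised_phi_D2_def by (intro AE tendsto_intros rpow_tendsto \<delta>) auto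
    show "AE x in (lebesgue :: (real ^ 'n) measure). x \<in> ball 0 1 \<longrightarrow> (\<forall>m. norm (regularised_phi_D1 a i (\<delta> m) x) \<le> h x)"
      by (intro AE allI D1_bound \<delta> ij)
    show "AE x in (lebesgue :: (real ^ 'n) measure). x \<in> ball 0 1 \<longrightarrow> (\<forall>m. norm (dir_deriv (regularised_phi_D1 a i (\<delta> m)) j x) \<le> h x)"
      unfolding dir_deriv_regularised_phi_D1[OF \<delta>(1)] by (intro AE allI D2_bound \<delta> ij)
  qed (intro Ck_on_regularised_phi_D1 \<delta> h set_borel_measurable_regularised_phi lmeasurable_ball[THEN fmeasurableD])+
  have "\<exists>v. weak_deriv (ball 0 1) i (regularised_phi b a 0) v \<and> sobolev 1 (ball 0 1) v" if "i \<in> Basis" for i :: "real ^ 'n"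
  proof (intro exI conjI)
    have i: "norm i = 1" using that by simp
    show "weak_deriv (ball 0 1) i (regularised_phi b a 0) (regularised_phi_D1 a i 0)" by (rule W1[OF i])
    have "\<exists>v. weak_deriv (ball 0 1) j (regularised_phi_D1 a i 0) v \<and> L2_on (ball 0 1) v" if "j \<in> Basis" for j
      using W2[OF i norm_Basis[OF that]] L2[OF i norm_Basis[OF that]] by blast
    then show "sobolev 1 (ball 0 1) (regularised_phi_D1 a i 0)" using L1[OF i] by simp
  qed
  then show ?thesis using L0 unfolding phi numeral_2_eq_2 by simp
qed

section \<open>The critical angle\<close>

text \<open>The arguments stand for \<open>\<beta> = b\<^sup>2\<close> and \<open>s = sin\<^sup>2 a\<close>.\<close>

definition critical_poly :: "real \<Rightarrow> real \<Rightarrow> real \<Rightarrow> real" where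
  "critical_poly n \<beta> s = 3 * (n - 3) * (1 - s) * (1 - s + \<beta> * s) + 2 * (n - 4) * \<beta> * s * (1 - s + \<beta> * s) - (n - 1) * \<beta> * s"

text \<open>Below the threshold the polynomial changes sign between \<open>0\<close> and \<open>1\<close>. From the threshold on, it is a
  sum of nonnegative terms, one of which is positive.\<close>

lemma critical_poly_root_iff:
  assumes "n \<ge> 5" "\<beta> > 0"
  shows "(\<exists>s\<in>{0<..<1}. critical_poly n \<beta> s = 0) \<longleftrightarrow> \<beta> < (n - 1) / (2 * (n - 4))"
proof
  assume "\<beta> < (n - 1) / (2 * (n - 4))"
  then have "2 * (n - 4) * \<beta> < n - 1" using assms(1) by (simp add: field_simps)
  then have "critical_poly n \<beta> 1 < 0"
    using mult_strict_right_mono[of "2 * (n - 4) * \<beta>" "n - 1" \<beta>] assms(2)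
    by (simp add: critical_poly_def algebra_simps)
  moreover have "critical_poly n \<beta> 0 > 0" using assms(1) by (simp add: critical_poly_def)
  moreover have "continuous_on {0..1} (critical_poly n \<beta>)"
    unfolding critical_poly_def[abs_def] by (intro continuous_intros)
  ultimately obtain s where "0 \<le> s" "s \<le> 1" "critical_poly n \<beta> s = 0"
    using IVT2'[of "critical_poly n \<beta>" 1 0 0] by force
  moreover from this have "s \<noteq> 0" "s \<noteq> 1"
    using \<open>critical_poly n \<beta> 1 < 0\<close> \<open>critical_poly n \<beta> 0 > 0\<close> by auto
  ultimately show "\<exists>s\<in>{0<..<1}. critical_poly n \<beta> s = 0" by (intro bexI[of _ s]) auto
next
  assume "\<exists>s\<in>{0<..<1}. critical_poly n \<beta> s = 0"
  then obtain s where s: "0 < s" "s < 1" "critical_poly n \<beta> s = 0" by auto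
  show "\<beta> < (n - 1) / (2 * (n - 4))"
  proof (rule ccontr)
    assume "\<not> ?thesis"
    then have le: "n - 1 \<le> 2 * (n - 4) * \<beta>" using assms(1) by (simp add: field_simps)
    \<comment> \<open>Split \<open>(n - 1) \<beta> s\<close> according to \<open>s = s\<^sup>2 + s (1 - s)\<close>.\<close>
    have "critical_poly n \<beta> s = 3 * (n - 3) * (1 - s)\<^sup>2 + 4 * (n - 4) * (\<beta> * s * (1 - s)) + (2 * (n - 4) * \<beta> - (n - 1)) * (\<beta> * s\<^sup>2)"
      by (simp add: critical_poly_def power2_eq_square algebra_simps)
    moreover have "3 * (n - 3) * (1 - s)\<^sup>2 > 0" using assms s by simp
    moreover have "4 * (n - 4) * (\<beta> * s * (1 - s)) \<ge> 0" using assms s by simp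
    moreover have "(2 * (n - 4) * \<beta> - (n - 1)) * (\<beta> * s\<^sup>2) \<ge> 0" using le assms by simp
    ultimately show False using s(3) by linarith
  qed
qed

text \<open>The product of the bienergy gradient with the polar direction \<open>(cos a u, - b sin a)\<close>, up to the
  factor that \<open>bienergy_gradient_phi_polar\<close> makes explicit. Its vanishing is the equation for the angle \<open>a\<close>.\<close>

definition polar_gradient_coeff :: "real \<Rightarrow> real \<Rightarrow> real \<Rightarrow> real" where
  "polar_gradient_coeff n b a = (3 * (n - 3) - (n - 1) * (sin a)\<^sup>2 / normal_vec_sq b a) * (cos a)\<^sup>2 / b\<^sup>2
    - ((n - 1) * (sin a)\<^sup>2 / normal_vec_sq b a / b\<^sup>2 - 2 * (n - 4)) * (sin a)\<^sup>2"

lemma polar_gradient_coeff_eq_critical_poly: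
  assumes "b > 0"
  shows "polar_gradient_coeff n b a * (b ^ 4 * normal_vec_sq b a) = critical_poly n (b\<^sup>2) ((sin a)\<^sup>2)"
proof -
  define s where "s = (sin a)\<^sup>2"
  have c: "(cos a)\<^sup>2 = 1 - s" by (simp add: s_def cos_squared_eq)
  define \<beta> where "\<beta> = b\<^sup>2"
  define q where "q = 1 - s + \<beta> * s"
  have \<beta>: "\<beta> > 0" using assms by (simp add: \<beta>_def)
  have D: "normal_vec_sq b a = q / \<beta>"
    using \<beta> unfolding normal_vec_sq_def c s_def[symmetric] \<beta>_def[symmetric] q_def by (simp add: field_simps)
  have q: "q > 0"
    using normal_vec_sq_pos[OF assms, of a] \<beta> unfolding D by (simp add: zero_less_divide_iff)
  have b4: "b ^ 4 = \<beta> * \<beta>" by (simp add: \<beta>_def power2_eq_square power4_eq_xxxx)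
  have "polar_gradient_coeff n b a * (b ^ 4 * normal_vec_sq b a) = 3 * (n - 3) * (1 - s) * q + 2 * (n - 4) * \<beta> * s * q - (n - 1) * \<beta> * s"
    unfolding polar_gradient_coeff_def c s_def[symmetric] D b4 \<beta>_def[symmetric]
    using q \<beta> by (simp add: field_simps)
  also have "\<dots> = critical_poly n (b\<^sup>2) s" by (simp add: critical_poly_def q_def \<beta>_def)
  finally have "polar_gradient_coeff n b a * (b ^ 4 * normal_vec_sq b a) = critical_poly n (b\<^sup>2) s" .
  then show ?thesis by (simp add: s_def)
qed

lemma polar_gradient_coeff_root_iff:
  assumes "n \<ge> 5" "b > 0"
  shows "(\<exists>a\<in>{0<..<pi/2}. polar_gradient_coeff n b a = 0) \<longleftrightarrow> b\<^sup>2 < (n - 1) / (2 * (n - 4))"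
proof -
  have iff: "polar_gradient_coeff n b a = 0 \<longleftrightarrow> critical_poly n (b\<^sup>2) ((sin a)\<^sup>2) = 0" for a
    using polar_gradient_coeff_eq_critical_poly[OF assms(2), of n a] normal_vec_sq_pos[OF assms(2), of a] assms(2) by auto
  have "(\<exists>a\<in>{0<..<pi/2}. polar_gradient_coeff n b a = 0) \<longleftrightarrow> (\<exists>s\<in>{0<..<1}. critical_poly n (b\<^sup>2) s = 0)"
  proof
    assume "\<exists>a\<in>{0<..<pi/2}. polar_gradient_coeff n b a = 0"
    then obtain a where a: "0 < a" "a < pi / 2" "polar_gradient_coeff n b a = 0" by auto
    have "0 < sin a" "0 < cos a" using a by (auto intro!: sin_gt_zero cos_gt_zero_pi)
    then have "0 < (sin a)\<^sup>2" "0 < (cos a)\<^sup>2" by simp_all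
    then have "(sin a)\<^sup>2 \<in> {0<..<1}"
      using sin_cos_squared_add[of a] by (intro greaterThanLessThan_iff[THEN iffD2] conjI) linarith+
    then show "\<exists>s\<in>{0<..<1}. critical_poly n (b\<^sup>2) s = 0" using a(3) iff by blast
  next
    assume "\<exists>s\<in>{0<..<1}. critical_poly n (b\<^sup>2) s = 0"
    then obtain s where s: "0 < s" "s < 1" "critical_poly n (b\<^sup>2) s = 0" by auto
    have r: "0 < sqrt s" "sqrt s < 1" using s by auto
    have "arcsin 0 < arcsin (sqrt s)" "arcsin (sqrt s) < arcsin 1"
      using r by (intro arcsin_less_arcsin; linarith)+
    moreover have "sin (arcsin (sqrt s)) = sqrt s" using r by (intro sin_arcsin) linarith+
    ultimately show "\<exists>a\<in>{0<..<pi/2}. polar_gradient_coeff n b a = 0"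
      using s iff[of "arcsin (sqrt s)"] by (intro bexI[of _ "arcsin (sqrt s)"]) auto
  qed
  then show ?thesis using critical_poly_root_iff[OF assms(1), of "b\<^sup>2"] assms(2) by simp
qed

section \<open>Sufficiency: biharmonicity at a critical angle\<close>

text \<open>The gradient has no component along the sphere directions orthogonal to \<open>(u, 0)\<close> and \<open>(0, 1)\<close>. A tangent vector
  therefore pairs with it through \<open>u \<bullet> fst v\<close> and \<open>snd v\<close> only, which tangency relates by one linear equation:
  all tangent vectors give multiples of the pairing with the polar direction.\<close>

lemma bienergy_gradient_phi_tangent:
  fixes x :: "real ^ 'n" and v :: "(real ^ 'n) \<times> real"
  assumes x: "x \<noteq> 0" and b: "b > 0" and a: "sin a \<noteq> 0" and v: "v \<bullet> normal_vec b (phi b a x) = 0"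
    and critical: "polar_gradient_coeff CARD('n) b a = 0"
  shows "bienergy_gradient b (phi b a) x \<bullet> v = 0"
proof -
  let ?n = "real CARD('n)" and ?c = "tension_coeff CARD('n) b a" and ?D = "normal_vec_sq b a"
  define A where "A = 3 * (?n - 3) - (?n - 1) * (sin a)\<^sup>2 / ?D"
  define B where "B = (?n - 1) * (sin a)\<^sup>2 / ?D / b\<^sup>2 - 2 * (?n - 4)"
  define w where "w = rpow 0 (- 1 / 2) x * (x \<bullet> fst v)"
  have balance: "A * (cos a)\<^sup>2 / b\<^sup>2 = B * (sin a)\<^sup>2" using critical by (simp add: polar_gradient_coeff_def A_def B_def)
  have "sin a * w + cos a / b * snd v = 0"
    using v unfolding normal_vec_phi[OF x] radial_field_def inner_prod_def w_def
    by (simp add: rpow_0[OF x] inner_commute mult_ac)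
  then have w: "sin a * w = - (cos a / b * snd v)" by simp
  have "rpow 0 (- 5 / 2) x * (x \<bullet> fst v) = rpow 0 (- 2) x * w"
    using rpow_add[of 0 "- 2" x "- 1 / 2"] by (simp add: w_def mult.assoc[symmetric])
  then have "bienergy_gradient b (phi b a) x \<bullet> v = ?c * rpow 0 (- 2) x * (A * cos a / b * w + B * sin a * snd v)"
    unfolding bienergy_gradient_phi[OF x b] radial_field_def inner_prod_def A_def[symmetric] B_def[symmetric]
    by (simp add: algebra_simps)
  then have "sin a * (bienergy_gradient b (phi b a) x \<bullet> v)
      = ?c * rpow 0 (- 2) x * (A * cos a / b * (sin a * w) + B * (sin a)\<^sup>2 * snd v)"
    by (simp add: algebra_simps power2_eq_square)
  also have "\<dots> = ?c * rpow 0 (- 2) x * snd v * (B * (sin a)\<^sup>2 - A * (cos a)\<^sup>2 / b\<^sup>2)"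
    unfolding w by (simp add: algebra_simps power2_eq_square)
  also have "\<dots> = 0" using balance by simp
  finally show ?thesis using a by simp
qed

lemma bienergy_gradient_phi_polar:
  fixes x :: "real ^ 'n"
  assumes x: "x \<noteq> 0" and b: "b > 0"
  shows "bienergy_gradient b (phi b a) x \<bullet> radial_field (- 1 / 2) 0 (cos a) (- b * sin a) x
    = tension_coeff CARD('n) b a * b * polar_gradient_coeff CARD('n) b a * rpow 0 (- 2) x"
  unfolding bienergy_gradient_phi[OF x b] radial_field_inner[OF x] polar_gradient_coeff_def
  using b by (simp add: field_simps power2_eq_square)

lemma smooth_map_phi:
  assumes "b > 0" "0 \<notin> U" "open U"
  shows "smooth_map b U (phi b a :: real ^ 'n \<Rightarrow> _)"
proof -
  have U: "U \<subseteq> - {0}" using assms(2) by auto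
  have "Ck_on k U (phi b a :: real ^ 'n \<Rightarrow> _)" for k
    using Ck_on_cong[OF assms(3), of "phi b a" "radial_field (- 1 / 2) 0 (sin a) (b * cos a)"]
      Ck_on_subset[OF Ck_on_radial_field U] phi_eq_radial_field U by blast
  moreover have "phi b a x \<in> ellipsoid b" if "x \<noteq> 0" for x :: "real ^ 'n"
  proof -
    have "norm (sin a *\<^sub>R (x /\<^sub>R norm x)) = \<bar>sin a\<bar>" using that by (simp add: abs_mult)
    then show ?thesis
      using assms(1) sin_cos_squared_add[of a] unfolding phi_def ellipsoid_def
      by (simp only: mem_Collect_eq prod.case) (simp add: power_mult_distrib)
  qed
  then have "phi b a ` U \<subseteq> ellipsoid b" using U by (intro image_subsetI) blast
  ultimately show ?thesis by (simp add: smooth_map_def smooth_on_def)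
qed

text \<open>The last component of the tension field is positive away from the origin.\<close>

lemma not_weakly_harmonic_phi:
  assumes "CARD('n) \<ge> 2" "b > 0" "a \<in> {0<..<pi/2}"
  shows "\<not> weakly_harmonic b (phi b a :: real ^ 'n \<Rightarrow> _)"
proof
  assume "weakly_harmonic b (phi b a :: real ^ 'n \<Rightarrow> _)"
  then have h: "tension b (phi b a) x = 0" if "x \<in> ball 0 1 - {0}" for x :: "real ^ 'n"
    using that unfolding weakly_harmonic_def harmonic_on_def by blast
  obtain e :: "real ^ 'n" where e: "e \<in> Basis" using nonempty_Basis by blast
  define x where "x = (1 / 2) *\<^sub>R e"
  have x: "x \<in> ball 0 1 - {0}" using e by (auto simp: x_def)
  then have x0: "x \<noteq> 0" by simp
  have sc: "0 < sin a" "0 < cos a" using assms(3) by (auto intro!: sin_gt_zero cos_gt_zero_pi)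
  have "tension_coeff CARD('n) b a > 0"
    unfolding tension_coeff_def using sc assms normal_vec_sq_pos[OF assms(2), of a] by simp
  then have "snd (tension b (phi b a) x) > 0"
    unfolding tension_phi[OF x0 assms(2)] radial_field_def using sc rpow_pos[OF x0] by simp
  then show False using h[OF x] by simp
qed

lemma sobolev_into_phi:
  assumes "CARD('n) \<ge> 5" "b > 0"
  shows "sobolev_into 2 (ball 0 1) (ellipsoid b) (phi b a :: real ^ 'n \<Rightarrow> _)"
proof -
  have "AE x in lebesgue. x \<noteq> (0 :: real ^ 'n)" by (rule AE_not_in[of "{0}", simplified]) simp
  then have "AE x in lebesgue. (x :: real ^ 'n) \<in> ball 0 1 \<longrightarrow> phi b a x \<in> ellipsoid b"
  proof eventually_elim
    case (elim x)
    then show ?case using smooth_map_phi[OF assms(2), of "- {0}" a] open_punctured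
      by (auto simp: smooth_map_def)
  qed
  then show ?thesis using sobolev_phi[OF assms(1)] by (simp add: sobolev_into_def)
qed

text \<open>Differentiating the equation of the ellipsoid along the variation shows that variation fields are
  tangential.\<close>

lemma variation_field:
  fixes \<phi> :: "'a::euclidean_space \<Rightarrow> (real ^ 'n) \<times> real"
  assumes "\<epsilon> > 0" "variation b U K \<phi> \<epsilon> \<Phi>" "x \<in> U"
  shows "\<exists>v. ((\<lambda>t. \<Phi> t x) has_vector_derivative v) (at 0) \<and> v \<bullet> normal_vec b (\<phi> x) = 0"
proof -
  define \<Psi> where "\<Psi> = (\<lambda>(t, x). \<Phi> t x)"
  have zero: "0 \<in> {- \<epsilon><..<\<epsilon>}" using assms(1) by simp
  have "Ck_on 1 ({- \<epsilon><..<\<epsilon>} \<times> U) \<Psi>"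
    using assms(2) by (simp add: variation_def smooth_map_def smooth_on_def \<Psi>_def)
  then have "\<Psi> differentiable (at (0, x))"
    by (rule Ck_on_differentiable) (use assms zero in auto)
  from has_vector_derivative_slice[OF this] obtain v where v: "((\<lambda>t. \<Phi> t x) has_vector_derivative v) (at 0)"
    unfolding \<Psi>_def by auto
  have \<Phi>0: "\<Phi> 0 x = \<phi> x" using assms by (simp add: variation_def)
  have ell: "\<Phi> t x \<bullet> normal_vec b (\<Phi> t x) = 1" if "t \<in> {- \<epsilon><..<\<epsilon>}" for t
    using assms(2,3) that unfolding variation_def smooth_map_def ellipsoid_iff[symmetric] by blast
  have "((\<lambda>t. \<Phi> t x \<bullet> normal_vec b (\<Phi> t x)) has_vector_derivative
      \<Phi> 0 x \<bullet> normal_vec b v + v \<bullet> normal_vec b (\<Phi> 0 x)) (at 0)"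
    by (rule bounded_bilinear.has_vector_derivative[OF bounded_bilinear_inner v
          bounded_linear.has_vector_derivative[OF bounded_linear_normal_vec v]])
  moreover have "((\<lambda>t. \<Phi> t x \<bullet> normal_vec b (\<Phi> t x)) has_vector_derivative 0) (at 0)"
    by (rule has_vector_derivative_transform_within_open[OF has_vector_derivative_const _ zero])
      (use ell in auto)
  ultimately have "\<Phi> 0 x \<bullet> normal_vec b v + v \<bullet> normal_vec b (\<Phi> 0 x) = 0"
    using vector_derivative_unique_at by blast
  moreover have "\<phi> x \<bullet> normal_vec b v = v \<bullet> normal_vec b (\<phi> x)"
    by (metis normal_vec_selfadjoint inner_commute)
  ultimately have "v \<bullet> normal_vec b (\<phi> x) = 0" by (simp add: \<Phi>0)
  then show ?thesis using v by blast
qed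

lemma biharmonic_on_phi:
  assumes "b > 0" "sin a \<noteq> 0" "polar_gradient_coeff CARD('n) b a = 0"
  shows "biharmonic_on b (ball 0 1 - {0}) (phi b a :: real ^ 'n \<Rightarrow> _)"
  unfolding biharmonic_on_def
proof (intro conjI allI impI; (elim conjE)?)
  let ?U = "ball 0 1 - {0} :: (real ^ 'n) set"
  have U: "open ?U" "0 \<notin> ?U" by (auto intro: open_delete)
  show "smooth_map b ?U (phi b a)" by (rule smooth_map_phi[OF assms(1) U(2,1)])
  fix K \<epsilon> \<Phi>
  assume K: "compact K" "K \<subseteq> ?U" and \<epsilon>: "\<epsilon> > 0" and var: "variation b ?U K (phi b a) \<epsilon> \<Phi>"
  obtain V where V: "((\<lambda>t. \<Phi> t x) has_vector_derivative V x) (at 0)" "V x \<bullet> normal_vec b (phi b a x) = 0"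
    if "x \<in> ?U" for x
    using variation_field[OF \<epsilon> var] by metis
  have "((\<lambda>t. bienergy b K (\<Phi> t)) has_real_derivative
      (LINT x:K|lebesgue. bienergy_gradient b (phi b a) x \<bullet> V x)) (at 0)"
    by (rule first_variation_of_bienergy[OF U(1) K \<epsilon> var V(1)]) (use K in blast)
  moreover have "(LINT x:K|lebesgue. bienergy_gradient b (phi b a) x \<bullet> V x) = (LINT x:K|lebesgue. 0)"
    unfolding set_lebesgue_integral_def
  proof (intro Bochner_Integration.integral_cong refl)
    fix x
    have "bienergy_gradient b (phi b a) x \<bullet> V x = 0" if "x \<in> K"
    proof -
      have "x \<in> ?U" using that K(2) by blast
      then show ?thesis using bienergy_gradient_phi_tangent[OF _ assms(1,2) V(2) assms(3), of x] by simp
    qed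
    then show "indicator K x *\<^sub>R (bienergy_gradient b (phi b a) x \<bullet> V x) = indicator K x *\<^sub>R (0 :: real)"
      by (cases "x \<in> K") auto
  qed
  ultimately show "((\<lambda>t. bienergy b K (\<Phi> t)) has_real_derivative 0) (at 0)" by simp
qed

section \<open>Necessity: varying the polar angle\<close>

text \<open>The argument of \<open>flat\<close> is positive exactly for \<open>1/4 < |x| < 1/2\<close>.\<close>

definition bump :: "'a::euclidean_space \<Rightarrow> real" where
  "bump x = flat 0 ((x \<bullet> x - 1 / 16) * (1 / 4 - x \<bullet> x))"

definition annulus :: "'a::euclidean_space set" where
  "annulus = {x. 1 / 16 \<le> x \<bullet> x \<and> x \<bullet> x \<le> 1 / 4}"

lemma compact_annulus: "compact (annulus :: 'a::euclidean_space set)"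
proof -
  have "closed (annulus :: 'a set)"
    unfolding annulus_def by (intro closed_Collect_conj closed_Collect_le continuous_intros)
  moreover have "(annulus :: 'a set) \<subseteq> cball 0 1"
    by (auto simp: annulus_def norm_eq_sqrt_inner)
  ultimately show ?thesis using bounded_subset[OF bounded_cball] compact_eq_bounded_closed by blast
qed

lemma annulus_subset: "annulus \<subseteq> ball 0 1 - {0 :: 'a::euclidean_space}"
  by (auto simp: annulus_def norm_eq_sqrt_inner)

lemma Ck_on_bump: "Ck_on k UNIV bump"
  unfolding bump_def[abs_def]
  by (rule Ck_on_compose_real[OF open_UNIV _ _ Ck_on_flat])
    (simp, intro Ck_on_mult Ck_on_diff Ck_on_inner Ck_on_const open_UNIV Ck_on_bounded_linear[OF bounded_linear_ident])

lemma bump_nonneg: "bump x \<ge> 0"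
  by (simp add: bump_def flat_def)

lemma bump_pos: "1 / 16 < x \<bullet> x \<Longrightarrow> x \<bullet> x < 1 / 4 \<Longrightarrow> bump x > 0"
  by (simp add: bump_def flat_def)

lemma bump_zero: "x \<notin> annulus \<Longrightarrow> bump x = 0"
  by (auto simp: bump_def flat_def annulus_def zero_less_mult_iff)

text \<open>A nonnegative continuous function that is positive on a nonempty open set.\<close>

lemma bump_integral_pos: "(LINT x:annulus|lebesgue. rpow 0 (- 2) x * bump (x :: 'a::euclidean_space)) > 0"
proof -
  let ?f = "\<lambda>x::'a. indicator annulus x *\<^sub>R (rpow 0 (- 2) x * bump x)"
  have sub: "(annulus :: 'a set) \<subseteq> - {0}" using annulus_subset by blast
  have c: "continuous_on annulus (\<lambda>x::'a. rpow 0 (- 2) x * bump x)"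
    using continuous_on_subset[OF Ck_on_continuous_on[OF Ck_on_rpow_punctured[of 0]] sub]
      continuous_on_subset[OF Ck_on_continuous_on[OF Ck_on_bump[of 0]] subset_UNIV]
    by (intro continuous_intros)
  have int: "integrable lebesgue ?f"
    using set_integrable_lebesgue_compact[OF compact_annulus c] by (simp add: set_integrable_def)
  have nn: "?f x \<ge> 0" for x using bump_nonneg[of x] by (simp add: indicator_def)
  have "integral\<^sup>L lebesgue ?f \<noteq> 0"
  proof
    assume "integral\<^sup>L lebesgue ?f = 0"
    then have AE: "AE x in lebesgue. ?f x = 0"
      using integral_nonneg_eq_0_iff_AE[OF int] nn by simp
    let ?O = "{x::'a. 1 / 16 < x \<bullet> x \<and> x \<bullet> x < 1 / 4}"
    have O: "open ?O" by (intro open_Collect_conj open_Collect_less continuous_intros)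
    have pos: "?f x > 0" if "x \<in> ?O" for x
    proof -
      have "x \<in> annulus" "x \<noteq> 0" using that by (auto simp: annulus_def)
      then show ?thesis using bump_pos[of x] rpow_pos[of x "- 2"] that by simp
    qed
    from AE have "AE x in lebesgue. x \<notin> ?O" by eventually_elim (use pos in force)
    then have "?O \<in> null_sets lebesgue"
      using O by (subst AE_iff_null_sets) (auto intro: borel_open)
    then have "negligible ?O" by (simp add: negligible_iff_null_sets)
    moreover obtain e :: 'a where "e \<in> Basis" using nonempty_Basis by blast
    \<comment> \<open>\<open>(3/8)\<^sup>2 = 9/64\<close> lies between \<open>1/16\<close> and \<open>1/4\<close>.\<close>
    then have "(3 / 8) *\<^sub>R e \<in> ?O" by (simp add: inner_Basis)
    ultimately show False using open_not_negligible[OF O] by blast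
  qed
  moreover have "integral\<^sup>L lebesgue ?f \<ge> 0" using nn by (rule Bochner_Integration.integral_nonneg)
  ultimately show ?thesis unfolding set_lebesgue_integral_def by simp
qed

text \<open>Changing the angle keeps the image on the ellipsoid, so no projection is required.\<close>

lemma variation_phi:
  assumes "b > 0" "\<epsilon> > 0"
  shows "variation b (ball 0 1 - {0}) annulus (phi b a :: real ^ 'n \<Rightarrow> _) \<epsilon> (\<lambda>t x. phi b (a + t * bump x) x)"
  unfolding variation_def
proof (intro conjI ballI)
  let ?W = "{- \<epsilon><..<\<epsilon>} \<times> (ball 0 1 - {0 :: real ^ 'n})"
  have W: "open ?W" by (intro open_Times open_delete) auto
  define \<theta> where "\<theta> z = a + fst z * bump (snd z)" for z :: "real \<times> (real ^ 'n)"
  have snd: "Ck_on k ?W (\<lambda>z. f (snd z))" if "Ck_on k (- {0}) f" for k and f :: "real ^ 'n \<Rightarrow> 'c::real_normed_vector"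
    using Ck_on_compose_affine[OF W bounded_linear_snd _ that, of 0] by auto
  have \<theta>: "Ck_on k ?W \<theta>" for k
    unfolding \<theta>_def[abs_def]
    by (intro Ck_on_add Ck_on_mult Ck_on_const W Ck_on_bounded_linear[OF bounded_linear_fst] snd
        Ck_on_subset[OF Ck_on_bump subset_UNIV])
  have sc: "Ck_on k ?W (\<lambda>z. sin (\<theta> z))" "Ck_on k ?W (\<lambda>z. cos (\<theta> z))" for k
    by (rule Ck_on_compose_real[OF W UNIV_I \<theta>], simp only: Ck_on_sin_cos)+
  have "Ck_on k ?W (\<lambda>z. (sin (\<theta> z) *\<^sub>R (rpow 0 (- 1 / 2) (snd z) *\<^sub>R snd z), b * cos (\<theta> z)))" for k
    by (rule Ck_on_Pair[OF W Ck_on_scaleR[OF W sc(1) Ck_on_scaleR[OF W snd[OF Ck_on_rpow_punctured]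
            Ck_on_bounded_linear[OF bounded_linear_snd]]] Ck_on_mult[OF W Ck_on_const sc(2)]])
  moreover have "(case z of (t, x) \<Rightarrow> phi b (a + t * bump x) x)
      = (sin (\<theta> z) *\<^sub>R (rpow 0 (- 1 / 2) (snd z) *\<^sub>R snd z), b * cos (\<theta> z))" if "z \<in> ?W" for z
    by (cases z) (simp add: \<theta>_def regularised_phi_def phi_eq_regularised_phi)
  ultimately have "Ck_on k ?W (\<lambda>(t, x). phi b (a + t * bump x) x)" for k
    by (subst Ck_on_cong[OF W])
  moreover have "phi b \<alpha> x \<in> ellipsoid b" if "x \<noteq> 0" for \<alpha> and x :: "real ^ 'n"
    using smooth_map_phi[OF assms(1), of "- {0}" \<alpha>] open_punctured that by (auto simp: smooth_map_def)
  then have "(\<lambda>(t, x). phi b (a + t * bump x) x) ` ?W \<subseteq> ellipsoid b"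
    by (intro image_subsetI) force
  ultimately show "smooth_map b ?W (\<lambda>(t, x). phi b (a + t * bump x) x)"
    by (simp add: smooth_map_def smooth_on_def)
qed (auto simp: bump_zero)

text \<open>For this variation the first variation is the coefficient times the positive number of
  \<open>bump_integral_pos\<close>, up to a nonzero constant.\<close>

lemma polar_gradient_coeff_of_biharmonic_on_phi:
  assumes "CARD('n) \<ge> 2" "b > 0" "a \<in> {0<..<pi/2}"
    and bih: "biharmonic_on b (ball 0 1 - {0}) (phi b a :: real ^ 'n \<Rightarrow> _)"
  shows "polar_gradient_coeff CARD('n) b a = 0"
proof -
  let ?U = "ball 0 1 - {0} :: (real ^ 'n) set" and ?c = "tension_coeff CARD('n) b a"
  let ?\<Phi> = "\<lambda>t (x :: real ^ 'n). phi b (a + t * bump x) x"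
  define V where "V x = bump x *\<^sub>R radial_field (- 1 / 2) 0 (cos a) (- b * sin a) x" for x :: "real ^ 'n"
  have U: "open ?U" by (auto intro: open_delete)
  have var: "variation b ?U annulus (phi b a) 1 ?\<Phi>" by (rule variation_phi[OF assms(2)]) simp
  have "((\<lambda>t. ?\<Phi> t x) has_vector_derivative V x) (at 0)" if "x \<in> annulus" for x
  proof -
    have x: "x \<noteq> 0" using that annulus_subset by blast
    have "((\<lambda>t. sin (a + t * bump x)) has_vector_derivative bump x * cos a) (at 0)"
      "((\<lambda>t. b * cos (a + t * bump x)) has_vector_derivative bump x * (- b * sin a)) (at 0)"
      unfolding has_real_derivative_iff_has_vector_derivative[symmetric]
      by (auto intro!: derivative_eq_intros)
    then have "((\<lambda>t. (sin (a + t * bump x) *\<^sub>R (rpow 0 (- 1 / 2) x *\<^sub>R x), (b * cos (a + t * bump x)) * rpow 0 0 x))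
        has_vector_derivative ((bump x * cos a) *\<^sub>R (rpow 0 (- 1 / 2) x *\<^sub>R x), (bump x * (- b * sin a)) * rpow 0 0 x)) (at 0)"
      by (intro has_vector_derivative_Pair bounded_linear.has_vector_derivative[OF bounded_linear_scaleR_left]
          bounded_linear.has_vector_derivative[OF bounded_linear_mult_left])
    then have "((\<lambda>t. radial_field (- 1 / 2) 0 (sin (a + t * bump x)) (b * cos (a + t * bump x)) x)
        has_vector_derivative V x) (at 0)"
      unfolding radial_field_def V_def by (simp add: mult.assoc)
    then show ?thesis by (simp add: phi_eq_radial_field[OF x])
  qed
  then have "((\<lambda>t. bienergy b annulus (?\<Phi> t)) has_real_derivative
      (LINT x:annulus|lebesgue. bienergy_gradient b (phi b a) x \<bullet> V x)) (at 0)"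
    by (rule first_variation_of_bienergy[OF U compact_annulus annulus_subset zero_less_one var])
  moreover have "((\<lambda>t. bienergy b annulus (?\<Phi> t)) has_real_derivative 0) (at 0)"
    by (rule bih[unfolded biharmonic_on_def, THEN conjunct2, rule_format, of annulus 1 ?\<Phi>])
      (intro conjI compact_annulus annulus_subset zero_less_one var)
  ultimately have "0 = (LINT x:annulus|lebesgue. bienergy_gradient b (phi b a) x \<bullet> V x)"
    using DERIV_unique by blast
  also have "\<dots> = (LINT x:annulus|lebesgue. (?c * b * polar_gradient_coeff CARD('n) b a) * (rpow 0 (- 2) x * bump (x :: real ^ 'n)))"
    unfolding set_lebesgue_integral_def
  proof (intro Bochner_Integration.integral_cong refl)
    fix x :: "real ^ 'n"
    show "indicator annulus x *\<^sub>R (bienergy_gradient b (phi b a) x \<bullet> V x)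
        = indicator annulus x *\<^sub>R ((?c * b * polar_gradient_coeff CARD('n) b a) * (rpow 0 (- 2) x * bump x))"
    proof (cases "x \<in> annulus")
      case True
      then have "x \<noteq> 0" using annulus_subset by blast
      from bienergy_gradient_phi_polar[OF this assms(2), of a] show ?thesis by (simp add: V_def)
    qed simp
  qed
  also have "\<dots> = (?c * b * polar_gradient_coeff CARD('n) b a) * (LINT x:annulus|lebesgue. rpow 0 (- 2) x * bump (x :: real ^ 'n))"
    by simp
  finally have "?c * b * polar_gradient_coeff CARD('n) b a = 0" using bump_integral_pos[where 'a="real ^ 'n"] by auto
  moreover have "0 < sin a" "0 < cos a" using assms(3) by (auto intro!: sin_gt_zero cos_gt_zero_pi)
  then have "?c > 0"
    unfolding tension_coeff_def using assms normal_vec_sq_pos[OF assms(2), of a] by simp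
  ultimately show ?thesis using assms(2) by simp
qed

theorem theorem1p7:
  fixes b :: real
  assumes "CARD('n::finite) \<ge> 5" and "b > 0"
  shows "(\<exists>a\<in>{0<..<pi/2}. proper_weakly_biharmonic b (phi b a :: real ^ 'n \<Rightarrow> (real ^ 'n) \<times> real))
    \<longleftrightarrow> 0 < b\<^sup>2 \<and> b\<^sup>2 < (real CARD('n) - 1) / (2 * (real CARD('n) - 4))"
proof -
  have iff: "proper_weakly_biharmonic b (phi b a :: real ^ 'n \<Rightarrow> (real ^ 'n) \<times> real) \<longleftrightarrow> polar_gradient_coeff CARD('n) b a = 0"
    if a: "a \<in> {0<..<pi/2}" for a
  proof
    assume "proper_weakly_biharmonic b (phi b a :: real ^ 'n \<Rightarrow> _)"
    then show "polar_gradient_coeff CARD('n) b a = 0"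
      using polar_gradient_coeff_of_biharmonic_on_phi[where 'n='n, OF _ assms(2) a] assms(1)
      unfolding proper_weakly_biharmonic_def weakly_biharmonic_def by simp
  next
    assume critical: "polar_gradient_coeff CARD('n) b a = 0"
    have "sin a > 0" using a by (auto intro!: sin_gt_zero)
    then have "biharmonic_on b (ball 0 1 - {0}) (phi b a :: real ^ 'n \<Rightarrow> _)"
      by (intro biharmonic_on_phi[OF assms(2) _ critical]) simp
    then show "proper_weakly_biharmonic b (phi b a :: real ^ 'n \<Rightarrow> _)"
      using sobolev_into_phi[OF assms, of a] not_weakly_harmonic_phi[OF _ assms(2) a, where 'n='n] assms(1)
      by (simp add: proper_weakly_biharmonic_def weakly_biharmonic_def)
  qed
  have "real CARD('n) \<ge> 5" using assms(1) by simp
  from polar_gradient_coeff_root_iff[OF this assms(2)] iff assms(2) show ?thesis by simp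
qed

end
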